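(* Let $H:\mathbb{R}_+\to\mathbb{R}$ be a strictly convex function that is smooth on $\mathbb{R}_+^*$ and satisfies $H(0)=0$. On $\mathbb{R}_+^*$ define $\psi=H'$, $U(x)=xH'(x)-H(x)$ and $U_2(x)=xU'(x)-U(x)$. Let $\overline\Omega\subset\mathbb{R}^d$ be a closed convex set and let $v:\overline\Omega\to\mathbb{R}_+^*$ be a smooth, positive, integrable function. Assume that $U_2+\frac1d U\ge 0$ on $\mathbb{R}_+^*$, and that there is a constant $C>0$ such that $-\nabla^2(\psi(v))\ge C I_d$ on $\overline\Omega$ (as symmetric matrices). Then for every positive function $u\in C^\infty(\overline\Omega)$ such that $\int_\Omega u=\int_\Omega v$, $$\int_\Omega \Big(H(u)-H(v)-(u-v)\psi(v)\Big)\le \frac{1}{2C}\int_\Omega u\,\|\nabla(\psi(u)-\psi(v))\|^2 .$$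
   Context: $\mathbb{R}_+=[0,\infty)$, $\mathbb{R}_+^*=(0,\infty)$. $\Omega$ is the interior of the closed convex set $\overline\Omega$; functions in $C^\infty(\overline\Omega)$ are smooth up to the boundary and need not vanish on $\partial\Omega$. All integrals over $\Omega$ are with respect to Lebesgue measure; $\|\cdot\|$ is the Euclidean norm, $\nabla^2$ the Hessian and $I_d$ the identity matrix. *)

theory Defs
  imports "HOL-Analysis.Analysis"
begin

section \<open>The convex function and its associated functions\<close>

definition strictly_convex_on :: "'a::real_vector set \<Rightarrow> ('a \<Rightarrow> real) \<Rightarrow> bool" where
  "strictly_convex_on S f \<longleftrightarrow> convex S \<and>
     (\<forall>x\<in>S. \<forall>y\<in>S. \<forall>t. x \<noteq> y \<and> 0 < t \<and> t < 1 \<longrightarrow>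
        f ((1 - t) *\<^sub>R x + t *\<^sub>R y) < (1 - t) * f x + t * f y)"

text \<open>Meant for open sets: \<^const>\<open>deriv\<close> is the two-sided derivative.\<close>

definition smooth_real_on :: "real set \<Rightarrow> (real \<Rightarrow> real) \<Rightarrow> bool" where
  "smooth_real_on S f \<longleftrightarrow> (\<forall>n. \<forall>x\<in>S. (deriv ^^ n) f differentiable (at x))"

definition psi_of :: "(real \<Rightarrow> real) \<Rightarrow> real \<Rightarrow> real" where
  "psi_of H x = deriv H x"

definition U_of :: "(real \<Rightarrow> real) \<Rightarrow> real \<Rightarrow> real" where
  "U_of H x = x * deriv H x - H x"

definition U2_of :: "(real \<Rightarrow> real) \<Rightarrow> real \<Rightarrow> real" where
  "U2_of H x = x * deriv (U_of H) x - U_of H x"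


section \<open>Smoothness up to the boundary, gradient and Hessian\<close>

definition partial_deriv :: "'n::finite \<Rightarrow> (real ^ 'n \<Rightarrow> real) \<Rightarrow> real ^ 'n \<Rightarrow> real" where
  "partial_deriv i f x = frechet_derivative f (at x) (axis i 1)"

definition partial_derivs :: "'n::finite list \<Rightarrow> (real ^ 'n \<Rightarrow> real) \<Rightarrow> real ^ 'n \<Rightarrow> real" where
  "partial_derivs is f = foldr partial_deriv is f"

text \<open>
  Here \<open>S\<close> plays the role of the closed set \<open>\<Omega>\<close>-bar, and its interior that of \<open>\<Omega>\<close>:
  \<open>f\<close> is infinitely differentiable in the interior, and \<open>f\<close> and all its partial derivatives
  extend continuously to \<open>S\<close> (for \<open>f\<close> itself, by its own boundary values). No bounds are imposed,
  and values of \<open>f\<close> outside \<open>S\<close> are irrelevant.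
\<close>

definition smooth_up_to_boundary :: "(real ^ 'n::finite) set \<Rightarrow> (real ^ 'n \<Rightarrow> real) \<Rightarrow> bool" where
  "smooth_up_to_boundary S f \<longleftrightarrow> continuous_on S f \<and>
     (\<forall>is. (\<forall>x\<in>interior S. partial_derivs is f differentiable (at x)) \<and>
           (\<exists>g. continuous_on S g \<and> (\<forall>x\<in>interior S. g x = partial_derivs is f x)))"

definition gradient :: "(real ^ 'n::finite \<Rightarrow> real) \<Rightarrow> real ^ 'n \<Rightarrow> real ^ 'n" where
  "gradient f x = (\<chi> i. partial_deriv i f x)"

text \<open>
  The Hessian on all of \<open>S\<close>: at a boundary point the second derivatives are the limits taken
  from the interior; at an interior point of continuity of the second derivatives the limit is
  just their value.
\<close>

definition hessian_on :: "(real ^ 'n::finite) set \<Rightarrow> (real ^ 'n \<Rightarrow> real) \<Rightarrow> real ^ 'n \<Rightarrow> real ^ 'n ^ 'n"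
  where
  "hessian_on S f x = (\<chi> i j. Lim (at x within interior S) (partial_derivs [i, j] f))"

text \<open>The Loewner order on symmetric matrices (symmetry itself is not part of the definition).\<close>

definition loewner_le :: "real ^ 'n::finite ^ 'n \<Rightarrow> real ^ 'n ^ 'n \<Rightarrow> bool" where
  "loewner_le A B \<longleftrightarrow> (\<forall>\<xi>. 0 \<le> \<xi> \<bullet> ((B - A) *v \<xi>))"

end

theory Submission
  imports Defs
begin

text \<open>
  Write \<open>\<psi> = H'\<close> and \<open>V = - \<psi>(v)\<close>, so that the integrand on the left is
  \<open>H(u) + u V + U(v)\<close>. Suppose that a map \<open>T\<close> carries the density \<open>u\<close> to the density \<open>v\<close>, and that
  its Jacobian matrix is triangular with positive diagonal entries \<open>D\<^sub>i\<close>, so that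
  \<open>u = v(T) \<Prod>\<^sub>i D\<^sub>i\<close>. Three facts give the inequality.

  \<^item> The hypothesis on \<open>U\<^sub>2 + U/d\<close> says that \<open>\<lambda> \<mapsto> \<lambda>^d H(r/\<lambda>^d)\<close> is convex. Its tangent at
    \<open>\<lambda> = 1\<close> and the inequality between the geometric and the arithmetic mean of the \<open>D\<^sub>i\<close> bound
    \<open>u H(v(T))/v(T)\<close> from below by \<open>H(u) - U(u) (div T - d)\<close> (\<open>transport_tangent\<close>).
  \<^item> The Hessian hypothesis gives
    \<open>V(T) \<ge> V(x) + \<nabla>V(x) \<bullet> (T - x) + C/2 |T - x|^2\<close> (\<open>strongly_concave_of_hessian\<close>).
  \<^item> Integrating \<open>U(u) div(T - x)\<close> by parts produces \<open>- u \<nabla>\<psi>(u) \<bullet> (T - x)\<close>, because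
    \<open>\<nabla>U(u) = u \<nabla>\<psi>(u)\<close>, and a boundary term of favourable sign, because \<open>T\<close> maps into a convex set.

  Adding these, using \<open>\<integral> u k(T) = \<integral> v k\<close> for \<open>k = U(v)/v\<close>, leaves
  \<open>- \<integral> u \<nabla>(\<psi>(u) - \<psi>(v)) \<bullet> (T - x) - C/2 \<integral> u |T - x|^2\<close> as an upper bound for the left-hand side,
  and completing the square finishes the argument.

  Only the diagonal derivatives of \<open>T\<close> enter, so \<open>T\<close> need not be the optimal map: the Knothe
  rearrangement is enough, and it is obtained by solving one scalar equation per coordinate
  (\<open>triangular_transport_exists\<close>). It is constructed between positive continuous densities on a
  box. A compact convex set \<open>L\<close> is put inside a box, \<open>u\<close> and \<open>v\<close> are extended from \<open>L\<close> by composition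
  with the closest-point projection and a decaying factor, and the boundary term is handled by a
  cutoff (\<open>concave_cutoff_exists\<close>). Where \<open>T(x)\<close> leaves \<open>L\<close> it is replaced by the closest point
  of \<open>L\<close>, which preserves the pointwise inequality and costs an error that vanishes with the mass
  outside \<open>L\<close>. The outcome is \<open>bounded_entropy_inequality\<close>.

  Finally the interior of \<open>S\<close> is exhausted by compact convex sets. The masses of \<open>u\<close> and \<open>v\<close> on such
  a set need not agree, so \<open>v\<close> is replaced by \<open>\<psi>\<inverse>(\<psi>(v) + c)\<close> with a constant \<open>c\<close> chosen to balance
  them (\<open>mass_balance\<close>); this leaves the Hessian of \<open>\<psi>(v)\<close> untouched. The constants tend to \<open>0\<close>, and
  since the integrand on the left is nonnegative, Fatou's lemma gives the theorem.
\<close>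

section \<open>Integration along one coordinate of a box\<close>

text \<open>
  A box is invariant under moving one coordinate within its range, and all iterated integrals are
  expressed through this operation: a function of fewer coordinates is a function on the same box
  that does not change under \<open>upd\<close> in the others. One index type therefore serves for every
  dimension in the inductive construction of the transport map.
\<close>
definition upd :: "real ^ 'n \<Rightarrow> 'n \<Rightarrow> real \<Rightarrow> real ^ 'n::finite" where
  "upd x i s = (\<chi> j. if j = i then s else x $ j)"

lemma upd_nth: "upd x i s $ j = (if j = i then s else x $ j)"
  by (simp add: upd_def)

lemma upd_simps [simp]:
  "upd x i s $ i = s" "upd x i (x $ i) = x" "upd (upd x i s) i t = upd x i t"
  "j \<noteq> i \<Longrightarrow> upd x i s $ j = x $ j"
  by (auto simp: upd_def vec_eq_iff)

lemma upd_commute: "i \<noteq> j \<Longrightarrow> upd (upd x i s) j t = upd (upd x j t) i s"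
  by (auto simp: upd_def vec_eq_iff)

lemma upd_in_cbox: "x \<in> cbox a b \<Longrightarrow> s \<in> {a $ i..b $ i} \<Longrightarrow> upd x i s \<in> cbox a b"
  by (auto simp: mem_box_cart upd_nth)

lemma continuous_on_upd [continuous_intros]:
  assumes "continuous_on A f" "continuous_on A g"
  shows "continuous_on A (\<lambda>z. upd (f z) i (g z))"
  unfolding upd_def
proof (rule continuous_on_vec_lambda)
  fix j show "continuous_on A (\<lambda>z. if j = i then g z else f z $ j)"
    using assms by (cases "j = i") (auto intro!: continuous_intros)
qed

text \<open>
  The map \<open>(x, s) \<mapsto> (upd x i s, x $ i)\<close> exchanges two coordinates, so it is an involution that
  preserves boxes and their volumes.
\<close>
lemma integral_coordinate_swap:
  fixes f :: "real ^ 'n::finite \<Rightarrow> real"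
  assumes cont: "continuous_on (cbox a b) f"
  shows "integral (cbox (a, a $ i) (b, b $ i)) (\<lambda>z. f (upd (fst z) i (snd z)))
       = integral (cbox (a, a $ i) (b, b $ i)) (\<lambda>z. f (fst z))"
proof -
  define g :: "(real ^ 'n) \<times> real \<Rightarrow> (real ^ 'n) \<times> real" where "g z = (upd (fst z) i (snd z), fst z $ i)" for z
  have gg: "g (g z) = z" for z by (simp add: g_def)
  have img: "g ` cbox (u, s) (v, t) = cbox (upd u i s, u $ i) (upd v i t, v $ i)" for u v s t
  proof -
    have "g ` cbox (u, s) (v, t) \<subseteq> cbox (upd u i s, u $ i) (upd v i t, v $ i)" for u v s t
      by (auto simp: g_def cbox_Pair_eq mem_box_cart upd_nth split: if_splits)
    note sub = this
    have "g ` g ` cbox (upd u i s, u $ i) (upd v i t, v $ i) \<subseteq> g ` cbox (u, s) (v, t)"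
      using sub[of "upd u i s" "u $ i" "upd v i t" "v $ i"] by (intro image_mono) simp
    then show ?thesis
      using sub[of u s v t] by (auto simp: image_image gg)
  qed
  have box_img: "\<exists>w z. g ` cbox p q = cbox w z" for p q
    using img by (cases p, cases q) blast
  have cont_g: "measure lborel (g ` cbox z w) = 1 * measure lborel (cbox z w)" for z w
  proof -
    obtain u s v t where z: "z = (u, s)" "w = (v, t)" by (cases z, cases w)
    show ?thesis
    proof (cases "cbox z w = {}")
      case True then show ?thesis by simp
    next
      case False
      then have ne: "cbox u v \<noteq> {}" "s \<le> t" unfolding z by (auto simp: cbox_Pair_eq)
      have le: "u $ j \<le> v $ j" for j using ne(1) by (simp add: interval_ne_empty_cart)
      have ne': "cbox (upd u i s) (upd v i t) \<noteq> {}"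
        using le ne by (auto simp: interval_ne_empty_cart upd_nth)
      have 1: "(\<Prod>j\<in>UNIV. v $ j - u $ j) = (v $ i - u $ i) * (\<Prod>j\<in>UNIV - {i}. v $ j - u $ j)"
        by (subst prod.remove[of _ i]) auto
      have 2: "(\<Prod>j\<in>UNIV. upd v i t $ j - upd u i s $ j) = (t - s) * (\<Prod>j\<in>UNIV - {i}. v $ j - u $ j)"
        by (subst prod.remove[of _ i]) (auto intro!: prod.cong)
      show ?thesis unfolding z img content_Pair
        using ne ne' le[of i] by (simp add: content_cbox_cart 1 2)
    qed
  qed
  have ab: "upd a i (a $ i) = a" "upd b i (b $ i) = b" by simp_all
  have "continuous_on UNIV g" unfolding g_def by (intro continuous_intros)
  then have cg: "isCont g z" for z by (metis continuous_on_eq_continuous_at open_UNIV UNIV_I)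
  let ?f = "\<lambda>z. f (fst z)"
  have "continuous_on (cbox (a, a $ i) (b, b $ i)) ?f"
    by (intro continuous_on_compose2[OF cont] continuous_intros) (auto simp: cbox_Pair_eq)
  then have "(?f has_integral integral (cbox (a, a $ i) (b, b $ i)) ?f) (cbox (a, a $ i) (b, b $ i))"
    by (intro integrable_integral integrable_continuous)
  from has_integral_twiddle[of 1 g g, OF _ gg gg cg _ _ cont_g this]
  have "((\<lambda>z. ?f (g z)) has_integral integral (cbox (a, a $ i) (b, b $ i)) ?f) (g ` cbox (a, a $ i) (b, b $ i))"
    using box_img by simp
  then show ?thesis unfolding img by (simp add: g_def integral_unique)
qed

text \<open>
  Fubini's theorem for a single coordinate, in a form that does not leave the box: averaging over
  one coordinate does not change the integral.
\<close>
lemma integral_average_coordinate: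
  fixes f :: "real ^ 'n::finite \<Rightarrow> real"
  assumes cont: "continuous_on (cbox a b) f" and le: "a $ i \<le> b $ i"
  shows "integral (cbox a b) (\<lambda>x. integral {a $ i..b $ i} (\<lambda>s. f (upd x i s))) = (b $ i - a $ i) * integral (cbox a b) f"
proof -
  have c1: "continuous_on (cbox (a, a $ i) (b, b $ i)) (\<lambda>z. f (upd (fst z) i (snd z)))"
    by (intro continuous_on_compose2[OF cont] continuous_intros) (auto simp: cbox_Pair_eq intro!: upd_in_cbox)
  have c2: "continuous_on (cbox (a, a $ i) (b, b $ i)) (\<lambda>z. f (fst z))"
    by (intro continuous_on_compose2[OF cont] continuous_intros) (auto simp: cbox_Pair_eq)
  have "integral (cbox a b) (\<lambda>x. integral {a $ i..b $ i} (\<lambda>s. f (upd x i s)))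
      = integral (cbox (a, a $ i) (b, b $ i)) (\<lambda>z. f (fst z))"
    using integral_prod_continuous[OF c1] integral_coordinate_swap[OF cont, of i] by simp
  also have "\<dots> = integral (cbox a b) (\<lambda>x. (b $ i - a $ i) * f x)"
    using integral_prod_continuous[OF c2] le by simp
  finally show ?thesis by simp
qed

section \<open>Monotone rearrangement of positive densities on an interval\<close>

text \<open>
  The monotone map that carries the normalised density \<open>p\<close> to the normalised density \<open>q\<close>, given by
  equality of the distribution functions. Both sides are multiplied by the total masses, so that
  densities of different mass are allowed.
\<close>
definition rearrangement :: "real \<Rightarrow> real \<Rightarrow> (real \<Rightarrow> real) \<Rightarrow> (real \<Rightarrow> real) \<Rightarrow> real \<Rightarrow> real" where
  "rearrangement \<alpha> \<beta> p q s = (THE t. t \<in> {\<alpha>..\<beta>} \<and>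
     integral {\<alpha>..t} q * integral {\<alpha>..\<beta>} p = integral {\<alpha>..\<beta>} q * integral {\<alpha>..s} p)"

lemma rearrangement_cong:
  assumes "\<And>s. s \<in> {\<alpha>..\<beta>} \<Longrightarrow> p s = p' s" "\<And>s. s \<in> {\<alpha>..\<beta>} \<Longrightarrow> q s = q' s" "s \<in> {\<alpha>..\<beta>}"
  shows "rearrangement \<alpha> \<beta> p q s = rearrangement \<alpha> \<beta> p' q' s"
proof -
  have "integral {\<alpha>..t} p = integral {\<alpha>..t} p'" "integral {\<alpha>..t} q = integral {\<alpha>..t} q'" if "t \<in> {\<alpha>..\<beta>}" for t
    using that assms by (auto intro!: integral_cong)
  moreover have "\<beta> \<in> {\<alpha>..\<beta>}" using assms(3) by auto
  ultimately show ?thesis unfolding rearrangement_def using assms(3)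
    by (intro arg_cong[where f=The] ext) metis
qed

lemma integral_pos_interval:
  fixes p :: "real \<Rightarrow> real"
  assumes "continuous_on {\<alpha>..\<beta>} p" "\<forall>s\<in>{\<alpha>..\<beta>}. 0 < p s" "\<alpha> < \<beta>"
  shows "0 < integral {\<alpha>..\<beta>} p"
proof -
  have "integral {\<alpha>..\<beta>} (\<lambda>_. 0) < integral {\<alpha>..\<beta>} p"
    by (rule integral_less_real) (use assms in auto)
  then show ?thesis by simp
qed

lemma integral_strict_mono_interval:
  fixes q :: "real \<Rightarrow> real"
  assumes c: "continuous_on {\<alpha>..\<beta>} q" and pos: "\<forall>s\<in>{\<alpha>..\<beta>}. 0 < q s"
    and "\<alpha> \<le> s" "s < t" "t \<le> \<beta>"
  shows "integral {\<alpha>..s} q < integral {\<alpha>..t} q"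
proof -
  have "integral {\<alpha>..s} q + integral {s..t} q = integral {\<alpha>..t} q"
    using assms by (intro Henstock_Kurzweil_Integration.integral_combine integrable_continuous_real continuous_on_subset[OF c]) auto
  moreover have "0 < integral {s..t} q"
    using assms by (intro integral_pos_interval continuous_on_subset[OF c]) auto
  ultimately show ?thesis by simp
qed

lemma rearrangement_eq:
  fixes p q :: "real \<Rightarrow> real"
  assumes ab: "\<alpha> < \<beta>"
    and p: "continuous_on {\<alpha>..\<beta>} p" "\<forall>s\<in>{\<alpha>..\<beta>}. 0 < p s"
    and q: "continuous_on {\<alpha>..\<beta>} q" "\<forall>s\<in>{\<alpha>..\<beta>}. 0 < q s"
    and s: "s \<in> {\<alpha>..\<beta>}"
  shows "rearrangement \<alpha> \<beta> p q s = t \<longleftrightarrow> t \<in> {\<alpha>..\<beta>} \<and>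
     integral {\<alpha>..t} q * integral {\<alpha>..\<beta>} p = integral {\<alpha>..\<beta>} q * integral {\<alpha>..s} p" (is "_ \<longleftrightarrow> ?R t")
proof -
  have P: "0 < integral {\<alpha>..\<beta>} p" and Q: "0 < integral {\<alpha>..\<beta>} q"
    using integral_pos_interval p q ab by blast+
  have uniq: "t = t'" if "?R t" "?R t'" for t t'
  proof -
    have "integral {\<alpha>..t} q * integral {\<alpha>..\<beta>} p = integral {\<alpha>..t'} q * integral {\<alpha>..\<beta>} p"
      using that by (metis (no_types))
    then have "integral {\<alpha>..t} q = integral {\<alpha>..t'} q" using P by simp
    then show ?thesis using integral_strict_mono_interval[OF q, of t t'] integral_strict_mono_interval[OF q, of t' t] that
      by (cases t t' rule: linorder_cases) auto
  qed
  let ?F = "\<lambda>t. integral {\<alpha>..t} q * integral {\<alpha>..\<beta>} p"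
  have c: "continuous_on {\<alpha>..\<beta>} ?F"
    by (intro continuous_intros indefinite_integral_continuous_1 integrable_continuous_real q)
  have ps: "0 \<le> integral {\<alpha>..s} p" "integral {\<alpha>..s} p \<le> integral {\<alpha>..\<beta>} p"
  proof -
    show "0 \<le> integral {\<alpha>..s} p" using s p
      by (intro integral_nonneg integrable_continuous_real continuous_on_subset[OF p(1)]) (auto intro: less_imp_le)
    show "integral {\<alpha>..s} p \<le> integral {\<alpha>..\<beta>} p"
      using integral_strict_mono_interval[OF p, of s \<beta>] s by (cases "s = \<beta>") auto
  qed
  have "\<exists>t\<ge>\<alpha>. t \<le> \<beta> \<and> ?F t = integral {\<alpha>..\<beta>} q * integral {\<alpha>..s} p"
    using ps P Q ab by (intro IVT' c) (auto intro!: mult_left_mono)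
  then obtain t0 where t0: "?R t0" by auto
  have "rearrangement \<alpha> \<beta> p q s = t0" unfolding rearrangement_def
    using t0 uniq by (intro the_equality) blast+
  then show ?thesis using t0 uniq by blast
qed

text \<open>
  Rescaling \<open>{\<alpha>..t}\<close> to the unit interval turns the variable upper limit into a parameter of the
  integrand.
\<close>
lemma continuous_on_integral_upper_limit:
  fixes q :: "'a::topological_space \<Rightarrow> real \<Rightarrow> real"
  assumes c: "continuous_on (X \<times> {\<alpha>..\<beta>}) (\<lambda>(x, t). q x t)"
  shows "continuous_on (X \<times> {\<alpha>..\<beta>}) (\<lambda>(x, t). integral {\<alpha>..t} (q x))"
proof -
  have "integral {\<alpha>..t} (q x) = (t - \<alpha>) * integral (cbox 0 1) (\<lambda>r. q x (\<alpha> + r * (t - \<alpha>)))"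
    if "x \<in> X" "t \<in> {\<alpha>..\<beta>}" for x t
  proof -
    have qx: "continuous_on {\<alpha>..\<beta>} (q x)"
      using that by (intro continuous_on_compose2[OF c, of _ "\<lambda>t. (x, t)", simplified] continuous_intros) auto
    have in_range: "\<alpha> + r * (t - \<alpha>) \<in> {\<alpha>..t}" if "r \<in> {0..1}" for r
    proof -
      have "0 \<le> r * (t - \<alpha>)" "r * (t - \<alpha>) \<le> t - \<alpha>"
        using that \<open>t \<in> {\<alpha>..\<beta>}\<close> by (auto simp: mult_left_le_one_le)
      then show ?thesis by auto
    qed
    have "((\<lambda>r. (t - \<alpha>) *\<^sub>R q x (\<alpha> + r * (t - \<alpha>))) has_integral (integral {\<alpha> + 0 * (t - \<alpha>)..\<alpha> + 1 * (t - \<alpha>)} (q x))) {0..1}"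
      using in_range \<open>t \<in> {\<alpha>..\<beta>}\<close>[unfolded atLeastAtMost_iff]
      by (intro has_integral_substitution[where c = \<alpha> and d = t] continuous_on_subset[OF qx])
         (auto intro!: derivative_eq_intros simp del: atLeastAtMost_iff)
    from integral_unique[OF this] show ?thesis by simp
  qed
  moreover have "continuous_on (X \<times> {\<alpha>..\<beta>}) (\<lambda>z. (snd z - \<alpha>) * integral (cbox 0 1) (\<lambda>r. q (fst z) (\<alpha> + r * (snd z - \<alpha>))))"
  proof (intro continuous_intros integral_continuous_on_param)
    have "\<alpha> + r * (t - \<alpha>) \<in> {\<alpha>..\<beta>}" if "t \<in> {\<alpha>..\<beta>}" "r \<in> {0..1}" for r t
    proof -
      have "0 \<le> r * (t - \<alpha>)" "r * (t - \<alpha>) \<le> t - \<alpha>" using that by (auto simp: mult_left_le_one_le)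
      then show ?thesis using that by auto
    qed
    then show "continuous_on ((X \<times> {\<alpha>..\<beta>}) \<times> cbox 0 1) (\<lambda>(z, r). q (fst z) (\<alpha> + r * (snd z - \<alpha>)))"
      unfolding split_beta
      by (intro continuous_on_compose2[OF c, of _ "\<lambda>w. (fst (fst w), \<alpha> + snd w * (snd (fst w) - \<alpha>))", simplified split_beta fst_conv snd_conv] continuous_intros) auto
  qed
  ultimately show ?thesis
    by (rule_tac continuous_on_eq[rotated]) (auto simp: split_beta)
qed

text \<open>
  The graph is the zero set of a continuous function of \<open>(x, s, t)\<close>, hence closed, and a function
  with closed graph and values in a compact set is continuous.
\<close>
lemma continuous_on_rearrangement:
  fixes p q :: "'a::euclidean_space \<Rightarrow> real \<Rightarrow> real"
  assumes ab: "\<alpha> < \<beta>" and X: "closed X"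
    and p: "continuous_on (X \<times> {\<alpha>..\<beta>}) (\<lambda>(x, t). p x t)" "\<And>x. x \<in> X \<Longrightarrow> \<forall>s\<in>{\<alpha>..\<beta>}. 0 < p x s"
    and q: "continuous_on (X \<times> {\<alpha>..\<beta>}) (\<lambda>(x, t). q x t)" "\<And>x. x \<in> X \<Longrightarrow> \<forall>s\<in>{\<alpha>..\<beta>}. 0 < q x s"
  shows "continuous_on (X \<times> {\<alpha>..\<beta>}) (\<lambda>(x, s). rearrangement \<alpha> \<beta> (p x) (q x) s)"
proof -
  have px: "continuous_on {\<alpha>..\<beta>} (p x)" and qx: "continuous_on {\<alpha>..\<beta>} (q x)" if "x \<in> X" for x
    using that by (auto intro!: continuous_on_compose2[OF p(1), of _ "\<lambda>t. (x, t)", simplified]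
        continuous_on_compose2[OF q(1), of _ "\<lambda>t. (x, t)", simplified] continuous_intros)
  note eq = rearrangement_eq[OF ab px p(2) qx q(2)]
  let ?Z = "(X \<times> {\<alpha>..\<beta>}) \<times> {\<alpha>..\<beta>}"
  let ?\<Phi> = "\<lambda>w. integral {\<alpha>..snd w} (q (fst (fst w))) * integral {\<alpha>..\<beta>} (p (fst (fst w)))
      - integral {\<alpha>..\<beta>} (q (fst (fst w))) * integral {\<alpha>..snd (fst w)} (p (fst (fst w)))"
  have cp: "continuous_on ?Z (\<lambda>w. integral {\<alpha>..h w} (p (fst (fst w))))"
    and cq: "continuous_on ?Z (\<lambda>w. integral {\<alpha>..h w} (q (fst (fst w))))"
    if "continuous_on ?Z h" "h ` ?Z \<subseteq> {\<alpha>..\<beta>}" for h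
    using that by (auto intro!: continuous_on_compose2[OF continuous_on_integral_upper_limit[OF p(1)], of _ "\<lambda>w. (fst (fst w), h w)", simplified]
      continuous_on_compose2[OF continuous_on_integral_upper_limit[OF q(1)], of _ "\<lambda>w. (fst (fst w), h w)", simplified] continuous_intros)
  have "continuous_on ?Z ?\<Phi>"
    using ab by (intro continuous_intros cp cq) auto
  moreover have "closed ?Z" using X by (intro closed_Times) auto
  ultimately have "closed (?Z \<inter> ?\<Phi> -` {0})"
    by (intro continuous_closed_preimage) auto
  also have "?Z \<inter> ?\<Phi> -` {0} = (\<lambda>z. (z, case z of (x, s) \<Rightarrow> rearrangement \<alpha> \<beta> (p x) (q x) s)) ` (X \<times> {\<alpha>..\<beta>})"
  proof (intro set_eqI iffI; clarsimp)
    fix x s t assume *: "x \<in> X" "\<alpha> \<le> s" "s \<le> \<beta>" "\<alpha> \<le> t" "t \<le> \<beta>"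
      "integral {\<alpha>..t} (q x) * integral {\<alpha>..\<beta>} (p x) = integral {\<alpha>..\<beta>} (q x) * integral {\<alpha>..s} (p x)"
    then have "rearrangement \<alpha> \<beta> (p x) (q x) s = t" using eq[of x x s t] by auto
    then show "((x, s), t) \<in> (\<lambda>z. (z, case z of (x, s) \<Rightarrow> rearrangement \<alpha> \<beta> (p x) (q x) s)) ` (X \<times> {\<alpha>..\<beta>})"
      using * by force
  next
    fix x s assume *: "x \<in> X" "\<alpha> \<le> s" "s \<le> \<beta>"
    then show "\<alpha> \<le> rearrangement \<alpha> \<beta> (p x) (q x) s \<and> rearrangement \<alpha> \<beta> (p x) (q x) s \<le> \<beta> \<and>
      integral {\<alpha>..rearrangement \<alpha> \<beta> (p x) (q x) s} (q x) * integral {\<alpha>..\<beta>} (p x) = integral {\<alpha>..\<beta>} (q x) * integral {\<alpha>..s} (p x)"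
      using eq[of x x s "rearrangement \<alpha> \<beta> (p x) (q x) s"] by auto
  qed
  finally have clo: "closed ((\<lambda>z. (z, case z of (x, s) \<Rightarrow> rearrangement \<alpha> \<beta> (p x) (q x) s)) ` (X \<times> {\<alpha>..\<beta>}))" .
  have "rearrangement \<alpha> \<beta> (p x) (q x) s \<in> {\<alpha>..\<beta>}" if "x \<in> X" "s \<in> {\<alpha>..\<beta>}" for x s
    using eq[of x x s "rearrangement \<alpha> \<beta> (p x) (q x) s"] that by blast
  with clo show ?thesis
    by (intro continuous_from_closed_graph[of "{\<alpha>..\<beta>}"]) (auto simp: Pi_iff)
qed

lemma rearrangement_endpoints:
  fixes p q :: "real \<Rightarrow> real"
  assumes ab: "\<alpha> < \<beta>"
    and p: "continuous_on {\<alpha>..\<beta>} p" "\<forall>s\<in>{\<alpha>..\<beta>}. 0 < p s"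
    and q: "continuous_on {\<alpha>..\<beta>} q" "\<forall>s\<in>{\<alpha>..\<beta>}. 0 < q s"
  shows "rearrangement \<alpha> \<beta> p q \<alpha> = \<alpha>" "rearrangement \<alpha> \<beta> p q \<beta> = \<beta>"
  by (subst rearrangement_eq[OF assms]; use ab in auto)+

text \<open>
  Implicit differentiation relative to arbitrary sets, which covers the end points of intervals.
  Caratheodory's form of the derivative of \<open>G\<close> makes the difference quotient of \<open>t\<close> a quotient of
  two convergent expressions.
\<close>
lemma has_real_derivative_implicit:
  fixes G F t :: "real \<Rightarrow> real"
  assumes G: "(G has_real_derivative g0) (at (t s0) within B)" "g0 \<noteq> 0"
    and F: "(F has_real_derivative f0) (at s0 within A)"
    and t: "continuous (at s0 within A) t" "s0 \<in> A" "t ` A \<subseteq> B"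
    and eq: "\<And>s. s \<in> A \<Longrightarrow> G (t s) = F s"
  shows "(t has_real_derivative f0 / g0) (at s0 within A)"
proof -
  obtain k where k: "\<And>z. G z - G (t s0) = k z * (z - t s0)" "continuous (at (t s0) within B) k" "k (t s0) = g0"
    using G(1) unfolding DERIV_caratheodory_within by blast
  have "((\<lambda>s. k (t s)) \<longlongrightarrow> k (t s0)) (at s0 within A)"
    using continuous_within_compose2[OF t(1), of k] continuous_within_subset[OF k(2) t(3)]
    by (simp add: continuous_within)
  then have kl: "((\<lambda>s. k (t s)) \<longlongrightarrow> g0) (at s0 within A)" using k by simp
  have lim: "((\<lambda>s. ((F s - F s0) / (s - s0)) / k (t s)) \<longlongrightarrow> f0 / g0) (at s0 within A)"
    using F G(2) kl unfolding has_field_derivative_iff by (intro tendsto_divide) auto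
  have "\<forall>\<^sub>F s in at s0 within A. k (t s) \<noteq> 0"
    using tendsto_imp_eventually_ne[OF kl G(2)] .
  moreover have "\<forall>\<^sub>F s in at s0 within A. s \<in> A"
    by (simp add: eventually_at_filter)
  ultimately have "\<forall>\<^sub>F s in at s0 within A. ((F s - F s0) / (s - s0)) / k (t s) = (t s - t s0) / (s - s0)"
  proof eventually_elim
    case (elim s)
    then have "F s - F s0 = k (t s) * (t s - t s0)" using k(1)[of "t s"] eq t(2) elim by simp
    then show "((F s - F s0) / (s - s0)) / k (t s) = (t s - t s0) / (s - s0)"
      using elim by simp
  qed
  from Lim_transform_eventually[OF lim this] show ?thesis unfolding has_field_derivative_iff .
qed

lemma rearrangement_mem:
  fixes p q :: "real \<Rightarrow> real"
  assumes ab: "\<alpha> < \<beta>"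
    and p: "continuous_on {\<alpha>..\<beta>} p" "\<forall>s\<in>{\<alpha>..\<beta>}. 0 < p s"
    and q: "continuous_on {\<alpha>..\<beta>} q" "\<forall>s\<in>{\<alpha>..\<beta>}. 0 < q s"
    and s: "s \<in> {\<alpha>..\<beta>}"
  shows "rearrangement \<alpha> \<beta> p q s \<in> {\<alpha>..\<beta>}"
  using rearrangement_eq[OF assms, of "rearrangement \<alpha> \<beta> p q s"] by blast

lemma continuous_on_rearrangement_1:
  fixes p q :: "real \<Rightarrow> real"
  assumes ab: "\<alpha> < \<beta>"
    and p: "continuous_on {\<alpha>..\<beta>} p" "\<forall>s\<in>{\<alpha>..\<beta>}. 0 < p s"
    and q: "continuous_on {\<alpha>..\<beta>} q" "\<forall>s\<in>{\<alpha>..\<beta>}. 0 < q s"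
  shows "continuous_on {\<alpha>..\<beta>} (rearrangement \<alpha> \<beta> p q)"
proof -
  have "continuous_on ({0::real} \<times> {\<alpha>..\<beta>}) (\<lambda>(x, s). rearrangement \<alpha> \<beta> ((\<lambda>_. p) x) ((\<lambda>_. q) x) s)"
    using assms
    by (intro continuous_on_rearrangement)
       (auto simp: split_beta intro!: continuous_on_compose2[OF p(1)] continuous_on_compose2[OF q(1)] continuous_intros)
  from continuous_on_compose2[OF this, of "{\<alpha>..\<beta>}" "\<lambda>s. (0, s)"] show ?thesis
    by (simp add: image_subset_iff continuous_on_Pair continuous_on_const)
qed

lemma has_real_derivative_rearrangement:
  fixes p q :: "real \<Rightarrow> real"
  assumes ab: "\<alpha> < \<beta>"
    and p: "continuous_on {\<alpha>..\<beta>} p" "\<forall>s\<in>{\<alpha>..\<beta>}. 0 < p s"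
    and q: "continuous_on {\<alpha>..\<beta>} q" "\<forall>s\<in>{\<alpha>..\<beta>}. 0 < q s"
    and s: "s \<in> {\<alpha>..\<beta>}"
  shows "(rearrangement \<alpha> \<beta> p q has_real_derivative
    (integral {\<alpha>..\<beta>} q * p s) / (integral {\<alpha>..\<beta>} p * q (rearrangement \<alpha> \<beta> p q s))) (at s within {\<alpha>..\<beta>})"
proof -
  let ?t = "rearrangement \<alpha> \<beta> p q"
  note mem = rearrangement_mem[OF ab p q]
  have P: "0 < integral {\<alpha>..\<beta>} p" using integral_pos_interval p ab by blast
  show ?thesis
  proof (rule has_real_derivative_implicit)
    show "((\<lambda>t. integral {\<alpha>..\<beta>} p * integral {\<alpha>..t} q) has_real_derivative integral {\<alpha>..\<beta>} p * q (?t s)) (at (?t s) within {\<alpha>..\<beta>})"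
      by (intro DERIV_cmult integral_has_real_derivative q mem s)
    show "integral {\<alpha>..\<beta>} p * q (?t s) \<noteq> 0" using P q(2) mem[OF s] by force
    show "((\<lambda>s. integral {\<alpha>..\<beta>} q * integral {\<alpha>..s} p) has_real_derivative integral {\<alpha>..\<beta>} q * p s) (at s within {\<alpha>..\<beta>})"
      by (intro DERIV_cmult integral_has_real_derivative p s)
    show "continuous (at s within {\<alpha>..\<beta>}) ?t"
      using continuous_on_rearrangement_1[OF ab p q] s by (simp add: continuous_on_eq_continuous_within)
    show "?t ` {\<alpha>..\<beta>} \<subseteq> {\<alpha>..\<beta>}" using mem by blast
    show "integral {\<alpha>..\<beta>} p * integral {\<alpha>..?t r} q = integral {\<alpha>..\<beta>} q * integral {\<alpha>..r} p" if "r \<in> {\<alpha>..\<beta>}" for r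
      using rearrangement_eq[OF ab p q that, of "?t r"] by (simp add: mult.commute)
  qed (use s in auto)
qed

lemma integral_rearrangement:
  fixes p q k :: "real \<Rightarrow> real"
  assumes ab: "\<alpha> < \<beta>"
    and p: "continuous_on {\<alpha>..\<beta>} p" "\<forall>s\<in>{\<alpha>..\<beta>}. 0 < p s"
    and q: "continuous_on {\<alpha>..\<beta>} q" "\<forall>s\<in>{\<alpha>..\<beta>}. 0 < q s"
    and k: "continuous_on {\<alpha>..\<beta>} k"
  shows "integral {\<alpha>..\<beta>} (\<lambda>s. k (rearrangement \<alpha> \<beta> p q s) * p s)
    = integral {\<alpha>..\<beta>} p * (integral {\<alpha>..\<beta>} (\<lambda>s. k s * q s) / integral {\<alpha>..\<beta>} q)"
proof -
  let ?t = "rearrangement \<alpha> \<beta> p q" and ?P = "integral {\<alpha>..\<beta>} p" and ?Q = "integral {\<alpha>..\<beta>} q"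
  note mem = rearrangement_mem[OF ab p q] and ends = rearrangement_endpoints[OF ab p q]
  have P: "0 < ?P" and Q: "0 < ?Q" using integral_pos_interval p q ab by blast+
  have "((\<lambda>s. ((?Q * p s) / (?P * q (?t s))) *\<^sub>R (k (?t s) * q (?t s))) has_integral
      (integral {?t \<alpha>..?t \<beta>} (\<lambda>s. k s * q s))) {\<alpha>..\<beta>}"
    using ab has_real_derivative_rearrangement[OF ab p q] mem ends
    by (intro has_integral_substitution[where c = \<alpha> and d = \<beta> and g = ?t and f = "\<lambda>s. k s * q s"
          and g' = "\<lambda>s. (?Q * p s) / (?P * q (?t s))"] continuous_intros k q) auto
  from has_integral_mult_right[OF this, of "?P / ?Q"]
  have "((\<lambda>s. k (?t s) * p s) has_integral (?P / ?Q * integral {\<alpha>..\<beta>} (\<lambda>s. k s * q s))) {\<alpha>..\<beta>}"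
  proof (rule has_integral_eq_rhs[OF has_integral_eq, rotated])
    fix s assume "s \<in> {\<alpha>..\<beta>}"
    then have "q (?t s) \<noteq> 0" using q(2) mem by force
    then show "?P / ?Q * (((?Q * p s) / (?P * q (?t s))) *\<^sub>R (k (?t s) * q (?t s))) = k (?t s) * p s"
      using P Q by simp
  qed (simp add: ends)
  from integral_unique[OF this] show ?thesis by simp
qed

section \<open>The Knothe rearrangement on a box\<close>

text \<open>
  \<open>T\<close> carries the density \<open>f\<close> to the density \<open>g\<close> and acts on the coordinates in \<open>I\<close> only. The functions
  \<open>D j\<close> are the diagonal entries of its Jacobian matrix; off-diagonal entries need not exist, and
  transport of mass is stated weakly, against continuous functions. The last clause, that \<open>T\<close>
  commutes with changes of the coordinates outside \<open>I\<close>, says that \<open>T\<close> is the identity in them and that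
  its other components do not depend on them.
\<close>
definition triangular_transport ::
  "real ^ 'n \<Rightarrow> real ^ 'n \<Rightarrow> 'n set \<Rightarrow> (real ^ 'n \<Rightarrow> real) \<Rightarrow> (real ^ 'n \<Rightarrow> real)
   \<Rightarrow> (real ^ 'n \<Rightarrow> real ^ 'n) \<Rightarrow> ('n::finite \<Rightarrow> real ^ 'n \<Rightarrow> real) \<Rightarrow> bool" where
  "triangular_transport a b I f g T D \<longleftrightarrow>
     continuous_on (cbox a b) T \<and> T ` cbox a b \<subseteq> cbox a b \<and>
     (\<forall>j\<in>I. continuous_on (cbox a b) (D j) \<and> (\<forall>x\<in>cbox a b. 0 < D j x \<and>
        ((\<lambda>s. T (upd x j s) $ j) has_real_derivative D j x) (at (x $ j) within {a $ j..b $ j}))) \<and>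
     (\<forall>x\<in>cbox a b. f x = g (T x) * (\<Prod>j\<in>I. D j x)) \<and>
     (\<forall>k. continuous_on (cbox a b) k \<longrightarrow>
        integral (cbox a b) (\<lambda>x. k (T x) * f x) = integral (cbox a b) (\<lambda>x. k x * g x)) \<and>
     (\<forall>j. j \<notin> I \<longrightarrow> (\<forall>x\<in>cbox a b. \<forall>s\<in>{a $ j..b $ j}. T (upd x j s) = upd (T x) j s))"

lemma triangular_transportD:
  assumes "triangular_transport a b I f g T D"
  shows "continuous_on (cbox a b) T" "\<And>x. x \<in> cbox a b \<Longrightarrow> T x \<in> cbox a b"
    and "\<And>j. j \<in> I \<Longrightarrow> continuous_on (cbox a b) (D j)"
    and "\<And>j x. j \<in> I \<Longrightarrow> x \<in> cbox a b \<Longrightarrow> 0 < D j x"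
    and "\<And>j x. j \<in> I \<Longrightarrow> x \<in> cbox a b \<Longrightarrow>
        ((\<lambda>s. T (upd x j s) $ j) has_real_derivative D j x) (at (x $ j) within {a $ j..b $ j})"
    and "\<And>x. x \<in> cbox a b \<Longrightarrow> f x = g (T x) * (\<Prod>j\<in>I. D j x)"
    and "\<And>k. continuous_on (cbox a b) k \<Longrightarrow>
        integral (cbox a b) (\<lambda>x. k (T x) * f x) = integral (cbox a b) (\<lambda>x. k x * g x)"
    and "\<And>j x s. j \<notin> I \<Longrightarrow> x \<in> cbox a b \<Longrightarrow> s \<in> {a $ j..b $ j} \<Longrightarrow> T (upd x j s) = upd (T x) j s"
proof -
  have push: "\<forall>k. continuous_on (cbox a b) k \<longrightarrow>
        integral (cbox a b) (\<lambda>x. k (T x) * f x) = integral (cbox a b) (\<lambda>x. k x * g x)"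
    using assms unfolding triangular_transport_def by (elim conjE) assumption
  show "integral (cbox a b) (\<lambda>x. k (T x) * f x) = integral (cbox a b) (\<lambda>x. k x * g x)"
    if "continuous_on (cbox a b) k" for k
    by (rule mp[OF spec[OF push] that])
qed (use assms in \<open>auto simp: triangular_transport_def\<close>)

lemma continuous_on_coordinate_integral:
  fixes h :: "real ^ 'n::finite \<Rightarrow> real"
  assumes "continuous_on (cbox a b) h"
  shows "continuous_on (cbox a b) (\<lambda>x. integral {a $ i..b $ i} (\<lambda>s. h (upd x i s)))"
  unfolding cbox_interval[symmetric]
  by (intro integral_continuous_on_param)
     (auto simp: split_beta intro!: continuous_on_compose2[OF assms] continuous_intros upd_in_cbox)

lemma continuous_on_coordinate_line:
  fixes h :: "real ^ 'n::finite \<Rightarrow> 'b::topological_space"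
  assumes "continuous_on (cbox a b) h" "x \<in> cbox a b"
  shows "continuous_on {a $ i..b $ i} (\<lambda>s. h (upd x i s))"
  using assms(2) by (intro continuous_on_compose2[OF assms(1)] continuous_intros image_subsetI upd_in_cbox) auto

text \<open>
  The inductive step of Knothe's construction. The map \<open>T'\<close> transports the marginals obtained by
  integrating out coordinate \<open>i\<close>; on each line in direction \<open>i\<close> the conditional density of \<open>f\<close> is then
  rearranged to the conditional density of \<open>g\<close> on the image line. Coordinate \<open>i\<close> thereby becomes the
  last one of the triangular structure, and the old diagonal entries are kept.
\<close>
lemma triangular_transport_insert:
  fixes f g :: "real ^ 'n::finite \<Rightarrow> real"
  assumes ab: "\<And>i. a $ i < b $ i"
    and f: "continuous_on (cbox a b) f" "\<And>x. x \<in> cbox a b \<Longrightarrow> 0 < f x"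
    and g: "continuous_on (cbox a b) g" "\<And>x. x \<in> cbox a b \<Longrightarrow> 0 < g x"
    and fI: "\<And>x y. x \<in> cbox a b \<Longrightarrow> y \<in> cbox a b \<Longrightarrow> (\<And>j. j \<in> insert i I \<Longrightarrow> x $ j = y $ j) \<Longrightarrow> f x = f y"
    and gI: "\<And>x y. x \<in> cbox a b \<Longrightarrow> y \<in> cbox a b \<Longrightarrow> (\<And>j. j \<in> insert i I \<Longrightarrow> x $ j = y $ j) \<Longrightarrow> g x = g y"
    and i: "i \<notin> I"
    and T': "triangular_transport a b I (\<lambda>x. integral {a $ i..b $ i} (\<lambda>s. f (upd x i s)))
               (\<lambda>x. integral {a $ i..b $ i} (\<lambda>s. g (upd x i s))) T' D'"
  shows "\<exists>T D. triangular_transport a b (insert i I) f g T D"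
proof -
  let ?Q = "cbox a b" and ?L = "{a $ i..b $ i}"
  define fb where "fb x = integral ?L (\<lambda>s. f (upd x i s))" for x
  define gb where "gb x = integral ?L (\<lambda>s. g (upd x i s))" for x
  define p where "p = (\<lambda>x s. f (upd x i s))"
  define q where "q = (\<lambda>x s. g (upd (T' x) i s))"
  define t where "t x = rearrangement (a $ i) (b $ i) (p x) (q x) (x $ i)" for x
  define T where "T x = upd (T' x) i (t x)" for x
  define D where "D j x = (if j = i then (gb (T' x) * f x) / (fb x * g (T x)) else D' j x)" for j x
  have T'c: "continuous_on ?Q T'" and T'm: "\<And>x. x \<in> ?Q \<Longrightarrow> T' x \<in> ?Q"
    and D'c: "\<And>j. j \<in> I \<Longrightarrow> continuous_on ?Q (D' j)"
    and D'p: "\<And>j x. j \<in> I \<Longrightarrow> x \<in> ?Q \<Longrightarrow> 0 < D' j x"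
    and D'd: "\<And>j x. j \<in> I \<Longrightarrow> x \<in> ?Q \<Longrightarrow> ((\<lambda>s. T' (upd x j s) $ j) has_real_derivative D' j x) (at (x $ j) within {a $ j..b $ j})"
    and J': "\<And>x. x \<in> ?Q \<Longrightarrow> fb x = gb (T' x) * (\<Prod>j\<in>I. D' j x)"
    and push': "\<And>k. continuous_on ?Q k \<Longrightarrow> integral ?Q (\<lambda>x. k (T' x) * fb x) = integral ?Q (\<lambda>x. k x * gb x)"
    and ind': "\<And>j x s. j \<notin> I \<Longrightarrow> x \<in> ?Q \<Longrightarrow> s \<in> {a $ j..b $ j} \<Longrightarrow> T' (upd x j s) = upd (T' x) j s"
    by (fact triangular_transportD[OF T', folded fb_def gb_def])+
  have ab': "a $ i < b $ i" by (rule ab)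
  have xi: "x $ j \<in> {a $ j..b $ j}" if "x \<in> ?Q" for x j using that by (simp add: mem_box_cart)
  have pc: "continuous_on ?L (p x)" "\<forall>s\<in>?L. 0 < p x s" if "x \<in> ?Q" for x
    unfolding p_def using that by (auto intro!: continuous_on_coordinate_line f upd_in_cbox)
  have qc: "continuous_on ?L (q x)" "\<forall>s\<in>?L. 0 < q x s" if "x \<in> ?Q" for x
    unfolding q_def using that T'm by (auto intro!: continuous_on_coordinate_line g upd_in_cbox)
  have fbp: "fb x = integral ?L (p x)" for x by (simp add: fb_def p_def)
  have gbq: "gb (T' x) = integral ?L (q x)" for x by (simp add: gb_def q_def)
  have gbpos: "0 < gb x" if "x \<in> ?Q" for x
    unfolding gb_def using that ab' by (intro integral_pos_interval continuous_on_coordinate_line ballI g upd_in_cbox)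
  have fbpos: "0 < fb x" if "x \<in> ?Q" for x
    unfolding fb_def using that ab' by (intro integral_pos_interval continuous_on_coordinate_line ballI f upd_in_cbox)
  have tm: "t x \<in> ?L" if "x \<in> ?Q" for x
    unfolding t_def using that by (intro rearrangement_mem ab' pc qc xi)
  have Tm: "T x \<in> ?Q" if "x \<in> ?Q" for x
    unfolding T_def by (intro upd_in_cbox T'm tm that)
  have tc: "continuous_on ?Q t"
  proof -
    have "continuous_on (?Q \<times> ?L) (\<lambda>(x, s). rearrangement (a $ i) (b $ i) (p x) (q x) s)"
      by (intro continuous_on_rearrangement ab' pc(2) qc(2))
         (auto simp: p_def q_def split_beta intro!: continuous_on_compose2[OF f(1)] continuous_on_compose2[OF g(1)]
            continuous_on_compose2[OF T'c] continuous_intros upd_in_cbox T'm)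
    from continuous_on_compose2[OF this, of ?Q "\<lambda>x. (x, x $ i)"] show ?thesis
      unfolding t_def using xi[of _ i] by (simp add: image_subset_iff continuous_on_Pair continuous_on_component)
  qed
  have Tc: "continuous_on ?Q T" unfolding T_def by (intro continuous_intros T'c tc)
  have tu: "t (upd x i s) = rearrangement (a $ i) (b $ i) (p x) (q x) s" if "x \<in> ?Q" "s \<in> ?L" for x s
    using that i by (simp add: t_def p_def q_def ind')
  have Tu: "T (upd x i s) = upd (T' x) i (rearrangement (a $ i) (b $ i) (p x) (q x) s)" if "x \<in> ?Q" "s \<in> ?L" for x s
    using that i by (simp add: T_def tu ind')
  have "triangular_transport a b (insert i I) f g T D"
    unfolding triangular_transport_def
  proof (intro conjI ballI allI impI)
    show "continuous_on ?Q T" by (rule Tc)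
    show "T ` ?Q \<subseteq> ?Q" using Tm by blast
  next
    fix j assume j: "j \<in> insert i I"
    have "continuous_on ?Q (\<lambda>x. (gb (T' x) * f x) / (fb x * g (T x)))"
    proof (intro continuous_intros f)
      show "continuous_on ?Q (\<lambda>x. gb (T' x))"
        by (rule continuous_on_compose2[OF _ T'c]) (use T'm continuous_on_coordinate_integral[OF g(1)] in \<open>auto simp: gb_def\<close>)
      show "continuous_on ?Q fb" unfolding fb_def by (rule continuous_on_coordinate_integral[OF f(1)])
      show "continuous_on ?Q (\<lambda>x. g (T x))"
        by (rule continuous_on_compose2[OF g(1) Tc]) (use Tm in auto)
      show "\<forall>x\<in>?Q. fb x * g (T x) \<noteq> 0" using fbpos g(2) Tm by fastforce
    qed
    then show "continuous_on ?Q (D j)" using j D'c by (cases "j = i") (auto simp: D_def[abs_def])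
    fix x assume x: "x \<in> ?Q"
    show "0 < D j x" using j x D'p fbpos gbpos f(2) g(2) Tm T'm by (auto simp: D_def intro!: divide_pos_pos mult_pos_pos)
    show "((\<lambda>s. T (upd x j s) $ j) has_real_derivative D j x) (at (x $ j) within {a $ j..b $ j})"
    proof (cases "j = i")
      case True
      have "(rearrangement (a $ i) (b $ i) (p x) (q x) has_real_derivative D i x) (at (x $ i) within ?L)"
        using has_real_derivative_rearrangement[OF ab' pc[OF x] qc[OF x] xi[OF x]] tu[OF x xi[OF x]]
        by (simp add: D_def fbp gbq T_def p_def q_def t_def)
      then show ?thesis unfolding True
        by (rule has_field_derivative_transform_within[OF _ zero_less_one xi[OF x]]) (simp add: Tu x)
    next
      case False
      then show ?thesis using j D'd[OF _ x, of j] by (simp add: T_def D_def)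
    qed
  next
    fix x assume x: "x \<in> ?Q"
    have "(\<Prod>j\<in>insert i I. D j x) = D i x * (\<Prod>j\<in>I. D' j x)"
      using i by (subst prod.insert) (auto simp: D_def intro!: prod.cong)
    also have "(\<Prod>j\<in>I. D' j x) = fb x / gb (T' x)" using J'[OF x] gbpos[OF T'm[OF x]] by simp
    finally show "f x = g (T x) * (\<Prod>j\<in>insert i I. D j x)"
      using gbpos[OF T'm[OF x]] fbpos[OF x] g(2)[OF Tm[OF x]] by (simp add: D_def)
  next
    fix k :: "real ^ 'n \<Rightarrow> real" assume k: "continuous_on ?Q k"
    \<comment> \<open>the conditional expectation of \<open>k\<close> under \<open>g\<close>, to which transport by \<open>T'\<close> applies\<close>
    define kb where "kb y = integral ?L (\<lambda>s. k (upd y i s) * g (upd y i s)) / gb y" for y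
    have kg: "continuous_on ?Q (\<lambda>x. k x * g x)" by (intro continuous_intros k g)
    have kbc: "continuous_on ?Q kb" unfolding kb_def
    proof (intro continuous_intros)
      show "continuous_on ?Q (\<lambda>y. integral ?L (\<lambda>s. k (upd y i s) * g (upd y i s)))"
        by (rule continuous_on_coordinate_integral[OF kg])
      show "continuous_on ?Q gb" unfolding gb_def by (rule continuous_on_coordinate_integral[OF g(1)])
      show "\<forall>x\<in>?Q. gb x \<noteq> 0" using gbpos by force
    qed
    have kT: "continuous_on ?Q (\<lambda>x. k (T x) * f x)"
      by (intro continuous_intros f continuous_on_compose2[OF k Tc]) (use Tm in auto)
    have "(b $ i - a $ i) * integral ?Q (\<lambda>x. k (T x) * f x)
        = integral ?Q (\<lambda>x. integral ?L (\<lambda>s. k (T (upd x i s)) * f (upd x i s)))"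
      using integral_average_coordinate[OF kT, of i] ab' by simp
    also have "\<dots> = integral ?Q (\<lambda>x. kb (T' x) * fb x)"
    proof (rule integral_cong)
      fix x assume x: "x \<in> ?Q"
      have kk: "continuous_on ?L (\<lambda>s. k (upd (T' x) i s))" by (intro continuous_on_coordinate_line k T'm x)
      have "integral ?L (\<lambda>s. k (T (upd x i s)) * f (upd x i s))
         = integral ?L (\<lambda>s. k (upd (T' x) i (rearrangement (a $ i) (b $ i) (p x) (q x) s)) * p x s)"
        by (rule integral_cong) (simp add: Tu x p_def)
      also have "\<dots> = kb (T' x) * fb x"
        using integral_rearrangement[OF ab' pc[OF x] qc[OF x] kk]
        by (simp add: kb_def fbp gbq) (simp add: q_def)
      finally show "integral ?L (\<lambda>s. k (T (upd x i s)) * f (upd x i s)) = kb (T' x) * fb x" .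
    qed
    also have "\<dots> = integral ?Q (\<lambda>x. kb x * gb x)" by (rule push'[OF kbc])
    also have "\<dots> = integral ?Q (\<lambda>x. integral ?L (\<lambda>s. k (upd x i s) * g (upd x i s)))"
      using gbpos by (intro integral_cong) (force simp: kb_def)
    also have "\<dots> = (b $ i - a $ i) * integral ?Q (\<lambda>x. k x * g x)"
      using integral_average_coordinate[OF kg, of i] ab' by simp
    finally show "integral ?Q (\<lambda>x. k (T x) * f x) = integral ?Q (\<lambda>x. k x * g x)" using ab' by simp
  next
    fix j x s assume j: "j \<notin> insert i I" and x: "x \<in> ?Q" and s: "s \<in> {a $ j..b $ j}"
    have T'j: "T' (upd x j s) = upd (T' x) j s" using ind' j x s by simp
    have "p (upd x j s) r = p x r" if "r \<in> ?L" for r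
      unfolding p_def using that x s j by (intro fI upd_in_cbox) (auto simp: upd_nth)
    moreover have "q (upd x j s) r = q x r" if "r \<in> ?L" for r
      unfolding q_def T'j using that x s j T'm by (intro gI upd_in_cbox) (auto simp: upd_nth)
    moreover have "upd x j s $ i = x $ i" using j by (auto simp: upd_nth)
    ultimately have "t (upd x j s) = t x"
      unfolding t_def using xi[OF x, of i] by (auto intro!: rearrangement_cong)
    then show "T (upd x j s) = upd (T x) j s"
      using j by (auto simp: T_def T'j upd_commute[of j i])
  qed
  then show ?thesis by blast
qed

lemma triangular_transport_exists_on:
  fixes f g :: "real ^ 'n::finite \<Rightarrow> real"
  assumes ab: "\<And>i. a $ i < b $ i" and I: "finite I"
    and f: "continuous_on (cbox a b) f" "\<And>x. x \<in> cbox a b \<Longrightarrow> 0 < f x"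
    and g: "continuous_on (cbox a b) g" "\<And>x. x \<in> cbox a b \<Longrightarrow> 0 < g x"
    and mass: "integral (cbox a b) f = integral (cbox a b) g"
    and fI: "\<And>x y. x \<in> cbox a b \<Longrightarrow> y \<in> cbox a b \<Longrightarrow> (\<And>j. j \<in> I \<Longrightarrow> x $ j = y $ j) \<Longrightarrow> f x = f y"
    and gI: "\<And>x y. x \<in> cbox a b \<Longrightarrow> y \<in> cbox a b \<Longrightarrow> (\<And>j. j \<in> I \<Longrightarrow> x $ j = y $ j) \<Longrightarrow> g x = g y"
  shows "\<exists>T D. triangular_transport a b I f g T D"
  using I f g mass fI gI
proof (induction I arbitrary: f g)
  \<comment> \<open>densities depending on no coordinate are constant, and equal mass makes them equal\<close>
  case empty
  have a: "a \<in> cbox a b" using ab by (auto simp: mem_box_cart less_imp_le)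
  have c: "0 < measure lborel (cbox a b)"
    using ab by (subst content_pos_lt_eq) (auto simp: Basis_vec_def inner_axis)
  have fc: "f x = f a" and gc: "g x = g a" if "x \<in> cbox a b" for x
    by (rule empty.prems(6)[OF that a], simp) (rule empty.prems(7)[OF that a], simp)
  have "integral (cbox a b) f = integral (cbox a b) (\<lambda>_. f a)" "integral (cbox a b) g = integral (cbox a b) (\<lambda>_. g a)"
    by (intro integral_cong fc gc; assumption)+
  then have "f a = g a" using empty.prems(5) c by simp
  then have fg: "f x = g x" if "x \<in> cbox a b" for x using fc[OF that] gc[OF that] by (simp only:)
  have "triangular_transport a b {} f g (\<lambda>x. x) (\<lambda>_ _. 1)"
    unfolding triangular_transport_def using fg by (auto intro!: continuous_intros integral_cong)
  then show ?case by blast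
next
  case (insert i I)
  let ?fb = "\<lambda>x. integral {a $ i..b $ i} (\<lambda>s. f (upd x i s))" and ?gb = "\<lambda>x. integral {a $ i..b $ i} (\<lambda>s. g (upd x i s))"
  have ab': "a $ i < b $ i" "a $ i \<le> b $ i" using ab[of i] by auto
  have "\<exists>T D. triangular_transport a b I ?fb ?gb T D"
  proof (rule insert.IH)
    show "continuous_on (cbox a b) ?fb" "continuous_on (cbox a b) ?gb"
      by (intro continuous_on_coordinate_integral insert.prems)+
    show "0 < ?fb x" if "x \<in> cbox a b" for x
      by (rule integral_pos_interval[OF continuous_on_coordinate_line[OF insert.prems(1) that] ballI ab'(1)],
          rule insert.prems(2), rule upd_in_cbox[OF that])
    show "0 < ?gb x" if "x \<in> cbox a b" for x
      by (rule integral_pos_interval[OF continuous_on_coordinate_line[OF insert.prems(3) that] ballI ab'(1)],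
          rule insert.prems(4), rule upd_in_cbox[OF that])
    show "integral (cbox a b) ?fb = integral (cbox a b) ?gb"
      by (simp add: integral_average_coordinate insert.prems(1,3,5) ab')
    fix x y assume xy: "x \<in> cbox a b" "y \<in> cbox a b" "\<And>j. j \<in> I \<Longrightarrow> x $ j = y $ j"
    have "f (upd x i s) = f (upd y i s)" "g (upd x i s) = g (upd y i s)" if "s \<in> {a $ i..b $ i}" for s
      using xy that by (auto intro!: insert.prems(6,7) upd_in_cbox simp: upd_nth)
    then show "?fb x = ?fb y" "?gb x = ?gb y" by (auto intro: integral_cong)
  qed
  then obtain T D where "triangular_transport a b I ?fb ?gb T D" by blast
  from triangular_transport_insert[OF ab insert.prems(1-4,6,7) insert.hyps(2) this] show ?case
    by blast
qed

lemma triangular_transport_exists: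
  fixes f g :: "real ^ 'n::finite \<Rightarrow> real"
  assumes "\<And>i. a $ i < b $ i"
    and "continuous_on (cbox a b) f" "\<And>x. x \<in> cbox a b \<Longrightarrow> 0 < f x"
    and "continuous_on (cbox a b) g" "\<And>x. x \<in> cbox a b \<Longrightarrow> 0 < g x"
    and "integral (cbox a b) f = integral (cbox a b) g"
  obtains T D where "triangular_transport a b UNIV f g T D"
proof -
  have "\<exists>T D. triangular_transport a b UNIV f g T D"
    using assms by (intro triangular_transport_exists_on) (auto, (metis vec_eq_iff)+)
  then show thesis using that by blast
qed

section \<open>Integration by parts against a triangular transport\<close>

lemma upd_eq_plus_axis: "upd x i s = x + (s - x $ i) *\<^sub>R axis i 1"
  by (auto simp: vec_eq_iff upd_nth axis_def)

lemma has_real_derivative_along_coordinate: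
  fixes \<phi> :: "real ^ 'n::finite \<Rightarrow> real"
  assumes "(\<phi> has_derivative (\<lambda>h. G \<bullet> h)) (at x)"
  shows "((\<lambda>s. \<phi> (upd x i s)) has_real_derivative G $ i) (at (x $ i) within A)"
proof -
  have 1: "((\<lambda>s. upd x i s) has_derivative (\<lambda>h. h *\<^sub>R axis i 1)) (at (x $ i) within A)"
    unfolding upd_eq_plus_axis by (auto intro!: derivative_eq_intros)
  have "((\<lambda>s. \<phi> (upd x i s)) has_derivative (\<lambda>h. G \<bullet> (h *\<^sub>R axis i 1))) (at (x $ i) within A)"
    using has_derivative_compose[OF 1, of \<phi> "\<lambda>h. G \<bullet> h"] assms by simp
  moreover have "(\<lambda>h. G \<bullet> (h *\<^sub>R axis i 1)) = (*) (G $ i)"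
    by (simp add: fun_eq_iff inner_axis)
  ultimately show ?thesis by (simp add: has_field_derivative_def)
qed

text \<open>The fundamental theorem of calculus on every line, followed by averaging over the lines.\<close>
lemma integral_coordinate_derivative_zero:
  fixes h :: "real ^ 'n::finite \<Rightarrow> real"
  assumes ab: "a $ i < b $ i"
    and dh: "continuous_on (cbox a b) dh"
    and deriv: "\<And>x. x \<in> cbox a b \<Longrightarrow> ((\<lambda>s. h (upd x i s)) has_real_derivative dh x) (at (x $ i) within {a $ i..b $ i})"
    and zero: "\<And>x. x \<in> cbox a b \<Longrightarrow> x $ i = a $ i \<or> x $ i = b $ i \<Longrightarrow> h x = 0"
  shows "integral (cbox a b) dh = 0"
proof -
  have "integral {a $ i..b $ i} (\<lambda>s. dh (upd x i s)) = 0" if x: "x \<in> cbox a b" for x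
  proof -
    have "((\<lambda>s. dh (upd x i s)) has_integral h (upd x i (b $ i)) - h (upd x i (a $ i))) {a $ i..b $ i}"
    proof (rule fundamental_theorem_of_calculus)
      fix s assume s: "s \<in> {a $ i..b $ i}"
      show "((\<lambda>s. h (upd x i s)) has_vector_derivative dh (upd x i s)) (at s within {a $ i..b $ i})"
        using deriv[OF upd_in_cbox[OF x s]] by (simp add: has_real_derivative_iff_has_vector_derivative)
    qed (use ab in simp)
    moreover have "h (upd x i (b $ i)) = 0" "h (upd x i (a $ i)) = 0"
      using ab x by (auto intro!: zero upd_in_cbox)
    ultimately show ?thesis by (simp add: integral_unique)
  qed
  then have "integral (cbox a b) (\<lambda>x. integral {a $ i..b $ i} (\<lambda>s. dh (upd x i s))) = integral (cbox a b) (\<lambda>_. 0)"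
    by (intro integral_cong)
  then show ?thesis using integral_average_coordinate[OF dh, of i] ab by simp
qed

text \<open>
  The divergence theorem for \<open>\<phi> (T - x)\<close>. Each summand \<open>\<partial>\<^sub>i(\<phi> (T\<^sub>i - x\<^sub>i))\<close> is integrated along
  coordinate \<open>i\<close>, so that the diagonal derivatives of \<open>T\<close> suffice.
\<close>
lemma triangular_transport_by_parts:
  fixes \<phi> :: "real ^ 'n::finite \<Rightarrow> real"
  assumes ab: "\<And>i. a $ i < b $ i"
    and T: "triangular_transport a b UNIV f g T D"
    and deriv: "\<And>x. x \<in> cbox a b \<Longrightarrow> (\<phi> has_derivative (\<lambda>h. G x \<bullet> h)) (at x)"
    and G: "continuous_on (cbox a b) G"
    and zero: "\<And>x. x \<in> cbox a b - box a b \<Longrightarrow> \<phi> x = 0"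
  shows "integral (cbox a b) (\<lambda>x. \<phi> x * ((\<Sum>i\<in>UNIV. D i x) - real CARD('n)) + G x \<bullet> (T x - x)) = 0"
proof -
  note T' = triangular_transportD[OF T]
  let ?dh = "\<lambda>i x. \<phi> x * (D i x - 1) + G x $ i * (T x $ i - x $ i)"
  have cphi: "continuous_on (cbox a b) \<phi>"
    using deriv by (meson continuous_at_imp_continuous_on has_derivative_continuous)
  have cont: "continuous_on (cbox a b) (?dh i)" for i
    by (intro continuous_intros cphi T'(1,3) G) auto
  have "integral (cbox a b) (?dh i) = 0" for i
  proof (rule integral_coordinate_derivative_zero[OF ab cont])
    fix x assume x: "x \<in> cbox a b"
    show "((\<lambda>s. \<phi> (upd x i s) * (T (upd x i s) $ i - upd x i s $ i)) has_real_derivative ?dh i x)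
      (at (x $ i) within {a $ i..b $ i})"
      by (auto intro!: derivative_eq_intros has_real_derivative_along_coordinate deriv T'(5) x)
    show "\<phi> x * (T x $ i - x $ i) = 0" if "x $ i = a $ i \<or> x $ i = b $ i"
    proof -
      have "x \<notin> box a b" using that by (metis mem_box_cart(1) less_irrefl)
      then show ?thesis using zero[of x] x by simp
    qed
  qed
  then have "(\<Sum>i\<in>UNIV. integral (cbox a b) (?dh i)) = 0" by simp
  also have "(\<Sum>i\<in>UNIV. integral (cbox a b) (?dh i)) = integral (cbox a b) (\<lambda>x. \<Sum>i\<in>UNIV. ?dh i x)"
    by (rule integral_sum[symmetric]) (auto intro: integrable_continuous cont)
  also have "(\<lambda>x. \<Sum>i\<in>UNIV. ?dh i x) = (\<lambda>x. \<phi> x * ((\<Sum>i\<in>UNIV. D i x) - real CARD('n)) + G x \<bullet> (T x - x))"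
    by (simp add: fun_eq_iff sum.distrib sum_distrib_left[symmetric] sum_subtractf inner_vec_def)
  finally show ?thesis .
qed

section \<open>Distance to a convex set and a concave cutoff\<close>

context
  fixes K :: "'a::euclidean_space set"
  assumes K: "closed K" "convex K" "K \<noteq> {}"
begin

text \<open>
  Convexity of the squared distance, in the form of its tangent inequality. The hyperplane through
  the closest point of \<open>x\<close> with normal \<open>x - closest_point K x\<close> separates \<open>x\<close> from \<open>K\<close>, and the
  distance of \<open>y\<close> to \<open>K\<close> is at least its distance to the half-space behind it.
\<close>
lemma sq_dist_closest_point_lower:
  "(norm (x - closest_point K x))\<^sup>2 + 2 * ((x - closest_point K x) \<bullet> (y - x)) \<le> (norm (y - closest_point K y))\<^sup>2"
proof -
  let ?n = "x - closest_point K x"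
  have "?n \<bullet> (closest_point K y - closest_point K x) \<le> 0"
    using closest_point_dot[OF K(2,1) closest_point_in_set[OF K(1,3)], of x y] .
  then have "?n \<bullet> ?n + ?n \<bullet> (y - x) \<le> ?n \<bullet> (y - closest_point K y)"
    by (simp add: inner_diff_right inner_diff_left)
  moreover have "0 \<le> (norm ((y - closest_point K y) - ?n))\<^sup>2" by simp
  then have "2 * (?n \<bullet> (y - closest_point K y)) - (norm ?n)\<^sup>2 \<le> (norm (y - closest_point K y))\<^sup>2"
    unfolding power2_norm_eq_inner by (simp add: inner_diff_left inner_diff_right inner_commute)
  ultimately show ?thesis by (simp add: power2_norm_eq_inner)
qed

text \<open>
  The tangent inequality bounds the increment from below; comparison with the closest point of \<open>x\<close>
  bounds it from above, up to the square of the step.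
\<close>
lemma has_derivative_sq_dist_closest_point:
  "((\<lambda>x. (norm (x - closest_point K x))\<^sup>2) has_derivative (\<lambda>h. (2 *\<^sub>R (x - closest_point K x)) \<bullet> h)) (at x)"
proof (rule has_derivativeI_sandwich[of 1])
  let ?q = "\<lambda>x. (norm (x - closest_point K x))\<^sup>2"
  show "bounded_linear (\<lambda>h. (2 *\<^sub>R (x - closest_point K x)) \<bullet> h)" by (rule bounded_linear_inner_right)
  show "((\<lambda>y. norm (y - x)) \<longlongrightarrow> 0) (at x)" by (intro tendsto_eq_intros) (auto intro!: tendsto_eq_intros)
  fix y assume "y \<noteq> x" "dist y x < 1"
  have "norm (y - closest_point K y) \<le> norm (y - closest_point K x)"
    using closest_point_le[OF K(1) closest_point_in_set[OF K(1,3)], of y x] by (simp add: dist_norm)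
  then have "?q y \<le> (norm (y - closest_point K x))\<^sup>2" by (intro power_mono) auto
  also have "\<dots> = ?q x + 2 * ((x - closest_point K x) \<bullet> (y - x)) + (norm (y - x))\<^sup>2"
    unfolding power2_norm_eq_inner by (simp add: inner_diff_left inner_diff_right inner_commute)
  finally have "\<bar>?q y - ?q x - (2 *\<^sub>R (x - closest_point K x)) \<bullet> (y - x)\<bar> \<le> (norm (y - x))\<^sup>2"
    using sq_dist_closest_point_lower[of x y] by simp
  then show "norm (?q y - ?q x - (2 *\<^sub>R (x - closest_point K x)) \<bullet> (y - x)) / norm (y - x) \<le> norm (y - x)"
    using \<open>y \<noteq> x\<close> by (simp add: divide_le_eq power2_eq_square)
qed auto

lemma convex_neighbourhood: "convex {x. norm (x - closest_point K x) \<le> e}"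
proof (rule convexI, clarify)
  fix x y and s t :: real
  assume *: "norm (x - closest_point K x) \<le> e" "norm (y - closest_point K y) \<le> e" "0 \<le> s" "0 \<le> t" "s + t = 1"
  let ?z = "s *\<^sub>R x + t *\<^sub>R y" and ?k = "s *\<^sub>R closest_point K x + t *\<^sub>R closest_point K y"
  have "?k \<in> K" using * by (intro convexD[OF K(2)] closest_point_in_set K)
  then have "norm (?z - closest_point K ?z) \<le> norm (?z - ?k)"
    using closest_point_le[OF K(1), of ?k ?z] by (simp add: dist_norm)
  also have "?z - ?k = s *\<^sub>R (x - closest_point K x) + t *\<^sub>R (y - closest_point K y)" by (simp add: algebra_simps)
  also have "norm \<dots> \<le> s * norm (x - closest_point K x) + t * norm (y - closest_point K y)"
    using * by (intro norm_triangle_le add_mono) auto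
  also have "\<dots> \<le> s * e + t * e" using * by (intro add_mono mult_left_mono) auto
  finally show "norm (?z - closest_point K ?z) \<le> e" using * by (simp add: distrib_right[symmetric])
qed

lemma continuous_on_closest_point_K: "continuous_on A (closest_point K)"
  by (rule continuous_on_closest_point[OF K(2,1,3)])

lemma compact_neighbourhood:
  assumes "bounded K"
  shows "compact {x. norm (x - closest_point K x) \<le> e}"
proof -
  obtain B where B: "\<And>x. x \<in> K \<Longrightarrow> norm x \<le> B" using assms by (auto simp: bounded_iff)
  have "norm x \<le> B + e" if "norm (x - closest_point K x) \<le> e" for x
    using that B[OF closest_point_in_set[OF K(1,3), of x]] norm_triangle_sub[of x "closest_point K x"] by simp
  then have "bounded {x. norm (x - closest_point K x) \<le> e}" unfolding bounded_iff by blast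
  moreover have "closed {x. norm (x - closest_point K x) \<le> e}"
    by (intro closed_Collect_le continuous_intros continuous_on_closest_point_K)
  ultimately show ?thesis by (simp add: compact_eq_bounded_closed)
qed

end

lemma has_real_derivative_sq_pos_part: "((\<lambda>t::real. (max 0 t)\<^sup>2) has_real_derivative 2 * max 0 t) (at t)"
  unfolding has_field_derivative_def
proof (rule has_derivativeI_sandwich[of 1])
  show "bounded_linear ((*) (2 * max 0 t))" by (rule bounded_linear_mult_right)
  show "((\<lambda>y. norm (y - t)) \<longlongrightarrow> 0) (at t)" by (intro tendsto_eq_intros) (auto intro!: tendsto_eq_intros)
  fix s assume "s \<noteq> t" "dist s t < 1"
  have "\<bar>(max 0 s)\<^sup>2 - (max 0 t)\<^sup>2 - 2 * max 0 t * (s - t)\<bar> \<le> (s - t)\<^sup>2"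
  proof (cases "0 \<le> s"; cases "0 \<le> t")
    assume "0 \<le> s" "0 \<le> t"
    then have "(max 0 s)\<^sup>2 - (max 0 t)\<^sup>2 - 2 * max 0 t * (s - t) = (s - t)\<^sup>2"
      by (simp add: max_def power2_eq_square algebra_simps)
    then show ?thesis by simp
  next
    assume st: "0 \<le> s" "\<not> 0 \<le> t"
    then have "s\<^sup>2 \<le> (s - t)\<^sup>2" by (intro power_mono) auto
    then show ?thesis using st by (simp add: max_def)
  next
    assume st: "\<not> 0 \<le> s" "0 \<le> t"
    then have "(max 0 s)\<^sup>2 - (max 0 t)\<^sup>2 - 2 * max 0 t * (s - t) = t * (t - 2 * s)"
      by (simp add: max_def power2_eq_square algebra_simps)
    moreover have "0 \<le> t * (t - 2 * s)" using st by (intro mult_nonneg_nonneg) auto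
    moreover have "(s - t)\<^sup>2 = t * (t - 2 * s) + s\<^sup>2" by (simp add: power2_eq_square algebra_simps)
    ultimately show ?thesis by simp
  qed (simp add: max_def)
  then show "norm ((max 0 s)\<^sup>2 - (max 0 t)\<^sup>2 - 2 * max 0 t * (s - t)) / norm (s - t) \<le> norm (s - t)"
    using \<open>s \<noteq> t\<close> by (simp add: divide_le_eq power2_eq_square)
qed auto

text \<open>
  The cutoff is \<open>w = (max 0 \<chi>)^2\<close> with \<open>\<chi> = 1 - dist(x, K)^2 / e^2\<close>. The square of the positive part
  makes \<open>w\<close> continuously differentiable; concavity of \<open>\<chi>\<close>, together with \<open>\<chi> \<ge> 0\<close> on \<open>L\<close>, gives the
  last estimate. That estimate replaces the sign of \<open>(T - x) \<bullet> n\<close> at the boundary of a convex set: it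
  bounds the boundary contribution by the volume of the layer \<open>L - K\<close>, uniformly in the thickness
  \<open>e\<close>, although \<open>G\<close> itself is of size \<open>1/e\<close>.
\<close>
lemma concave_cutoff_exists:
  fixes K :: "'a::euclidean_space set"
  assumes K: "closed K" "convex K" "K \<noteq> {}" and e: "0 < e"
  defines "L \<equiv> {x. norm (x - closest_point K x) \<le> e}"
  obtains w :: "'a \<Rightarrow> real" and G where
    "\<And>x. (w has_derivative (\<lambda>h. G x \<bullet> h)) (at x)" "continuous_on UNIV G"
    "\<And>x. 0 \<le> w x" "\<And>x. w x \<le> 1" "\<And>x. x \<in> K \<Longrightarrow> w x = 1"
    "\<And>x. x \<notin> L \<Longrightarrow> w x = 0" "\<And>x. x \<notin> L \<Longrightarrow> G x = 0"
    "\<And>x p. x \<in> L \<Longrightarrow> p \<in> L \<Longrightarrow> - 2 * indicator (- K) x \<le> G x \<bullet> (p - x)"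
proof
  define q where "q x = (norm (x - closest_point K x))\<^sup>2" for x
  define w where "w x = (max 0 (1 - q x / e\<^sup>2))\<^sup>2" for x
  define G where "G x = (- 4 * max 0 (1 - q x / e\<^sup>2) / e\<^sup>2) *\<^sub>R (x - closest_point K x)" for x
  have qd: "(q has_derivative (\<lambda>h. (2 *\<^sub>R (x - closest_point K x)) \<bullet> h)) (at x)" for x
    unfolding q_def by (rule has_derivative_sq_dist_closest_point[OF K])
  have cq: "continuous_on UNIV q" unfolding q_def
    by (intro continuous_intros continuous_on_closest_point K)
  have out: "1 - q x / e\<^sup>2 \<le> 0" if "x \<notin> L" for x
  proof -
    have "e\<^sup>2 \<le> q x" unfolding q_def using that e by (intro power_mono) (auto simp: L_def)
    then show ?thesis using e by simp
  qed
  have inq: "q x \<le> e\<^sup>2" if "x \<in> L" for x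
    using that unfolding q_def L_def by (auto intro: power_mono)
  have inK: "closest_point K x = x" "q x = 0" if "x \<in> K" for x
    using closest_point_self[OF that] by (auto simp: q_def)
  have q0: "0 \<le> q x" for x by (simp add: q_def)
  show "(w has_derivative (\<lambda>h. G x \<bullet> h)) (at x)" for x
  proof -
    have "((\<lambda>x. 1 - q x / e\<^sup>2) has_derivative (\<lambda>h. - ((2 *\<^sub>R (x - closest_point K x)) \<bullet> h) / e\<^sup>2)) (at x)"
      using has_derivative_diff[OF has_derivative_const has_derivative_mult_right[OF qd, of "inverse (e\<^sup>2)"], of 1 x]
      by (simp add: divide_inverse mult.commute)
    from has_derivative_compose[OF this has_real_derivative_sq_pos_part[unfolded has_field_derivative_def]]
    show ?thesis unfolding w_def G_def by (rule has_derivative_eq_rhs) (simp add: fun_eq_iff)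
  qed
  show "continuous_on UNIV G" unfolding G_def
    using e by (intro continuous_intros continuous_on_closest_point K cq) auto
  show "0 \<le> w x" for x by (simp add: w_def)
  show "w x \<le> 1" for x using q0[of x] by (auto simp: w_def max_def power_le_one_iff)
  show "w x = 1" if "x \<in> K" for x using inK[OF that] by (simp add: w_def)
  show "w x = 0" "G x = 0" if "x \<notin> L" for x using out[OF that] by (auto simp: w_def G_def max_def)
  show "- 2 * indicator (- K) x \<le> G x \<bullet> (p - x)" if "x \<in> L" "p \<in> L" for x p
  proof (cases "x \<in> K")
    case True then show ?thesis using inK[OF True] by (simp add: G_def)
  next
    case False
    let ?m = "max 0 (1 - q x / e\<^sup>2)"
    have m: "0 \<le> ?m" "?m \<le> 1" using q0[of x] by auto
    have "2 * ((x - closest_point K x) \<bullet> (p - x)) \<le> q p - q x"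
      using sq_dist_closest_point_lower[OF K, of x p] by (simp add: q_def)
    also have "\<dots> \<le> e\<^sup>2" using inq[OF that(2)] q0[of x] by simp
    finally have "?m * (2 * ((x - closest_point K x) \<bullet> (p - x))) \<le> ?m * e\<^sup>2" using m by (intro mult_left_mono) 
    also have "\<dots> \<le> 1 * e\<^sup>2" using m by (intro mult_right_mono) auto
    finally have "(?m * (2 * ((x - closest_point K x) \<bullet> (p - x)))) / e\<^sup>2 \<le> 1" using e by (simp add: divide_le_eq)
    then show ?thesis using False by (simp add: G_def)
  qed
qed

section \<open>Extending densities from a compact convex set to a box\<close>

lemma integrable_on_compact:
  fixes h :: "'a::euclidean_space \<Rightarrow> real"
  assumes "compact K" "continuous_on K h"
  shows "h integrable_on K"
  using borel_integrable_compact[OF assms] set_borel_integral_eq_integral(1)[of K h]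
  by (simp add: set_integrable_def)

text \<open>
  The extensions of \<open>u\<close> from \<open>K\<close> are continuous, and decrease to the extension by zero as \<open>m\<close> grows.
\<close>
lemma integral_decay_tendsto:
  fixes u :: "'a::euclidean_space \<Rightarrow> real"
  assumes K: "compact K" "convex K" "K \<noteq> {}" "K \<subseteq> cbox a b"
    and u: "continuous_on K u" "\<And>x. x \<in> K \<Longrightarrow> 0 < u x"
  defines "h \<equiv> \<lambda>m::nat. \<lambda>x. u (closest_point K x) / (1 + real m * norm (x - closest_point K x))"
  shows "\<And>m. continuous_on (cbox a b) (h m)"
    and "(\<lambda>m. integral (cbox a b) (h m)) \<longlonglongrightarrow> integral K u"
    and "\<And>m. integral K u \<le> integral (cbox a b) (h m)"
proof -
  have cl: "closed K" using K(1) by (rule compact_imp_closed)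
  let ?p = "closest_point K"
  have pin: "?p x \<in> K" for x by (rule closest_point_in_set[OF cl K(3)])
  have cp: "continuous_on A ?p" for A by (rule continuous_on_closest_point[OF K(2) cl K(3)])
  have cup: "continuous_on A (\<lambda>x. u (?p x))" for A
    using pin by (intro continuous_on_compose2[OF u(1) cp]) auto
  have den: "1 \<le> 1 + real m * norm (x - ?p x)" for m x by simp
  show cont: "continuous_on (cbox a b) (h m)" for m unfolding h_def
    by (intro continuous_intros cup cp) (use den in \<open>smt (verit)\<close>)
  have pos: "0 < h m x" for m x unfolding h_def using u(2)[OF pin[of x]] less_le_trans[OF zero_less_one den[of m x]] by (rule divide_pos_pos)
  let ?g = "\<lambda>x. if x \<in> K then u x else 0"
  have lim: "(\<lambda>m. h m x) \<longlonglongrightarrow> ?g x" for x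
  proof (cases "x \<in> K")
    case True then show ?thesis by (simp add: h_def closest_point_self)
  next
    case False
    then have "?p x \<noteq> x" using pin[of x] by auto
    then have "0 < norm (x - ?p x)" by simp
    then have "filterlim (\<lambda>m. 1 + real m * norm (x - ?p x)) at_top sequentially"
      by (intro filterlim_tendsto_add_at_top[OF tendsto_const] filterlim_at_top_mult_tendsto_pos[OF tendsto_const] filterlim_real_sequentially)
    then have "(\<lambda>m. u (?p x) / (1 + real m * norm (x - ?p x))) \<longlonglongrightarrow> 0"
      by (intro real_tendsto_divide_at_top[OF tendsto_const])
    then show ?thesis using False by (simp add: h_def)
  qed
  have bd: "norm (h m x) \<le> u (?p x)" for m x
    using pos[of m x] u(2)[OF pin[of x]] den[of m x] by (simp add: h_def divide_le_eq mult_le_cancel_left1)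
  have int: "h m integrable_on cbox a b" for m by (intro integrable_continuous cont)
  note dc = dominated_convergence[of h "cbox a b" "\<lambda>x. u (?p x)" ?g, OF int integrable_continuous[OF cup] bd lim]
  have eq: "integral (cbox a b) ?g = integral K u" using K(4) by (simp add: integral_restrict_Int Int_absorb2)
  show "(\<lambda>m. integral (cbox a b) (h m)) \<longlonglongrightarrow> integral K u" using dc(2) eq by simp
  have "integral (cbox a b) ?g \<le> integral (cbox a b) (h m)" for m
    using dc(1) int
  proof (rule integral_le)
    fix x show "?g x \<le> h m x" using pos[of m x] by (auto simp: h_def closest_point_self less_imp_le)
  qed
  then show "integral K u \<le> integral (cbox a b) (h m)" for m using eq by simp
qed

text \<open>
  The transport on a box needs positive continuous densities of equal mass, while the comparison
  of \<open>v\<close> at the projected image with \<open>g\<close> needs \<open>g\<close> not to exceed the value of \<open>v\<close> at the closest point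
  of \<open>K\<close>. There is no such restriction on \<open>f\<close> outside \<open>K\<close>, so \<open>g\<close> is fixed first, with little mass
  outside \<open>K\<close>, and \<open>f\<close> is adjusted to it.
\<close>
lemma extend_to_equal_mass:
  fixes u v :: "'a::euclidean_space \<Rightarrow> real"
  assumes K: "compact K" "convex K" "K \<noteq> {}" "K \<subseteq> box a b"
    and u: "continuous_on K u" "\<And>x. x \<in> K \<Longrightarrow> 0 < u x"
    and v: "continuous_on K v" "\<And>x. x \<in> K \<Longrightarrow> 0 < v x"
    and mass: "integral K u = integral K v" and \<delta>: "0 < \<delta>"
  obtains f g where "continuous_on (cbox a b) f" "\<And>x. 0 < f x"
    "continuous_on (cbox a b) g" "\<And>x. 0 < g x"
    "\<And>x. x \<in> K \<Longrightarrow> f x = u x" "\<And>x. x \<in> K \<Longrightarrow> g x = v x"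
    "\<And>x. g x \<le> v (closest_point K x)"
    "integral (cbox a b) f = integral (cbox a b) g" "integral (cbox a b) g \<le> integral K v + \<delta>"
proof -
  have cl: "closed K" using K(1) by (rule compact_imp_closed)
  have KQ: "K \<subseteq> cbox a b" using K(4) box_subset_cbox by blast
  let ?p = "closest_point K"
  let ?d = "\<lambda>x. norm (x - ?p x)"
  have pin: "?p x \<in> K" for x by (rule closest_point_in_set[OF cl K(3)])
  have cd: "continuous_on A ?d" for A
    by (intro continuous_intros continuous_on_closest_point[OF K(2) cl K(3)])
  define h where "h w m x = w (?p x) / (1 + real m * ?d x)" for w :: "'a \<Rightarrow> real" and m :: nat and x
  have h_fold: "(\<lambda>x. w (?p x) / (1 + real m * ?d x)) = h w m" for w m by (simp add: fun_eq_iff h_def)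
  note hu = integral_decay_tendsto[OF K(1-3) KQ u, unfolded h_fold]
  note hv = integral_decay_tendsto[OF K(1-3) KQ v, unfolded h_fold]
  have hpos: "0 < h w m x" if "\<And>x. x \<in> K \<Longrightarrow> 0 < w x" for w m x
    unfolding h_def using that[OF pin[of x]] by (intro divide_pos_pos add_pos_nonneg) auto
  have bne: "box a b \<noteq> {}" using K(3,4) by auto
  then have aQ: "a \<in> cbox a b" by (auto simp: mem_box box_ne_empty less_imp_le)
  have "a \<notin> K" using K(4) by (auto simp: mem_box box_def)
  then have da: "0 < ?d a" using pin[of a] by auto
  have pos_int: "0 < integral (cbox a b) r"
    if "continuous_on (cbox a b) r" "\<And>x. x \<in> cbox a b \<Longrightarrow> 0 \<le> r x" "r a \<noteq> 0" for r :: "'a \<Rightarrow> real"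
  proof -
    have "integral (cbox a b) r \<noteq> 0" using integral_cbox_eq_0_iff[OF that(1) bne that(2)] aQ that(3) by auto
    moreover have "0 \<le> integral (cbox a b) r" using that by (intro integral_nonneg integrable_continuous) auto
    ultimately show ?thesis by simp
  qed
  have "eventually (\<lambda>m. integral (cbox a b) (h v m) < integral K v + \<delta>) sequentially"
    using \<delta> by (intro order_tendstoD(2)[OF hv(2)]) auto
  then obtain m where m: "integral (cbox a b) (h v m) < integral K v + \<delta>"
    by (auto simp: eventually_sequentially)
  \<comment> \<open>the mass of \<open>g\<close> strictly exceeds that of \<open>v\<close> on \<open>K\<close>, which leaves room for the extension of \<open>u\<close>\<close>
  have "0 < integral (cbox a b) (\<lambda>x. h v m x - h v (Suc m) x)"
  proof (rule pos_int)
    show "continuous_on (cbox a b) (\<lambda>x. h v m x - h v (Suc m) x)" by (intro continuous_intros hv(1))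
    show "0 \<le> h v m x - h v (Suc m) x" for x
      using v(2)[OF pin[of x]] by (auto simp: h_def intro!: divide_left_mono mult_right_mono mult_pos_pos add_pos_nonneg)
    have "h v (Suc m) a < h v m a" unfolding h_def
      using v(2)[OF pin[of a]] da by (intro divide_strict_left_mono mult_pos_pos add_pos_nonneg) auto
    then show "h v m a - h v (Suc m) a \<noteq> 0" by simp
  qed
  also have "\<dots> = integral (cbox a b) (h v m) - integral (cbox a b) (h v (Suc m))"
    by (intro integral_diff integrable_continuous hv(1))
  finally have strict: "integral K u < integral (cbox a b) (h v m)"
    using hv(3)[of "Suc m"] mass by simp
  have "eventually (\<lambda>n. integral (cbox a b) (h u n) < integral (cbox a b) (h v m)) sequentially"
    by (rule order_tendstoD(2)[OF hu(2) strict])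
  then obtain n where n: "integral (cbox a b) (h u n) < integral (cbox a b) (h v m)"
    by (auto simp: eventually_sequentially)
  have dint: "0 < integral (cbox a b) ?d" using da by (intro pos_int cd) auto
  \<comment> \<open>the distance function vanishes on \<open>K\<close> and can absorb the missing mass\<close>
  define s where "s = (integral (cbox a b) (h v m) - integral (cbox a b) (h u n)) / integral (cbox a b) ?d"
  have s: "0 \<le> s" unfolding s_def using n dint by simp
  show thesis
  proof (rule that[of "\<lambda>x. h u n x + s * ?d x" "h v m"])
    show "continuous_on (cbox a b) (\<lambda>x. h u n x + s * ?d x)" by (intro continuous_intros hu(1) cd)
    show "0 < h u n x + s * ?d x" for x using hpos[of u n x] u(2) s by (intro add_pos_nonneg) auto
    show "continuous_on (cbox a b) (h v m)" by (rule hv(1))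
    show "0 < h v m x" for x by (rule hpos[OF v(2)])
    show "h u n x + s * ?d x = u x" "h v m x = v x" if "x \<in> K" for x
      using closest_point_self[OF that] by (auto simp: h_def)
    show "h v m x \<le> v (?p x)" for x
      using v(2)[OF pin[of x]] by (auto simp: h_def divide_le_eq mult_le_cancel_left1 add_pos_nonneg)
    have "integral (cbox a b) (\<lambda>x. h u n x + s * ?d x) = integral (cbox a b) (h u n) + s * integral (cbox a b) ?d"
      by (subst integral_add) (auto intro!: integrable_continuous hu(1) cd continuous_intros)
    then show "integral (cbox a b) (\<lambda>x. h u n x + s * ?d x) = integral (cbox a b) (h v m)"
      using dint by (simp add: s_def)
    show "integral (cbox a b) (h v m) \<le> integral K v + \<delta>" using m by simp
  qed
qed

section \<open>McCann's condition\<close>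

text \<open>
  The equation for the derivative of \<open>H\<close> says that \<open>U\<close> is the pressure \<open>r H'(r) - H(r)\<close>. The last but
  one assumption is convexity of \<open>H\<close> at \<open>s\<close>, written without \<open>H'\<close>.
\<close>
locale mccann_entropy =
  fixes H U dU :: "real \<Rightarrow> real" and N :: nat
  assumes N: "0 < N"
    and H_deriv: "\<And>r. 0 < r \<Longrightarrow> (H has_real_derivative (H r + U r) / r) (at r)"
    and U_deriv: "\<And>r. 0 < r \<Longrightarrow> (U has_real_derivative dU r) (at r)"
    and U_nonneg: "\<And>r. 0 < r \<Longrightarrow> 0 \<le> U r"
    and mccann_condition: "\<And>r. 0 < r \<Longrightarrow> 0 \<le> r * dU r - U r + U r / N"
    and H_tangent: "\<And>r s. 0 < r \<Longrightarrow> 0 < s \<Longrightarrow> 0 \<le> H r - r * ((H s + U s) / s) + U s"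
    and dU_cont: "continuous_on {0<..} dU"
begin

text \<open>McCann's condition is exactly the sign of the derivative of \<open>U(r) / r^(1 - 1/N)\<close>.\<close>
lemma scaled_pressure_mono:
  assumes "0 < r" "r \<le> s"
  shows "U r * r powr (1 / N - 1) \<le> U s * s powr (1 / N - 1)"
proof (rule DERIV_nonneg_imp_nondecreasing[OF assms(2)])
  fix x assume "r \<le> x" "x \<le> s"
  then have x: "0 < x" using assms by simp
  have "((\<lambda>x. U x * x powr (1 / N - 1)) has_real_derivative
      dU x * x powr (1 / N - 1) + U x * ((1 / N - 1) * x powr (1 / N - 1 - 1))) (at x)"
    using x by (auto intro!: derivative_eq_intros U_deriv)
  moreover have "x powr (1 / N - 1) = x * x powr (1 / N - 1 - 1)"
    using x by (simp add: powr_diff power2_eq_square)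
  then have "dU x * x powr (1 / N - 1) + U x * ((1 / N - 1) * x powr (1 / N - 1 - 1))
     = (x * dU x - U x + U x / N) * x powr (1 / N - 1 - 1)" by (simp add: algebra_simps)
  then have "0 \<le> dU x * x powr (1 / N - 1) + U x * ((1 / N - 1) * x powr (1 / N - 1 - 1))"
    using mccann_condition[OF x] by simp
  ultimately show "\<exists>y. ((\<lambda>x. U x * x powr (1 / N - 1)) has_real_derivative y) (at x) \<and> 0 \<le> y" by blast
qed

text \<open>
  The tangent at \<open>\<lambda> = 1\<close> of \<open>\<lambda> \<mapsto> \<lambda>^N H(r / \<lambda>^N)\<close>, with \<open>s = r / \<lambda>^N\<close> as the variable. The difference of
  the two sides has a minimum at \<open>s = r\<close>, where it vanishes: its derivative in \<open>s\<close> has the sign of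
  the increment of the scaled pressure.
\<close>
lemma dilation_tangent:
  assumes r: "0 < r" and s: "0 < s"
  shows "H r - N * U r * ((r / s) powr (1 / N) - 1) \<le> r * H s / s"
proof -
  define F where "F s = r * (H s / s) + N * U r * r powr (1 / N) * s powr (- 1 / N)" for s
  define F' where "F' s = r * s powr (- 1 / N - 1) * (U s * s powr (1 / N - 1) - U r * r powr (1 / N - 1))" for s
  have D: "(F has_real_derivative F' x) (at x)" if x: "0 < x" for x
  proof -
    have "(F has_real_derivative r * (((H x + U x) / x * x - H x * 1) / (x * x)) + N * U r * r powr (1 / N) * ((- 1 / N) * x powr (- 1 / N - 1))) (at x)"
      unfolding F_def using x by (auto intro!: derivative_eq_intros H_deriv) (auto simp: algebra_simps)
    moreover have "r * (((H x + U x) / x * x - H x * 1) / (x * x)) = r * x powr (- 1 / N - 1) * (U x * x powr (1 / N - 1))"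
    proof -
      have "x powr (- 1 / N - 1) * x powr (1 / N - 1) = x powr (- 2)" by (simp add: powr_add[symmetric])
      also have "\<dots> = 1 / (x * x)" using x by (simp add: powr_minus powr_numeral power2_eq_square divide_inverse)
      finally have p: "x powr (- 1 / N - 1) * x powr (1 / N - 1) = 1 / (x * x)" .
      have "r * x powr (- 1 / N - 1) * (U x * x powr (1 / N - 1)) = r * U x * (x powr (- 1 / N - 1) * x powr (1 / N - 1))"
        by (simp only: mult_ac)
      moreover have "(H x + U x) / x * x - H x * 1 = U x" using x by simp
      ultimately show ?thesis unfolding p by simp
    qed
    moreover have "N * U r * r powr (1 / N) * ((- 1 / N) * x powr (- 1 / N - 1)) = - r * x powr (- 1 / N - 1) * (U r * r powr (1 / N - 1))"
      using N r by (simp add: powr_diff)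
    ultimately show ?thesis unfolding F'_def by (simp add: algebra_simps)
  qed
  have "F r \<le> F s"
  proof (cases "r \<le> s")
    case True
    show ?thesis
    proof (rule DERIV_nonneg_imp_nondecreasing[OF True])
      fix x assume x: "r \<le> x" "x \<le> s"
      then have "0 \<le> F' x" unfolding F'_def using scaled_pressure_mono[OF r x(1)] r by simp
      then show "\<exists>y. (F has_real_derivative y) (at x) \<and> 0 \<le> y" using D[of x] r x by fastforce
    qed
  next
    case False
    then have le: "s \<le> r" by simp
    show ?thesis
    proof (rule DERIV_nonpos_imp_nonincreasing[OF le])
      fix x assume x: "s \<le> x" "x \<le> r"
      then have "F' x \<le> 0" unfolding F'_def using scaled_pressure_mono[OF _ x(2)] r s
        by (intro mult_nonneg_nonpos) auto
      then show "\<exists>y. (F has_real_derivative y) (at x) \<and> y \<le> 0" using D[of x] s x by fastforce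
    qed
  qed
  moreover have "r powr (1 / N) * r powr (- 1 / N) = 1" using r by (simp add: powr_add[symmetric])
  then have "F r = H r + N * U r" using r by (simp add: F_def mult.assoc)
  moreover have "r powr (1 / N) * s powr (- 1 / N) = (r / s) powr (1 / N)"
    using r s powr_minus_divide[of s "1 / N"] by (simp add: powr_divide)
  then have "F s = r * H s / s + N * U r * (r / s) powr (1 / N)" by (simp add: F_def mult.assoc)
  ultimately show ?thesis by (simp add: algebra_simps)
qed

text \<open>
  For a triangular map the product of the \<open>D i\<close> is the Jacobian determinant and their sum is the
  divergence; the arithmetic-geometric mean inequality turns a dilation factor into a divergence.
\<close>
lemma transport_tangent:
  assumes r: "0 < r" and s: "0 < s" and I: "finite I" "card I = N"
    and D: "\<And>i. i \<in> I \<Longrightarrow> 0 < D i" and le: "r / s \<le> (\<Prod>i\<in>I. D i)"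
  shows "H r - U r * ((\<Sum>i\<in>I. D i) - N) \<le> r * H s / s"
proof -
  have ne: "I \<noteq> {}" using I N by auto
  have "(r / s) powr (1 / N) \<le> (\<Prod>i\<in>I. D i) powr (1 / N)" using le r s by (intro powr_mono2) auto
  also have "\<dots> \<le> (\<Sum>i\<in>I. D i / N)"
    using arith_geom_mean[OF I(1) ne, of D] D I(2) by (simp add: less_imp_le)
  finally have "N * ((r / s) powr (1 / N) - 1) \<le> (\<Sum>i\<in>I. D i) - N"
    using N by (simp add: sum_divide_distrib[symmetric] field_simps)
  then have "U r * (N * ((r / s) powr (1 / N) - 1)) \<le> U r * ((\<Sum>i\<in>I. D i) - N)"
    using U_nonneg[OF r] by (rule mult_left_mono)
  then show ?thesis using dilation_tangent[OF r s] by (simp add: algebra_simps)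
qed

end

section \<open>The entropy inequality on a compact convex set\<close>

context mccann_entropy
begin

lemma continuous_on_H: "continuous_on {0<..} H"
  using H_deriv by (intro continuous_at_imp_continuous_on) (auto intro: DERIV_isCont)

lemma continuous_on_U: "continuous_on {0<..} U"
  using U_deriv by (intro continuous_at_imp_continuous_on) (auto intro: DERIV_isCont)

text \<open>
  The complete pointwise estimate. Here \<open>r = u(x)\<close>, \<open>y = T(x)\<close>, \<open>p\<close> is the closest point of \<open>y\<close> in \<open>L\<close>,
  \<open>s = v(p)\<close>, \<open>w\<close> and \<open>G\<close> are the cutoff and its gradient at \<open>x\<close>, and \<open>\<kappa>\<close> is the value at \<open>x\<close> of the
  indicator of the boundary layer. The bracket on the right is the integrand that vanishes after integration
  by parts; the remaining terms are the error of projecting \<open>y\<close> to \<open>p\<close>, the energy left by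
  completing the square, and the error of the boundary layer.
\<close>
lemma entropy_pointwise:
  fixes x y p gu W :: "'a::euclidean_space"
  assumes N: "finite I" "card I = N"
    and pos: "0 < r" "0 < s" "\<And>i. i \<in> I \<Longrightarrow> 0 < D i" and le: "r / s \<le> (\<Prod>i\<in>I. D i)"
    and V: "- ((H s + U s) / s) \<ge> Vx + W \<bullet> (p - x) + C / 2 * (norm (p - x))\<^sup>2"
    and C: "0 < C" and w: "0 \<le> w" "w \<le> 1" and G: "- 2 * \<kappa> \<le> G \<bullet> (p - x)" "0 \<le> \<kappa>"
    and g: "norm (U r *\<^sub>R G + (w * dU r) *\<^sub>R gu) \<le> P * r"
    and A: "U r \<le> A" and B: "U s / s \<le> B" and M: "r \<le> M" and wk: "1 - w \<le> \<kappa>"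
  shows "w * (H r + r * Vx) + r * (U s / s) \<le>
     (w * U r * ((\<Sum>i\<in>I. D i) - N) + (U r *\<^sub>R G + (w * dU r) *\<^sub>R gu) \<bullet> (y - x))
     + P * (r * norm (y - p)) + 1 / (2 * C) * (r * (norm ((dU r / r) *\<^sub>R gu + W))\<^sup>2)
     + (2 * A + B * M) * \<kappa>"
proof -
  let ?S = "\<Sum>i\<in>I. D i" and ?a = "(dU r / r) *\<^sub>R gu + W" and ?g = "U r *\<^sub>R G + (w * dU r) *\<^sub>R gu"
  have "H r - U r * (?S - N) \<le> r * H s / s" by (intro transport_tangent assms)
  also have "r * H s / s = - r * (- ((H s + U s) / s)) - r * (U s / s)"
    using pos by (simp add: field_simps)
  also have "\<dots> \<le> - r * (Vx + W \<bullet> (p - x) + C / 2 * (norm (p - x))\<^sup>2) - r * (U s / s)"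
    using mult_left_mono[OF V less_imp_le[OF pos(1)]] by linarith
  finally have 1: "H r + r * Vx + r * (U s / s) \<le> U r * (?S - N) - r * (W \<bullet> (p - x)) - r * (C / 2 * (norm (p - x))\<^sup>2)"
    by (simp add: algebra_simps)
  have "w * (H r + r * Vx + r * (U s / s)) \<le> w * (U r * (?S - N) - r * (W \<bullet> (p - x)) - r * (C / 2 * (norm (p - x))\<^sup>2))"
    using 1 w(1) by (rule mult_left_mono)
  then have 2: "w * (H r + r * Vx) + w * r * (U s / s) \<le> w * U r * (?S - N) - w * r * (W \<bullet> (p - x)) - w * r * (C / 2 * (norm (p - x))\<^sup>2)"
    by (simp add: algebra_simps)
  have "- (P * r * norm (y - p)) \<le> ?g \<bullet> (y - p)"
  proof -
    have "\<bar>?g \<bullet> (y - p)\<bar> \<le> norm ?g * norm (y - p)" by (rule Cauchy_Schwarz_ineq2)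
    also have "\<dots> \<le> P * r * norm (y - p)" using g by (intro mult_right_mono) auto
    finally show ?thesis by linarith
  qed
  moreover have "U r * (- 2 * \<kappa>) \<le> U r * (G \<bullet> (p - x))" using G(1) U_nonneg[OF pos(1)] by (rule mult_left_mono)
  moreover have "U r * (2 * \<kappa>) \<le> A * (2 * \<kappa>)" using A G(2) by (intro mult_right_mono) auto
  moreover have "?g \<bullet> (y - x) = ?g \<bullet> (y - p) + U r * (G \<bullet> (p - x)) + w * r * ((dU r / r) * (gu \<bullet> (p - x)))"
    using pos by (simp add: inner_add_left inner_diff_right algebra_simps)
  ultimately have 3: "w * r * ((dU r / r) * (gu \<bullet> (p - x))) \<le> ?g \<bullet> (y - x) + P * r * norm (y - p) + A * (2 * \<kappa>)" by simp
  \<comment> \<open>completing the square in \<open>p - x\<close>\<close>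
  have "0 \<le> (norm (?a + C *\<^sub>R (p - x)))\<^sup>2" by simp
  also have "\<dots> = (norm ?a)\<^sup>2 + 2 * C * (?a \<bullet> (p - x)) + C\<^sup>2 * (norm (p - x))\<^sup>2"
    unfolding power2_norm_eq_inner by (simp add: inner_add_left inner_add_right inner_commute power2_eq_square algebra_simps)
  finally have "0 \<le> ((norm ?a)\<^sup>2 + 2 * C * (?a \<bullet> (p - x)) + C\<^sup>2 * (norm (p - x))\<^sup>2) / (2 * C)"
    using C by simp
  also have "\<dots> = (norm ?a)\<^sup>2 / (2 * C) + ?a \<bullet> (p - x) + C / 2 * (norm (p - x))\<^sup>2"
    using C by (simp add: add_divide_distrib power2_eq_square)
  finally have "- (?a \<bullet> (p - x)) - C / 2 * (norm (p - x))\<^sup>2 \<le> (norm ?a)\<^sup>2 / (2 * C)" by simp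
  then have "w * r * (- (?a \<bullet> (p - x)) - C / 2 * (norm (p - x))\<^sup>2) \<le> w * r * ((norm ?a)\<^sup>2 / (2 * C))"
    using w pos by (intro mult_left_mono) auto
  also have "\<dots> \<le> 1 * r * ((norm ?a)\<^sup>2 / (2 * C))" using w pos C by (intro mult_right_mono) auto
  finally have 4: "- w * r * (?a \<bullet> (p - x)) - w * r * (C / 2 * (norm (p - x))\<^sup>2) \<le> 1 / (2 * C) * (r * (norm ?a)\<^sup>2)"
    by (simp add: algebra_simps)
  have 5: "w * r * (?a \<bullet> (p - x)) = w * r * ((dU r / r) * (gu \<bullet> (p - x))) + w * r * (W \<bullet> (p - x))"
    by (simp add: inner_add_left distrib_left)
  have k0: "0 \<le> U s / s" using U_nonneg pos by simp
  have "(1 - w) * (r * (U s / s)) \<le> \<kappa> * (M * B)"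
    using wk w M B k0 pos G(2) mult_nonneg_nonneg[OF less_imp_le[OF pos(1)] k0] by (intro mult_mono) auto
  moreover have dist: "(1 - w) * (r * q) = r * q - w * r * q" for q by (simp add: algebra_simps)
  moreover have "\<kappa> * (M * B) = B * M * \<kappa>" by simp
  ultimately have 6: "r * (U s / s) \<le> w * r * (U s / s) + B * M * \<kappa>"
    unfolding dist by linarith
  show ?thesis using 2 3 4 5 6 by (simp add: algebra_simps)
qed

text \<open>
  The entropy inequality on the compact set \<open>L\<close>, the \<open>e\<close>-neighbourhood of \<open>K\<close>, up to a multiple of the
  volume of \<open>L - K\<close>. The pointwise estimate is integrated over a box around \<open>L\<close> against a transport of
  extended densities that have mass at most \<open>\<delta>\<close> outside \<open>L\<close>; letting \<open>\<delta>\<close> tend to \<open>0\<close> removes the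
  dependence on the extension. The potential \<open>V\<close> enters through its first-order convexity
  inequality only, so that \<open>v\<close> is merely continuous; this matters because \<open>\<psi>\<inverse>\<close> need not be
  differentiable.
\<close>
lemma bounded_entropy_inequality:
  fixes u v V :: "real ^ 'n::finite \<Rightarrow> real" and gu W :: "real ^ 'n \<Rightarrow> real ^ 'n"
  assumes N_card: "N = CARD('n)"
    and K: "compact K" "convex K" "K \<noteq> {}" and e: "0 < e"
  defines "L \<equiv> {x. norm (x - closest_point K x) \<le> e}"
  assumes Om: "open Om" "L \<subseteq> Om"
    and u: "\<And>x. x \<in> Om \<Longrightarrow> 0 < u x" "\<And>x. x \<in> Om \<Longrightarrow> (u has_derivative (\<lambda>h. gu x \<bullet> h)) (at x)"
      "continuous_on Om gu"
    and v: "continuous_on L v" "\<And>x. x \<in> L \<Longrightarrow> 0 < v x"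
    and V: "\<And>x. x \<in> L \<Longrightarrow> V x = - ((H (v x) + U (v x)) / v x)"
    and W: "continuous_on L W"
      "\<And>x p. x \<in> L \<Longrightarrow> p \<in> L \<Longrightarrow> V x + W x \<bullet> (p - x) + C / 2 * (norm (p - x))\<^sup>2 \<le> V p"
    and C: "0 < C"
    and mass: "integral L u = integral L v"
    and A: "\<And>x. x \<in> L \<Longrightarrow> U (u x) \<le> A" and B: "\<And>x. x \<in> L \<Longrightarrow> U (v x) / v x \<le> B"
    and M: "\<And>x. x \<in> L \<Longrightarrow> u x \<le> M"
  shows "integral K (\<lambda>x. H (u x) + u x * V x + U (v x))
    \<le> 1 / (2 * C) * integral L (\<lambda>x. u x * (norm ((dU (u x) / u x) *\<^sub>R gu x + W x))\<^sup>2)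
      + (2 * A + B * M) * (integral L (\<lambda>_. 1) - integral K (\<lambda>_. 1))"
proof -
  have clK: "closed K" and bdK: "bounded K" using K(1) by (auto simp: compact_eq_bounded_closed)
  have KL: "K \<subseteq> L" using e by (auto simp: L_def closest_point_self)
  have L: "compact L" "convex L" "L \<noteq> {}" unfolding L_def
    using compact_neighbourhood[OF clK K(2,3) bdK] convex_neighbourhood[OF clK K(2,3)] KL K(3)
    by (auto simp: L_def)
  have clL: "closed L" using L(1) by (rule compact_imp_closed)
  obtain c where c: "L \<subseteq> box (- c) c" using bounded_subset_box_symmetric compact_imp_bounded L(1) by blast
  let ?Q = "cbox (- c) c"
  have LQ: "L \<subseteq> ?Q" using c box_subset_cbox by blast
  have KQ: "K \<subseteq> ?Q" using LQ KL by blast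
  have c_pos: "(- c) $ i < c $ i" for i
  proof -
    obtain x where "x \<in> box (- c) c" using c L(3) by blast
    then have "(- c) $ i < x $ i" "x $ i < c $ i" by (simp_all only: mem_box_cart)
    then show ?thesis by (rule less_trans)
  qed
  obtain w G where w: "\<And>x. (w has_derivative (\<lambda>h. G x \<bullet> h)) (at x)" "continuous_on UNIV G"
    "\<And>x. 0 \<le> w x" "\<And>x. w x \<le> 1" "\<And>x. x \<in> K \<Longrightarrow> w x = 1"
    "\<And>x. x \<notin> L \<Longrightarrow> w x = 0" "\<And>x. x \<notin> L \<Longrightarrow> G x = 0"
    "\<And>x p. x \<in> L \<Longrightarrow> p \<in> L \<Longrightarrow> - 2 * indicator (- K) x \<le> G x \<bullet> (p - x)"
    proof -
      show thesis by (rule concave_cutoff_exists[OF clK K(2,3) e, folded L_def]) (fact that)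
    qed
  have cw: "continuous_on S w" for S
    using w(1) by (meson continuous_at_imp_continuous_on has_derivative_continuous)
  have cu: "continuous_on Om u"
    using u(2) by (meson continuous_at_imp_continuous_on has_derivative_continuous)
  have cuL: "continuous_on L u" by (rule continuous_on_subset[OF cu Om(2)])
  have uL: "0 < u x" if "x \<in> L" for x using u(1) that Om(2) by blast
  have cHu: "continuous_on L (\<lambda>x. H (u x))" and cUu: "continuous_on L (\<lambda>x. U (u x))" and cdUu: "continuous_on L (\<lambda>x. dU (u x))"
    by (auto intro!: continuous_on_compose2[OF continuous_on_H cuL] continuous_on_compose2[OF continuous_on_U cuL]
        continuous_on_compose2[OF dU_cont cuL] uL)
  have cHv: "continuous_on L (\<lambda>x. H (v x))" and cUv: "continuous_on L (\<lambda>x. U (v x))"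
    by (auto intro!: continuous_on_compose2[OF continuous_on_H v(1)] continuous_on_compose2[OF continuous_on_U v(1)] v(2))
  have cV: "continuous_on L V"
  proof -
    have "continuous_on L (\<lambda>x. - ((H (v x) + U (v x)) / v x))"
      using v(2) by (intro continuous_intros cHv cUv v(1)) (auto simp: less_imp_neq[THEN not_sym])
    then show ?thesis by (rule continuous_on_eq) (simp add: V)
  qed
  have cguL: "continuous_on L gu" by (rule continuous_on_subset[OF u(3) Om(2)])
  \<comment> \<open>\<open>\<phi>\<close> is the test function of the integration by parts, and \<open>g\<phi>\<close> its gradient\<close>
  define \<phi> where "\<phi> x = w x * U (u x)" for x
  define g\<phi> where "g\<phi> x = U (u x) *\<^sub>R G x + (w x * dU (u x)) *\<^sub>R gu x" for x
  have \<phi>_out: "\<phi> x = 0" "g\<phi> x = 0" if "x \<notin> L" for x using w(6,7)[OF that] by (auto simp: \<phi>_def g\<phi>_def)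
  have UNIV_eq: "UNIV = Om \<union> - L" using Om(2) by blast
  have d\<phi>: "(\<phi> has_derivative (\<lambda>h. g\<phi> x \<bullet> h)) (at x)" for x
  proof (cases "x \<in> Om")
    case True
    have "((\<lambda>x. U (u x)) has_derivative (\<lambda>h. dU (u x) * (gu x \<bullet> h))) (at x)"
      using has_derivative_compose[OF u(2)[OF True] U_deriv[OF u(1)[OF True], unfolded has_field_derivative_def]] .
    from has_derivative_mult[OF w(1) this] show ?thesis unfolding \<phi>_def g\<phi>_def
      by (rule has_derivative_eq_rhs) (simp add: fun_eq_iff inner_add_left algebra_simps)
  next
    case False
    then have x: "x \<in> - L" using Om(2) by blast
    have "((\<lambda>x. 0) has_derivative (\<lambda>h. g\<phi> x \<bullet> h)) (at x)" using \<phi>_out x by simp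
    then show ?thesis
      by (rule has_derivative_transform_within_open[OF _ _ x]) (use \<phi>_out clL in auto)
  qed
  have cg\<phi>: "continuous_on UNIV g\<phi>"
  proof -
    have "continuous_on Om g\<phi>" unfolding g\<phi>_def
      by (intro continuous_intros continuous_on_compose2[OF continuous_on_U cu] continuous_on_compose2[OF dU_cont cu]
          u(3) continuous_on_subset[OF w(2)] cw) (auto simp: u(1))
    moreover have "continuous_on (- L) (\<lambda>x. 0 :: real ^ 'n)" by simp
    then have "continuous_on (- L) g\<phi>" by (rule continuous_on_eq) (simp add: \<phi>_out)
    ultimately have "continuous_on (Om \<union> - L) g\<phi>"
      using Om(1) clL by (intro continuous_on_open_Un) auto
    then show ?thesis using UNIV_eq by metis
  qed
  have c\<phi>: "continuous_on S \<phi>" for S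
    using d\<phi> by (meson continuous_at_imp_continuous_on has_derivative_continuous)
  obtain P where P: "\<And>x. x \<in> L \<Longrightarrow> norm (g\<phi> x) \<le> P * u x" and P0: "0 \<le> P"
  proof -
    have "continuous_on L (\<lambda>x. norm (g\<phi> x) / u x)"
      using uL by (intro continuous_intros cuL continuous_on_subset[OF cg\<phi>]) (auto simp: less_imp_neq[THEN not_sym])
    then have "bounded ((\<lambda>x. norm (g\<phi> x) / u x) ` L)"
      using L(1) compact_continuous_image compact_imp_bounded by blast
    then obtain P where P: "0 < P" "\<forall>r\<in>(\<lambda>x. norm (g\<phi> x) / u x) ` L. norm r \<le> P" unfolding bounded_pos by blast
    show thesis
    proof (rule that)
      fix x assume x: "x \<in> L"
      have "norm (g\<phi> x) / u x \<le> P" using P(2) x order_trans[OF abs_ge_self] by fastforce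
      then show "norm (g\<phi> x) \<le> P * u x" using uL[OF x] by (simp add: pos_divide_le_eq)
    qed (use P(1) in simp)
  qed
  let ?p = "closest_point L"
  have pin: "?p x \<in> L" for x by (rule closest_point_in_set[OF clL L(3)])
  have cp: "continuous_on S ?p" for S by (rule continuous_on_closest_point[OF L(2) clL L(3)])
  \<comment> \<open>the observable whose transport turns \<open>u k(T)\<close> into \<open>U(v)\<close> on \<open>L\<close>\<close>
  define k where "k y = U (v (?p y)) / v (?p y)" for y
  have ck: "continuous_on S k" for S unfolding k_def
    using pin v(2) by (intro continuous_intros continuous_on_compose2[OF cUv cp] continuous_on_compose2[OF v(1) cp])
      (auto simp: less_imp_neq[THEN not_sym])
  have k0: "0 \<le> k y" for y unfolding k_def using U_nonneg v(2)[OF pin[of y]] by simp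
  have kB: "k y \<le> B" for y unfolding k_def by (rule B[OF pin])
  define d where "d y = norm (y - ?p y)" for y
  have cd: "continuous_on S d" for S unfolding d_def by (intro continuous_intros cp)
  have d0: "0 \<le> d y" for y by (simp add: d_def)
  have dL: "d y = 0" if "y \<in> L" for y using that by (simp add: d_def closest_point_self)
  obtain E where E: "\<And>y. y \<in> ?Q \<Longrightarrow> d y \<le> E" "0 \<le> E"
  proof -
    have "bounded (d ` ?Q)" using compact_continuous_image[OF cd compact_cbox] compact_imp_bounded by blast
    then obtain E where "\<forall>r\<in>d ` ?Q. norm r \<le> E" "0 < E" unfolding bounded_pos by blast
    then show thesis using d0 by (intro that[of E]) auto
  qed
  let ?a = "\<lambda>x. (dU (u x) / u x) *\<^sub>R gu x + W x"
  have ca: "continuous_on L (\<lambda>x. u x * (norm (?a x))\<^sup>2)"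
    using uL by (intro continuous_intros cuL cdUu cguL W(1)) (auto simp: less_imp_neq[THEN not_sym])
  let ?e = "\<lambda>x. w x * (H (u x) + u x * V x)"
  have ce: "continuous_on L ?e" by (intro continuous_intros cw cHu cuL cV)
  let ?I = "integral L (\<lambda>x. u x * (norm (?a x))\<^sup>2)"
  let ?E = "integral L (\<lambda>_. 1) - integral K (\<lambda>_. 1::real)"
  have ext_int: "(\<lambda>x. if x \<in> S then h x else 0) integrable_on ?Q"
    and ext_eq: "integral ?Q (\<lambda>x. if x \<in> S then h x else 0) = integral S h"
    if "compact S" "S \<subseteq> ?Q" "continuous_on S h" for S and h :: "real ^ 'n \<Rightarrow> real"
    using that integrable_on_compact[of S h]
    by (simp_all add: integral_restrict_Int integrable_restrict_Int Int_absorb2)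
  have step: "integral L ?e + integral L (\<lambda>x. U (v x)) \<le> 1 / (2 * C) * ?I + (2 * A + B * M) * ?E + (P * E + B) * \<delta>"
    if \<delta>: "0 < \<delta>" for \<delta>
  proof -
    obtain f g where f: "continuous_on ?Q f" "\<And>x. 0 < f x"
      and g: "continuous_on ?Q g" "\<And>x. 0 < g x"
      and fg: "\<And>x. x \<in> L \<Longrightarrow> f x = u x" "\<And>x. x \<in> L \<Longrightarrow> g x = v x"
        "\<And>x. g x \<le> v (?p x)"
        "integral ?Q f = integral ?Q g" "integral ?Q g \<le> integral L v + \<delta>"
      proof -
      show thesis by (rule extend_to_equal_mass[OF L c cuL uL v mass \<delta>]; (assumption | fact that))
    qed
    obtain T D where T: "triangular_transport (- c) c UNIV f g T D"
      using triangular_transport_exists[OF c_pos f(1) f(2) g(1) g(2) fg(4)] by blast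
    note T' = triangular_transportD[OF T]
    define R where "R x = \<phi> x * ((\<Sum>i\<in>UNIV. D i x) - real CARD('n)) + g\<phi> x \<bullet> (T x - x)" for x
    have R0: "integral ?Q R = 0" unfolding R_def
      using \<phi>_out c by (intro triangular_transport_by_parts[OF c_pos T d\<phi> continuous_on_subset[OF cg\<phi>]]) auto
    have cR: "continuous_on ?Q R" unfolding R_def
      by (intro continuous_intros c\<phi> continuous_on_subset[OF cg\<phi>] T'(1,3)) auto
    have ckT: "continuous_on ?Q (\<lambda>x. k (T x) * f x)" and cdT: "continuous_on ?Q (\<lambda>x. d (T x) * f x)"
      by (intro continuous_intros f continuous_on_compose2[OF ck[of UNIV] T'(1)] continuous_on_compose2[OF cd[of UNIV] T'(1)]; simp)+
    let ?lhs = "\<lambda>x. (if x \<in> L then ?e x else 0) + k (T x) * f x"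
    let ?rhs = "\<lambda>x. R x + P * (d (T x) * f x) + 1 / (2 * C) * (if x \<in> L then u x * (norm (?a x))\<^sup>2 else 0)
       + B * (f x - (if x \<in> L then u x else 0)) + (2 * A + B * M) * ((if x \<in> L then 1 else 0) - (if x \<in> K then 1 else 0))"
    have "?lhs x \<le> ?rhs x" if x: "x \<in> ?Q" for x
    proof (cases "x \<in> L")
      case True
      let ?r = "u x" and ?q = "?p (T x)"
      have "f x = g (T x) * (\<Prod>i\<in>UNIV. D i x)" by (rule T'(6)[OF x])
      also have "\<dots> \<le> v ?q * (\<Prod>i\<in>UNIV. D i x)"
        using fg(3) T'(4)[OF _ x] by (intro mult_right_mono prod_nonneg) (auto simp: less_imp_le)
      \<comment> \<open>projecting \<open>T x\<close> to \<open>L\<close> only helps, because \<open>g\<close> lies below \<open>v\<close> at the projected point\<close>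
      finally have J: "u x / v ?q \<le> (\<Prod>i\<in>UNIV. D i x)"
        using fg(1)[OF True] v(2)[OF pin] by (simp add: divide_le_eq mult.commute)
      have "?e x + u x * (U (v ?q) / v ?q) \<le>
        (w x * U (u x) * ((\<Sum>i\<in>UNIV. D i x) - N) + (U (u x) *\<^sub>R G x + (w x * dU (u x)) *\<^sub>R gu x) \<bullet> (T x - x))
        + P * (u x * norm (T x - ?q)) + 1 / (2 * C) * (u x * (norm (?a x))\<^sup>2)
        + (2 * A + B * M) * indicator (- K) x"
      proof (rule entropy_pointwise)
        show "V x + W x \<bullet> (?q - x) + C / 2 * (norm (?q - x))\<^sup>2 \<le> - ((H (v ?q) + U (v ?q)) / v ?q)"
          using W(2)[OF True pin[of "T x"]] V[OF pin] by simp
        show "norm (U (u x) *\<^sub>R G x + (w x * dU (u x)) *\<^sub>R gu x) \<le> P * u x"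
          using P[OF True] by (simp add: g\<phi>_def)
        show "1 - w x \<le> indicator (- K) x" using w(3)[of x] w(5)[of x] by (cases "x \<in> K") auto
      qed (use N_card uL[OF True] v(2)[OF pin] T'(4)[OF _ x] J C w(3,4) w(8)[OF True pin] A[OF True] B[OF pin] M[OF True] in auto)
      then show ?thesis using True fg(1)[OF True] KL N_card
        by (auto simp: R_def \<phi>_def g\<phi>_def k_def d_def mult.commute split: if_splits)
    next
      case False
      then have "x \<notin> K" using KL by blast
      moreover have "R x = 0" using \<phi>_out[OF False] by (simp add: R_def)
      moreover have "k (T x) * f x \<le> B * f x" using kB f(2) by (intro mult_right_mono) (auto simp: less_imp_le)
      moreover have "0 \<le> P * (d (T x) * f x)" using P0 d0 f(2) by (simp add: less_imp_le)
      ultimately show ?thesis using False by simp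
    qed
    note pointwise = this
    note ints = integrable_continuous[OF cR] integrable_continuous[OF ckT] integrable_continuous[OF cdT]
      integrable_continuous[OF f(1)] ext_int[OF L(1) LQ ce] ext_int[OF L(1) LQ ca] ext_int[OF L(1) LQ cuL]
      ext_int[OF L(1) LQ continuous_on_const[of _ 1]] ext_int[OF K(1) KQ continuous_on_const[of _ 1]]
    have "(?lhs has_integral (integral L ?e + integral ?Q (\<lambda>x. k (T x) * f x))) ?Q"
      unfolding ext_eq[OF L(1) LQ ce, symmetric]
      by (intro has_integral_add integrable_integral ints)
    moreover have "(?rhs has_integral (integral ?Q R + P * integral ?Q (\<lambda>x. d (T x) * f x) + 1 / (2 * C) * ?I
      + B * (integral ?Q f - integral L u) + (2 * A + B * M) * ?E)) ?Q"
      unfolding ext_eq[OF L(1) LQ ca, symmetric] ext_eq[OF L(1) LQ cuL, symmetric]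
        ext_eq[OF L(1) LQ continuous_on_const[of _ 1], symmetric] ext_eq[OF K(1) KQ continuous_on_const[of _ 1], symmetric]
      by (intro has_integral_add has_integral_diff has_integral_mult_right integrable_integral ints)
    ultimately have main: "integral L ?e + integral ?Q (\<lambda>x. k (T x) * f x) \<le>
      integral ?Q R + P * integral ?Q (\<lambda>x. d (T x) * f x) + 1 / (2 * C) * ?I
      + B * (integral ?Q f - integral L u) + (2 * A + B * M) * ?E"
      by (rule has_integral_le) (rule pointwise)
    have "integral ?Q (\<lambda>x. k (T x) * f x) = integral ?Q (\<lambda>x. k x * g x)" by (rule T'(7)[OF ck])
    moreover have "integral L (\<lambda>x. U (v x)) \<le> integral ?Q (\<lambda>x. k x * g x)"
      unfolding ext_eq[OF L(1) LQ cUv, symmetric]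
    proof (rule integral_le)
      show "(\<lambda>x. if x \<in> L then U (v x) else 0) integrable_on ?Q" by (rule ext_int[OF L(1) LQ cUv])
      show "(\<lambda>x. k x * g x) integrable_on ?Q" by (intro integrable_continuous continuous_intros ck g)
      fix x show "(if x \<in> L then U (v x) else 0) \<le> k x * g x"
      proof (cases "x \<in> L")
        case True
        then show ?thesis using fg(2)[OF True] v(2)[OF True] by (simp add: k_def closest_point_self)
      next
        case False
        then show ?thesis using mult_nonneg_nonneg[OF k0 less_imp_le[OF g(2)]] by simp
      qed
    qed
    moreover have "integral ?Q (\<lambda>x. d (T x) * f x) \<le> E * \<delta>"
    proof -
      have "integral ?Q (\<lambda>x. d (T x) * f x) = integral ?Q (\<lambda>x. d x * g x)" by (rule T'(7)[OF cd])
      also have "\<dots> \<le> integral ?Q (\<lambda>x. E * (g x - (if x \<in> L then v x else 0)))"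
      proof (rule integral_le)
        show "(\<lambda>x. d x * g x) integrable_on ?Q" by (intro integrable_continuous continuous_intros cd g)
        show "(\<lambda>x. E * (g x - (if x \<in> L then v x else 0))) integrable_on ?Q"
          by (intro integrable_on_mult_right integrable_diff integrable_continuous g ext_int[OF L(1) LQ v(1)])
        fix x assume "x \<in> ?Q"
        then show "d x * g x \<le> E * (g x - (if x \<in> L then v x else 0))"
          using fg(2)[of x] dL[of x] E g(2)[of x] by (auto intro: mult_right_mono)
      qed
      also have "\<dots> = E * (integral ?Q g - integral L v)"
        unfolding ext_eq[OF L(1) LQ v(1), symmetric]
        by (simp add: integral_diff integrable_continuous[OF g(1)] ext_int[OF L(1) LQ v(1)])
      also have "\<dots> \<le> E * \<delta>" using fg(5) E(2) by (intro mult_left_mono) auto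
      finally show ?thesis .
    qed
    then have "P * integral ?Q (\<lambda>x. d (T x) * f x) \<le> P * (E * \<delta>)" using P0 by (rule mult_left_mono)
    moreover have "B * (integral ?Q f - integral L u) \<le> B * \<delta>"
      using fg(4,5) mass order_trans[OF k0 kB] by (intro mult_left_mono) auto
    ultimately show ?thesis using main R0 by (simp add: algebra_simps)
  qed
  have lim: "integral L ?e + integral L (\<lambda>x. U (v x)) \<le> 1 / (2 * C) * ?I + (2 * A + B * M) * ?E"
  proof (rule field_le_epsilon)
    fix \<epsilon> :: real assume "0 < \<epsilon>"
    have pe: "0 < P * E + B + 1" using P0 E(2) order_trans[OF k0 kB] by (intro add_nonneg_pos add_nonneg_nonneg) auto
    have "(P * E + B) * (\<epsilon> / (P * E + B + 1)) \<le> \<epsilon>" using pe \<open>0 < \<epsilon>\<close> by (simp add: divide_le_eq algebra_simps)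
    then show "integral L ?e + integral L (\<lambda>x. U (v x)) \<le> 1 / (2 * C) * ?I + (2 * A + B * M) * ?E + \<epsilon>"
      using step[of "\<epsilon> / (P * E + B + 1)"] pe \<open>0 < \<epsilon>\<close> by fastforce
  qed
  have nonneg: "0 \<le> H (u x) + u x * V x + U (v x)" if "x \<in> L" for x
    using H_tangent[OF uL[OF that] v(2)[OF that]] V[OF that] by simp
  have "integral K (\<lambda>x. H (u x) + u x * V x + U (v x)) \<le> integral L (\<lambda>x. ?e x + U (v x))"
  proof -
    have c1: "continuous_on L (\<lambda>x. H (u x) + u x * V x + U (v x))" "continuous_on L (\<lambda>x. ?e x + U (v x))"
      by (intro continuous_intros cHu cuL cV cUv cw)+
    show ?thesis
      unfolding ext_eq[OF K(1) KQ continuous_on_subset[OF c1(1) KL], symmetric] ext_eq[OF L(1) LQ c1(2), symmetric]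
    proof (rule integral_le[OF ext_int[OF K(1) KQ continuous_on_subset[OF c1(1) KL]] ext_int[OF L(1) LQ c1(2)]])
      fix x
      have "0 \<le> ?e x + U (v x)" if "x \<in> L"
      proof -
        have "0 \<le> w x * (H (u x) + u x * V x + U (v x))" using nonneg[OF that] w(3) by simp
        also have "\<dots> = ?e x + w x * U (v x)" by (simp add: algebra_simps)
        also have "\<dots> \<le> ?e x + 1 * U (v x)"
          using w(4) U_nonneg v(2) that by (intro add_left_mono mult_right_mono) auto
        finally show ?thesis by simp
      qed
      then show "(if x \<in> K then H (u x) + u x * V x + U (v x) else 0) \<le> (if x \<in> L then ?e x + U (v x) else 0)"
        using w(5)[of x] KL by auto
    qed
  qed
  also have "\<dots> = integral L ?e + integral L (\<lambda>x. U (v x))"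
    by (intro integral_add integrable_on_compact L ce cUv)
  finally show ?thesis using lim by simp
qed

end

section \<open>Consequences of strict convexity of the entropy density\<close>

lemma strictly_convex_imp_convex_on:
  assumes "strictly_convex_on S f" shows "convex_on S f"
proof (rule convex_onI)
  fix t :: real and x y assume *: "0 < t" "t < 1" "x \<in> S" "y \<in> S"
  show "f ((1 - t) *\<^sub>R x + t *\<^sub>R y) \<le> (1 - t) * f x + t * f y"
  proof (cases "x = y")
    case True
    have "(1 - t) *\<^sub>R x + t *\<^sub>R x = x" by (simp add: scaleR_left_distrib[symmetric])
    then show ?thesis using True by (simp add: algebra_simps)
  qed (use assms * in \<open>auto simp: strictly_convex_on_def intro!: less_imp_le\<close>)
qed (use assms in \<open>simp add: strictly_convex_on_def\<close>)

text \<open>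
  Passage from the hypotheses of the theorem to pointwise calculus on \<open>{0<..}\<close>. The value of
  \<open>H\<close> at \<open>0\<close> enters through the tangent at \<open>r\<close>: evaluated at \<open>0\<close>, it gives \<open>U(r) \<ge> 0\<close>.
\<close>
locale entropy_density =
  fixes H :: "real \<Rightarrow> real"
  assumes H_convex: "strictly_convex_on {0..} H"
    and H_smooth: "smooth_real_on {0<..} H"
    and H_zero: "H 0 = 0"
begin

lemma deriv_funpow_DERIV:
  assumes "0 < r"
  shows "((deriv ^^ n) H has_real_derivative (deriv ^^ Suc n) H r) (at r)"
proof -
  have "(deriv ^^ n) H differentiable (at r)"
    using assms H_smooth unfolding smooth_real_on_def by blast
  then have "((deriv ^^ n) H has_real_derivative deriv ((deriv ^^ n) H) r) (at r)"
    by (simp only: DERIV_deriv_iff_real_differentiable)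
  then show ?thesis by (simp only: funpow.simps o_def)
qed

lemma psi_eq_deriv: "psi_of H = deriv H"
  by (rule ext) (rule psi_of_def)

lemma H_DERIV: "0 < r \<Longrightarrow> (H has_real_derivative psi_of H r) (at r)"
  using deriv_funpow_DERIV[of r 0] unfolding psi_eq_deriv funpow.simps o_def id_def .

lemma psi_DERIV: "0 < r \<Longrightarrow> (psi_of H has_real_derivative deriv (psi_of H) r) (at r)"
  using deriv_funpow_DERIV[of r "Suc 0"] unfolding psi_eq_deriv funpow.simps o_def id_def .

lemma dpsi_DERIV: "0 < r \<Longrightarrow> (deriv (psi_of H) has_real_derivative deriv (deriv (psi_of H)) r) (at r)"
  using deriv_funpow_DERIV[of r "Suc (Suc 0)"] unfolding psi_eq_deriv funpow.simps o_def id_def .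

lemma ddpsi_DERIV: "0 < r \<Longrightarrow> (deriv (deriv (psi_of H)) has_real_derivative deriv (deriv (deriv (psi_of H))) r) (at r)"
  using deriv_funpow_DERIV[of r "Suc (Suc (Suc 0))"] unfolding psi_eq_deriv funpow.simps o_def id_def .

lemma above_tangent:
  assumes "0 < s" "0 \<le> r"
  shows "psi_of H s * (r - s) \<le> H r - H s"
proof (rule convex_on_imp_above_tangent[of "{0..}"])
  show "convex_on {0..} H" by (rule strictly_convex_imp_convex_on[OF H_convex])
  show "s \<in> interior {0..}" using assms by (simp add: interior_Ici)
  show "(H has_field_derivative psi_of H s) (at s within {0..})"
    using H_DERIV[OF assms(1)] by (rule has_field_derivative_at_within)
qed (use assms in auto)

text \<open>
  The tangent inequalities give monotonicity only; strictness comes from strict convexity at the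
  midpoint.
\<close>
lemma psi_strict_mono:
  assumes "0 < r" "r < s" shows "psi_of H r < psi_of H s"
proof -
  have "psi_of H r * ((1 - 1/2) *\<^sub>R r + (1/2) *\<^sub>R s - r) \<le> H ((1 - 1/2) *\<^sub>R r + (1/2) *\<^sub>R s) - H r"
    using assms by (intro above_tangent) auto
  moreover have "H ((1 - 1/2) *\<^sub>R r + (1/2) *\<^sub>R s) < (1 - 1/2) * H r + (1/2) * H s"
    using H_convex[unfolded strictly_convex_on_def, THEN conjunct2, rule_format, of r s "1 / 2"] assms by simp
  ultimately have "psi_of H r * (s - r) < H s - H r" by (simp add: algebra_simps)
  also have "\<dots> \<le> psi_of H s * (s - r)" using above_tangent[of s r] assms by (simp add: algebra_simps)
  finally show ?thesis using assms by simp
qed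

lemma psi_less_iff:
  assumes "0 < r" "0 < s"
  shows "psi_of H r < psi_of H s \<longleftrightarrow> r < s"
proof
  assume "psi_of H r < psi_of H s"
  then show "r < s" using psi_strict_mono[of s r] assms(2) by (metis less_asym less_irrefl linorder_neqE)
qed (rule psi_strict_mono[OF assms(1)])

lemma psi_le_iff: "0 < r \<Longrightarrow> 0 < s \<Longrightarrow> psi_of H r \<le> psi_of H s \<longleftrightarrow> r \<le> s"
  using psi_less_iff[of s r] by (simp only: linorder_not_less[symmetric])

lemma U_DERIV: "0 < r \<Longrightarrow> (U_of H has_real_derivative r * deriv (psi_of H) r) (at r)"
proof -
  assume r: "0 < r"
  have "((\<lambda>x. x * psi_of H x - H x) has_real_derivative 1 * psi_of H r + deriv (psi_of H) r * r - psi_of H r) (at r)"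
    by (intro DERIV_diff DERIV_mult DERIV_ident psi_DERIV H_DERIV r)
  moreover have "U_of H = (\<lambda>x. x * psi_of H x - H x)" by (rule ext) (simp only: U_of_def psi_of_def)
  ultimately show ?thesis by (simp add: mult.commute)
qed

lemma mccann_entropy_of:
  assumes "0 < N" and "\<And>r. 0 < r \<Longrightarrow> 0 \<le> U2_of H r + 1 / real N * U_of H r"
  shows "mccann_entropy H (U_of H) (\<lambda>r. r * deriv (psi_of H) r) N"
proof
  fix r :: real assume r: "0 < r"
  have "(H r + U_of H r) / r = psi_of H r" using r by (simp add: U_of_def psi_of_def)
  then show "(H has_real_derivative (H r + U_of H r) / r) (at r)" using H_DERIV[OF r] by simp
  show "(U_of H has_real_derivative r * deriv (psi_of H) r) (at r)" by (rule U_DERIV[OF r])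
  show "0 \<le> U_of H r" using above_tangent[OF r, of 0] H_zero by (simp add: U_of_def psi_of_def mult.commute)
  show "0 \<le> r * (r * deriv (psi_of H) r) - U_of H r + U_of H r / real N"
    using assms(2)[OF r] DERIV_imp_deriv[OF U_DERIV[OF r]] by (simp add: U2_of_def)
  fix s :: real assume s: "0 < s"
  have "(H s + U_of H s) / s = psi_of H s" using s by (simp add: U_of_def psi_of_def)
  then show "0 \<le> H r - r * ((H s + U_of H s) / s) + U_of H s"
    using above_tangent[OF s, of r] r by (simp add: U_of_def psi_of_def algebra_simps)
next
  show "continuous_on {0<..} (\<lambda>r. r * deriv (psi_of H) r)"
    using dpsi_DERIV by (intro continuous_intros continuous_at_imp_continuous_on) (auto intro: DERIV_isCont)
qed (rule assms(1))

end

section \<open>Gradients, Hessians and strong concavity\<close>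

lemma has_derivative_gradient:
  fixes f :: "real ^ 'n::finite \<Rightarrow> real"
  assumes "f differentiable (at x)"
  shows "(f has_derivative (\<lambda>h. gradient f x \<bullet> h)) (at x)"
proof -
  let ?D = "frechet_derivative f (at x)"
  have D: "(f has_derivative ?D) (at x)" using assms by (simp add: frechet_derivative_works[symmetric])
  have "?D h = gradient f x \<bullet> h" for h
  proof -
    have "(\<Sum>i\<in>UNIV. h $ i *\<^sub>R axis i 1) = h" using basis_expansion[of h] by (simp add: scalar_mult_eq_scaleR)
    then have "?D h = ?D (\<Sum>i\<in>UNIV. h $ i *\<^sub>R axis i 1)" by (simp only:)
    also have "\<dots> = (\<Sum>i\<in>UNIV. h $ i * ?D (axis i 1))"
      using has_derivative_linear[OF D] by (simp add: linear_sum linear_cmul)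
    finally show ?thesis by (simp add: gradient_def partial_deriv_def inner_vec_def mult.commute)
  qed
  then have "?D = (\<lambda>h. gradient f x \<bullet> h)" by (rule ext)
  with D show ?thesis by simp
qed

lemma gradient_eqI:
  assumes "(f has_derivative (\<lambda>h. G \<bullet> h)) (at x)"
  shows "gradient f x = (G :: real ^ 'n::finite)"
proof -
  have "frechet_derivative f (at x) = (\<lambda>h. G \<bullet> h)" using frechet_derivative_at[OF assms] by simp
  then show ?thesis by (simp add: gradient_def partial_deriv_def vec_eq_iff inner_axis)
qed

lemma partial_deriv_eqI:
  assumes "(f has_derivative (\<lambda>h. G \<bullet> h)) (at (x :: real ^ 'n::finite))"
  shows "partial_deriv i f x = G $ i"
  using gradient_eqI[OF assms] by (simp add: gradient_def vec_eq_iff)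

lemma partial_deriv_cong_open:
  assumes "open A" "x \<in> A" "\<And>y. y \<in> A \<Longrightarrow> f y = g y" and g: "g differentiable (at x)"
  shows "f differentiable (at x)" "partial_deriv i f x = partial_deriv i g x"
proof -
  have "(f has_derivative (\<lambda>h. gradient g x \<bullet> h)) (at x)"
    by (rule has_derivative_transform_within_open[OF has_derivative_gradient[OF g] assms(1,2)])
       (simp add: assms(3))
  then show "f differentiable (at x)" "partial_deriv i f x = partial_deriv i g x"
    by (auto simp: differentiable_def partial_deriv_eqI gradient_def)
qed

lemma smooth_up_to_boundary_differentiable:
  assumes "smooth_up_to_boundary S f" "x \<in> interior S"
  shows "f differentiable (at x)" "partial_deriv i f differentiable (at x)"
    "partial_deriv i (partial_deriv j f) differentiable (at x)"
proof -
  have *: "partial_derivs is f differentiable (at x)" for "is"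
    using assms unfolding smooth_up_to_boundary_def by blast
  show "f differentiable (at x)" "partial_deriv i f differentiable (at x)"
    "partial_deriv i (partial_deriv j f) differentiable (at x)"
    using *[of "[]"] *[of "[i]"] *[of "[i, j]"] by (simp_all add: partial_derivs_def)
qed

lemma continuous_on_of_differentiable:
  assumes "\<And>x. x \<in> A \<Longrightarrow> f differentiable (at x)" shows "continuous_on A f"
  using assms by (intro continuous_at_imp_continuous_on) (auto intro: differentiable_imp_continuous_within)

lemma smooth_up_to_boundary_continuous_gradient:
  assumes "smooth_up_to_boundary S f"
  shows "continuous_on (interior S) (gradient f)"
  unfolding gradient_def[abs_def]
  by (intro continuous_on_vec_lambda continuous_on_of_differentiable smooth_up_to_boundary_differentiable[OF assms])

lemma has_derivative_real_comp:
  fixes v :: "real ^ 'n::finite \<Rightarrow> real"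
  assumes "v differentiable (at x)" "(p has_real_derivative p') (at (v x))"
  shows "((\<lambda>y. p (v y)) has_derivative (\<lambda>h. (p' *\<^sub>R gradient v x) \<bullet> h)) (at x)"
  using has_derivative_compose[OF has_derivative_gradient[OF assms(1)] assms(2)[unfolded has_field_derivative_def]]
  by simp

text \<open>
  The Hessian on a set is defined through limits of second partial derivatives, so it is their
  continuity that identifies it with the classical Hessian at interior points.
\<close>
lemma comp_twice_differentiable:
  fixes v :: "real ^ 'n::finite \<Rightarrow> real"
  assumes v: "smooth_up_to_boundary S v" "\<And>x. x \<in> interior S \<Longrightarrow> 0 < v x"
    and p: "\<And>r. 0 < r \<Longrightarrow> (p has_real_derivative p1 r) (at r)"
      "\<And>r. 0 < r \<Longrightarrow> (p1 has_real_derivative p2 r) (at r)"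
      "\<And>r. 0 < r \<Longrightarrow> (p2 has_real_derivative p3 r) (at r)"
  defines "f \<equiv> \<lambda>y. p (v y)"
  shows "\<And>x. x \<in> interior S \<Longrightarrow> f differentiable (at x)"
    and "\<And>x j. x \<in> interior S \<Longrightarrow> partial_deriv j f differentiable (at x)"
    and "\<And>i j. continuous_on (interior S) (partial_deriv i (partial_deriv j f))"
proof -
  note dv = smooth_up_to_boundary_differentiable[OF v(1)]
  have df: "(f has_derivative (\<lambda>h. (p1 (v x) *\<^sub>R gradient v x) \<bullet> h)) (at x)" if "x \<in> interior S" for x
    unfolding f_def by (rule has_derivative_real_comp[OF dv(1)[OF that] p(1)[OF v(2)[OF that]]])
  show "f differentiable (at x)" if "x \<in> interior S" for x using df[OF that] by (auto simp: differentiable_def)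
  have pf: "partial_deriv j f x = p1 (v x) * partial_deriv j v x" if "x \<in> interior S" for x j
    using partial_deriv_eqI[OF df[OF that]] by (simp add: gradient_def)
  have dpf: "((\<lambda>x. p1 (v x) * partial_deriv j v x) has_derivative
     (\<lambda>h. (p1 (v x) *\<^sub>R gradient (partial_deriv j v) x + (partial_deriv j v x * p2 (v x)) *\<^sub>R gradient v x) \<bullet> h)) (at x)"
    if "x \<in> interior S" for x j
    using has_derivative_mult[OF has_derivative_real_comp[OF dv(1)[OF that] p(2)[OF v(2)[OF that]]]
        has_derivative_gradient[OF dv(2)[OF that, of j]]]
    by (rule has_derivative_eq_rhs) (simp add: fun_eq_iff inner_add_left)
  have dpf': "(\<lambda>x. p1 (v x) * partial_deriv j v x) differentiable (at x)" if "x \<in> interior S" for x j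
    using dpf[OF that] by (auto simp: differentiable_def)
  show "partial_deriv j f differentiable (at x)" if "x \<in> interior S" for x j
    by (rule partial_deriv_cong_open(1)[OF open_interior that pf dpf'[OF that]])
  have ppf: "partial_deriv i (partial_deriv j f) x =
      p1 (v x) * partial_deriv i (partial_deriv j v) x + partial_deriv j v x * p2 (v x) * partial_deriv i v x"
    if "x \<in> interior S" for x i j
    using partial_deriv_cong_open(2)[OF open_interior that pf dpf'[OF that]] partial_deriv_eqI[OF dpf[OF that]]
    by (simp add: gradient_def)
  have cv: "continuous_on (interior S) v" by (intro continuous_on_of_differentiable dv)
  have c1: "continuous_on {0<..} p1" and c2: "continuous_on {0<..} p2"
    using p(2,3) by (auto intro!: continuous_at_imp_continuous_on intro: DERIV_isCont)
  have "continuous_on (interior S) (\<lambda>x. p1 (v x) * partial_deriv i (partial_deriv j v) x + partial_deriv j v x * p2 (v x) * partial_deriv i v x)" for i j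
    by (intro continuous_intros continuous_on_compose2[OF c1 cv] continuous_on_compose2[OF c2 cv] continuous_on_of_differentiable dv)
       (auto simp: v(2))
  then show "continuous_on (interior S) (partial_deriv i (partial_deriv j f))" for i j
    by (rule continuous_on_eq) (simp add: ppf)
qed

text \<open>Taylor's formula of order two along the segment, which stays in the interior by convexity.\<close>
lemma strongly_concave_of_hessian:
  fixes f :: "real ^ 'n::finite \<Rightarrow> real"
  assumes S: "convex S"
    and f: "\<And>x. x \<in> interior S \<Longrightarrow> f differentiable (at x)"
      "\<And>x j. x \<in> interior S \<Longrightarrow> partial_deriv j f differentiable (at x)"
      "\<And>i j. continuous_on (interior S) (partial_deriv i (partial_deriv j f))"
    and hess: "\<And>x. x \<in> interior S \<Longrightarrow> loewner_le (C *\<^sub>R mat 1) (- hessian_on S f x)"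
    and xy: "x \<in> interior S" "y \<in> interior S"
  shows "f y \<le> f x + gradient f x \<bullet> (y - x) - C / 2 * (norm (y - x))\<^sup>2"
proof -
  let ?h = "y - x"
  let ?z = "\<lambda>t. x + t *\<^sub>R ?h"
  define \<gamma>2 where "\<gamma>2 t = (\<Sum>j\<in>UNIV. ?h $ j * (gradient (partial_deriv j f) (?z t) \<bullet> ?h))" for t
  have z: "?z t \<in> interior S" if "0 \<le> t" "t \<le> 1" for t
  proof -
    have "?z t = (1 - t) *\<^sub>R x + t *\<^sub>R y" by (simp add: algebra_simps)
    then show ?thesis using convexD_alt[OF convex_interior[OF S] xy that] by simp
  qed
  have dz: "(?z has_derivative (\<lambda>s. s *\<^sub>R ?h)) (at t)" for t by (auto intro!: derivative_eq_intros)
  have along: "((\<lambda>t. k (?z t)) has_real_derivative gradient k (?z t) \<bullet> ?h) (at t)"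
    if "k differentiable (at (?z t))" for k t
  proof -
    have "(\<lambda>s. gradient k (?z t) \<bullet> (s *\<^sub>R ?h)) = (*) (gradient k (?z t) \<bullet> ?h)" by (simp add: fun_eq_iff)
    then show ?thesis
      using has_derivative_compose[OF dz has_derivative_gradient[OF that]]
      by (simp only: has_field_derivative_def)
  qed
  define dd where "dd m t = (if m = 0 then f (?z t) else if m = 1 then gradient f (?z t) \<bullet> ?h else \<gamma>2 t)" for m :: nat and t
  have d0: "((\<lambda>t. f (?z t)) has_real_derivative gradient f (?z t) \<bullet> ?h) (at t)" if "0 \<le> t" "t \<le> 1" for t
    by (intro along f z that)
  have d1: "((\<lambda>t. gradient f (?z t) \<bullet> ?h) has_real_derivative \<gamma>2 t) (at t)" if "0 \<le> t" "t \<le> 1" for t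
  proof -
    have "(\<lambda>t. gradient f (?z t) \<bullet> ?h) = (\<lambda>t. \<Sum>j\<in>UNIV. ?h $ j * partial_deriv j f (?z t))"
      by (simp add: fun_eq_iff inner_vec_def gradient_def mult.commute)
    then show ?thesis unfolding \<gamma>2_def
      by (auto intro!: DERIV_sum DERIV_cmult along f z that)
  qed
  have "\<exists>t>0. t < 1 \<and> f (?z 1) = (\<Sum>m<2. dd m 0 / fact m * 1 ^ m) + dd 2 t / fact 2 * 1 ^ 2"
  proof (rule Maclaurin)
    show "dd 0 = (\<lambda>t. f (?z t))" by (simp add: dd_def fun_eq_iff)
    show "\<forall>m t. m < 2 \<and> 0 \<le> t \<and> t \<le> 1 \<longrightarrow> (dd m has_real_derivative dd (Suc m) t) (at t)"
      using d0 d1 by (auto simp: dd_def[abs_def] less_2_cases_iff)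
  qed auto
  then obtain t where t: "0 < t" "t < 1" and eq: "f y = f x + gradient f x \<bullet> ?h + \<gamma>2 t / 2"
    by (auto simp: dd_def numeral_2_eq_2)
  let ?w = "?z t"
  have w: "?w \<in> interior S" using z t by simp
  have hij: "hessian_on S f ?w $ i $ j = partial_deriv i (partial_deriv j f) ?w" for i j
  proof -
    have "isCont (partial_deriv i (partial_deriv j f)) ?w"
      using f(3) w by (simp add: continuous_on_eq_continuous_at)
    then have "(partial_derivs [i, j] f \<longlongrightarrow> partial_deriv i (partial_deriv j f) ?w) (at ?w within interior S)"
      unfolding at_within_open[OF w open_interior] isCont_def by (simp add: partial_derivs_def)
    moreover have "at ?w within interior S \<noteq> bot" using at_within_open[OF w open_interior] by simp
    ultimately show ?thesis unfolding hessian_on_def by (simp add: tendsto_Lim)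
  qed
  have "0 \<le> ?h \<bullet> ((- hessian_on S f ?w - C *\<^sub>R mat 1) *v ?h)"
    using hess[OF w] unfolding loewner_le_def by blast
  also have "(- hessian_on S f ?w - C *\<^sub>R mat 1) *v ?h = (0 - hessian_on S f ?w - C *\<^sub>R mat 1) *v ?h" by simp
  also have "\<dots> = - (hessian_on S f ?w *v ?h) - C *\<^sub>R ?h"
    unfolding matrix_vector_mult_diff_rdistrib scaleR_matrix_vector_assoc[symmetric] by simp
  also have "?h \<bullet> (- (hessian_on S f ?w *v ?h) - C *\<^sub>R ?h) = - (?h \<bullet> (hessian_on S f ?w *v ?h)) - C * (?h \<bullet> ?h)"
    by (simp add: inner_diff_right)
  also have "?h \<bullet> (hessian_on S f ?w *v ?h) = \<gamma>2 t"
    unfolding \<gamma>2_def inner_vec_def matrix_vector_mult_def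
    by (simp add: hij gradient_def sum_distrib_left) (subst sum.swap, simp add: mult_ac)
  finally have "\<gamma>2 t \<le> - C * (norm ?h)\<^sup>2" by (simp add: power2_norm_eq_inner)
  then show ?thesis unfolding eq by simp
qed

section \<open>Exhaustion by compact convex sets and balancing of masses\<close>

text \<open>Passage from gauge integrals over compact sets to Lebesgue integrals.\<close>
lemma nn_integral_compact:
  fixes h :: "'a::euclidean_space \<Rightarrow> real"
  assumes K: "compact K" and h: "continuous_on K h" "\<And>x. x \<in> K \<Longrightarrow> 0 \<le> h x"
  shows "(\<integral>\<^sup>+x\<in>K. ennreal (h x) \<partial>lborel) = ennreal (integral K h)"
proof -
  have i: "integrable lborel (\<lambda>x. indicator K x *\<^sub>R h x)" by (rule borel_integrable_compact[OF K h(1)])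
  have "(\<integral>\<^sup>+x\<in>K. ennreal (h x) \<partial>lborel) = (\<integral>\<^sup>+x. ennreal (indicator K x *\<^sub>R h x) \<partial>lborel)"
    by (intro nn_integral_cong) (auto simp: indicator_def)
  also have "\<dots> = ennreal (\<integral>x. indicator K x *\<^sub>R h x \<partial>lborel)"
    using h(2) by (intro nn_integral_eq_integral[OF i] AE_I2) (auto simp: indicator_def)
  also have "(\<integral>x. indicator K x *\<^sub>R h x \<partial>lborel) = integral K h"
    using set_borel_integral_eq_integral(2)[of K h] i by (simp add: set_integrable_def set_lebesgue_integral_def)
  finally show ?thesis .
qed

lemma neighbourhood_shrink:
  fixes A :: "'a::euclidean_space set"
  assumes A: "compact A" "convex A" "A \<noteq> {}"
  defines "L \<equiv> \<lambda>e. {x. norm (x - closest_point A x) \<le> e}"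
  shows "(\<lambda>k. integral (L (1 / real (Suc k))) (\<lambda>_. 1) - integral A (\<lambda>_. 1::real)) \<longlonglongrightarrow> 0"
proof -
  have cl: "closed A" and bd: "bounded A" using A(1) by (auto simp: compact_eq_bounded_closed)
  have cL: "compact (L e)" for e unfolding L_def by (rule compact_neighbourhood[OF cl A(2,3) bd])
  have mono: "L e \<subseteq> L e'" if "e \<le> e'" for e e' using that by (auto simp: L_def)
  obtain c where "L 1 \<subseteq> box (- c) c" using bounded_subset_box_symmetric compact_imp_bounded cL by blast
  then have c: "L 1 \<subseteq> cbox (- c) c" using box_subset_cbox by blast
  have AL: "A \<subseteq> L e" if "0 \<le> e" for e using that by (auto simp: L_def closest_point_self)
  have Lk: "L (1 / real (Suc k)) \<subseteq> cbox (- c) c" for k using mono[of "1 / real (Suc k)" 1] c by auto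
  have Ac: "A \<subseteq> cbox (- c) c" using AL[of 1] c by simp
  let ?f = "\<lambda>k x. if x \<in> L (1 / real (Suc k)) then 1 else 0 :: real"
  have int: "?f k integrable_on cbox (- c) c" for k
    using integrable_on_compact[OF cL, of "1 / real (Suc k)" "\<lambda>_. 1"] Lk[of k]
    by (simp add: integrable_restrict_Int Int_absorb2)
  have lim: "(\<lambda>k. ?f k x) \<longlonglongrightarrow> (if x \<in> A then 1 else 0)" for x
  proof (cases "x \<in> A")
    case True
    have "x \<in> L (1 / real (Suc k))" for k using AL[of "1 / real (Suc k)"] True by auto
    then show ?thesis using True by simp
  next
    case False
    then have "closest_point A x \<noteq> x" using closest_point_in_set[OF cl A(3), of x] by auto
    then have "0 < norm (x - closest_point A x)" by simp
    then have "eventually (\<lambda>k. 1 / real (Suc k) < norm (x - closest_point A x)) sequentially"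
      by (intro order_tendstoD(2)[OF LIMSEQ_Suc[OF lim_1_over_n]])
    then have "eventually (\<lambda>k. ?f k x = 0) sequentially" by eventually_elim (auto simp: L_def)
    then show ?thesis using False by (simp add: tendsto_eventually)
  qed
  have "(\<lambda>k. integral (cbox (- c) c) (?f k)) \<longlonglongrightarrow> integral (cbox (- c) c) (\<lambda>x. if x \<in> A then 1 else 0)"
    by (rule dominated_convergence(2)[OF int integrable_const[of 1] _ lim]) auto
  then have "(\<lambda>k. integral (L (1 / real (Suc k))) (\<lambda>_. 1)) \<longlonglongrightarrow> integral A (\<lambda>_. 1::real)"
    using Lk Ac by (simp add: integral_restrict_Int Int_absorb2)
  then show ?thesis using LIM_zero by (intro LIM_zero) 
qed

text \<open>
  The sets are \<open>{x. cball x (r / (n + 1)) \<subseteq> S}\<close>, cut off by growing balls: an intersection of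
  translates of \<open>S\<close> is closed and convex. A common box inside all of them ensures that they have
  volume bounded below.
\<close>
lemma convex_exhaustion:
  fixes S :: "'a::euclidean_space set"
  assumes S: "closed S" "convex S" "interior S \<noteq> {}"
  obtains A :: "nat \<Rightarrow> 'a set" and \<rho> a b where
    "\<And>n. compact (A n)" "\<And>n. convex (A n)" "\<And>n. cbox a b \<subseteq> A n" "box a b \<noteq> {}" "\<And>n. 0 < \<rho> n"
    "\<And>n. {x. norm (x - closest_point (A n) x) \<le> \<rho> n} \<subseteq> interior S"
    "\<And>x. x \<in> interior S \<Longrightarrow> \<forall>\<^sub>F n in sequentially. x \<in> A n"
proof -
  obtain x0 where x0: "x0 \<in> interior S" using S(3) by blast
  obtain a b where ab: "x0 \<in> box a b" "cbox a b \<subseteq> interior S"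
    using open_contains_cbox[OF open_interior x0] by metis
  obtain r where r: "0 < r" "(\<Union>x\<in>cbox a b. cball x r) \<subseteq> interior S"
    using compact_subset_open_imp_cball_epsilon_subset[OF compact_cbox open_interior ab(2)] by blast
  obtain R where R: "cbox a b \<subseteq> cball x0 R"
    using bounded_subset_ballD[OF bounded_cbox] ball_subset_cball by (metis order_trans)
  define A where "A n = cball x0 (R + real n) \<inter> (\<Inter>z\<in>cball 0 (r / real (Suc n)). (\<lambda>x. x + z) -` S)" for n
  have Amem: "x \<in> A n \<longleftrightarrow> x \<in> cball x0 (R + real n) \<and> cball x (r / real (Suc n)) \<subseteq> S" for x n
  proof -
    have "(\<forall>z\<in>cball 0 (r / real (Suc n)). x + z \<in> S) \<longleftrightarrow> cball x (r / real (Suc n)) \<subseteq> S"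
    proof safe
      fix y assume "\<forall>z\<in>cball 0 (r / real (Suc n)). x + z \<in> S" "y \<in> cball x (r / real (Suc n))"
      then show "y \<in> S" by (auto simp: dist_norm norm_minus_commute dest!: bspec[of _ _ "y - x"])
    next
      fix z :: 'a assume "cball x (r / real (Suc n)) \<subseteq> S" "z \<in> cball 0 (r / real (Suc n))"
      then show "x + z \<in> S" by (auto simp: dist_norm subset_iff)
    qed
    then show ?thesis by (simp add: A_def)
  qed
  have clA: "closed (A n)" for n unfolding A_def
    by (intro closed_Int closed_cball closed_INT ballI closed_vimage S continuous_intros)
  show thesis
  proof (rule that[of A a b "\<lambda>n. r / real (Suc n) / 2"])
    show "compact (A n)" for n unfolding compact_eq_bounded_closed
      using clA[of n] by (auto simp: A_def intro: bounded_subset[OF bounded_cball])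
    show "convex (A n)" for n unfolding A_def
    proof (intro convex_Int convex_cball convex_INT)
      fix z :: 'a assume "z \<in> cball 0 (r / real (Suc n))"
      have "(\<lambda>x. x + z) -` S = (+) (- z) ` S" by (force simp: image_iff add.commute)
      then show "convex ((\<lambda>x. x + z) -` S)" using convex_translation[OF S(2)] by simp
    qed
    show sub: "cbox a b \<subseteq> A n" for n
    proof
      fix x assume x: "x \<in> cbox a b"
      have "cball x (r / real (Suc n)) \<subseteq> cball x r" using r(1) by (intro subset_cball) (simp add: divide_le_eq)
      also have "\<dots> \<subseteq> S" using r(2) x interior_subset by blast
      finally show "x \<in> A n" using x R unfolding Amem by (auto simp: subset_iff intro: order_trans)
    qed
    show "box a b \<noteq> {}" using ab(1) by blast
    show "0 < r / real (Suc n) / 2" for n using r(1) by simp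
    show "{x. norm (x - closest_point (A n) x) \<le> r / real (Suc n) / 2} \<subseteq> interior S" for n
    proof clarify
      fix x assume x: "norm (x - closest_point (A n) x) \<le> r / real (Suc n) / 2"
      have "A n \<noteq> {}" using sub[of n] ab(1) box_subset_cbox by blast
      then have "closest_point (A n) x \<in> A n" by (rule closest_point_in_set[OF clA])
      then have "cball (closest_point (A n) x) (r / real (Suc n)) \<subseteq> S" by (simp add: Amem)
      moreover have "ball x (r / real (Suc n) / 2) \<subseteq> cball (closest_point (A n) x) (r / real (Suc n))"
      proof
        fix y assume "y \<in> ball x (r / real (Suc n) / 2)"
        then have "dist (closest_point (A n) x) y \<le> r / real (Suc n) / 2 + r / real (Suc n) / 2"
          using x dist_triangle[of "closest_point (A n) x" y x] by (simp add: dist_norm norm_minus_commute)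
        then show "y \<in> cball (closest_point (A n) x) (r / real (Suc n))"
          unfolding field_sum_of_halves mem_cball .
      qed
      ultimately have "ball x (r / real (Suc n) / 2) \<subseteq> S" by (rule order_trans[rotated])
      then show "x \<in> interior S" unfolding mem_interior using r(1) by (intro exI[of _ "r / real (Suc n) / 2"]) simp
    qed
    fix x assume x: "x \<in> interior S"
    obtain e where e: "0 < e" "cball x e \<subseteq> S" using x by (auto simp: mem_interior_cball)
    have "(\<lambda>n. r / real (Suc n)) \<longlonglongrightarrow> 0" by (rule LIMSEQ_Suc) (rule lim_const_over_n)
    then have "eventually (\<lambda>n. r / real (Suc n) < e) sequentially" using e(1) by (rule order_tendstoD)
    moreover have "eventually (\<lambda>n. dist x0 x - R < real n) sequentially"
      using filterlim_real_sequentially unfolding filterlim_at_top_dense by blast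
    ultimately show "\<forall>\<^sub>F n in sequentially. x \<in> A n"
    proof eventually_elim
      case (elim n)
      have "cball x (r / real (Suc n)) \<subseteq> cball x e" using elim by (intro subset_cball) simp
      then show ?case using elim e(2) by (auto simp: Amem)
    qed
  qed
qed

text \<open>
  On \<open>K n\<close> the masses of \<open>u\<close> and \<open>v\<close> differ by a quantity that tends to \<open>0\<close>, whereas a shift by \<open>\<eta>\<close> in
  either direction changes the mass of \<open>v\<close> by at least its change on the fixed box. The intermediate
  value theorem gives a balancing shift within \<open>{-\<eta>..\<eta>}\<close>, for arbitrarily small \<open>\<eta>\<close>.
\<close>
lemma mass_balance:
  fixes u v :: "'a::euclidean_space \<Rightarrow> real" and vc :: "real \<Rightarrow> 'a \<Rightarrow> real"
  assumes u: "u integrable_on Om" "\<And>x. x \<in> Om \<Longrightarrow> 0 < u x" "continuous_on Om u"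
    and v: "v integrable_on Om" "\<And>x. x \<in> Om \<Longrightarrow> 0 < v x" "continuous_on Om v"
    and mass: "integral Om u = integral Om v"
    and K: "\<And>n. compact (K n)" "\<And>n. K n \<subseteq> Om" "\<And>n. cbox a b \<subseteq> K n" "box a b \<noteq> {}"
      "\<And>x. x \<in> Om \<Longrightarrow> \<forall>\<^sub>F n in sequentially. x \<in> K n"
    and \<eta>: "0 < \<eta>"
    and vc: "continuous_on (Om \<times> {-\<eta>..\<eta>}) (\<lambda>(x, c). vc c x)"
      "\<And>x. x \<in> Om \<Longrightarrow> vc (-\<eta>) x < v x" "\<And>x. x \<in> Om \<Longrightarrow> v x < vc \<eta> x"
  shows "\<forall>\<^sub>F n in sequentially. \<exists>c\<in>{-\<eta>..\<eta>}. integral (K n) (vc c) = integral (K n) u"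
proof -
  have cvc: "continuous_on Om (vc c)" if "c \<in> {-\<eta>..\<eta>}" for c
    using that by (intro continuous_on_compose2[OF vc(1), of _ "\<lambda>x. (x, c)", simplified] continuous_intros) auto
  have Kint: "h integrable_on K n" if "continuous_on Om h" for h :: "'a \<Rightarrow> real" and n
    by (rule integrable_on_compact[OF K(1) continuous_on_subset[OF that K(2)]])
  have "(\<lambda>n. integral Om (\<lambda>x. if x \<in> K n then u x - v x else 0)) \<longlonglongrightarrow> integral Om (\<lambda>x. u x - v x)"
  proof (rule dominated_convergence(2)[where h = "\<lambda>x. u x + v x"])
    show "(\<lambda>x. if x \<in> K n then u x - v x else 0) integrable_on Om" for n
      using Kint[of "\<lambda>x. u x - v x" n] K(2)[of n] u(3) v(3)
      by (simp add: integrable_restrict_Int Int_absorb2 continuous_on_diff)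
    show "(\<lambda>x. u x + v x) integrable_on Om" by (intro integrable_add u v)
    show "norm (if x \<in> K n then u x - v x else 0) \<le> u x + v x" if "x \<in> Om" for n x
      using u(2)[OF that] v(2)[OF that] by auto
    show "(\<lambda>n. if x \<in> K n then u x - v x else 0) \<longlonglongrightarrow> u x - v x" if "x \<in> Om" for x
      by (rule tendsto_eventually[OF eventually_mono[OF K(5)[OF that]]]) simp
  qed
  moreover have "integral Om (\<lambda>x. u x - v x) = 0" using mass by (simp add: integral_diff u v)
  moreover have "integral Om (\<lambda>x. if x \<in> K n then u x - v x else 0) = integral (K n) u - integral (K n) v" for n
    using K(2)[of n] by (simp add: integral_restrict_Int Int_absorb2 integral_diff Kint u v)
  ultimately have lim: "(\<lambda>n. integral (K n) u - integral (K n) v) \<longlonglongrightarrow> 0" by simp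
  have gap: "0 < integral (cbox a b) h" "\<And>n. integral (cbox a b) h \<le> integral (K n) h"
    if h: "continuous_on Om h" "\<And>x. x \<in> Om \<Longrightarrow> 0 < h x" for h :: "'a \<Rightarrow> real"
  proof -
    have BO: "cbox a b \<subseteq> Om" using K(2,3) by blast
    have ch: "continuous_on (cbox a b) h" by (rule continuous_on_subset[OF h(1) BO])
    obtain z where z: "z \<in> cbox a b" using K(4) box_subset_cbox[of a b] by blast
    have "0 \<le> h x" if "x \<in> cbox a b" for x using h(2) BO that by (meson less_imp_le subsetD)
    from integral_cbox_eq_0_iff[OF ch K(4) this] have "integral (cbox a b) h \<noteq> 0"
      using h(2)[of z] BO z by (metis less_irrefl subsetD)
    moreover have "0 \<le> integral (cbox a b) h"
      using h(2) BO by (intro integral_nonneg integrable_continuous ch) (auto simp: less_imp_le subset_iff)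
    ultimately show "0 < integral (cbox a b) h" by simp
    show "integral (cbox a b) h \<le> integral (K n) h" for n
      using h(2) K(2)[of n] by (intro integral_subset_le K(3) integrable_continuous ch Kint h) (auto simp: less_imp_le)
  qed
  have \<eta>in: "\<eta> \<in> {-\<eta>..\<eta>}" "-\<eta> \<in> {-\<eta>..\<eta>}" using \<eta> by auto
  define \<rho>1 where "\<rho>1 = integral (cbox a b) (\<lambda>x. vc \<eta> x - v x)"
  define \<rho>2 where "\<rho>2 = integral (cbox a b) (\<lambda>x. v x - vc (-\<eta>) x)"
  have c1: "continuous_on Om (\<lambda>x. vc \<eta> x - v x)" and c2: "continuous_on Om (\<lambda>x. v x - vc (-\<eta>) x)"
    by (intro continuous_on_diff cvc \<eta>in v)+
  have p1: "0 < vc \<eta> x - v x" and p2: "0 < v x - vc (-\<eta>) x" if "x \<in> Om" for x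
    using vc(2,3)[OF that] by simp_all
  have \<rho>1: "0 < \<rho>1" "\<rho>1 \<le> integral (K n) (vc \<eta>) - integral (K n) v" for n
    using gap(1)[OF c1 p1] gap(2)[OF c1 p1, of n] integral_diff[OF Kint[OF cvc[OF \<eta>in(1)]] Kint[OF v(3)], of n]
    unfolding \<rho>1_def by simp_all
  have \<rho>2: "0 < \<rho>2" "\<rho>2 \<le> integral (K n) v - integral (K n) (vc (-\<eta>))" for n
    using gap(1)[OF c2 p2] gap(2)[OF c2 p2, of n] integral_diff[OF Kint[OF v(3)] Kint[OF cvc[OF \<eta>in(2)]], of n]
    unfolding \<rho>2_def by simp_all
  have "\<forall>\<^sub>F n in sequentially. integral (K n) u - integral (K n) v < \<rho>1"
    by (rule order_tendstoD(2)[OF lim \<rho>1(1)])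
  moreover have "\<forall>\<^sub>F n in sequentially. - \<rho>2 < integral (K n) u - integral (K n) v"
    using \<rho>2(1) by (intro order_tendstoD(1)[OF lim]) simp
  ultimately show ?thesis
  proof eventually_elim
    case (elim n)
    obtain B where B: "\<forall>z\<in>K n \<times> {-\<eta>..\<eta>}. norm (vc (snd z) (fst z)) \<le> B"
    proof -
      have "compact ((\<lambda>z. vc (snd z) (fst z)) ` (K n \<times> {-\<eta>..\<eta>}))"
        using vc(1) K(2)[of n] by (intro compact_continuous_image compact_Times K compact_Icc)
          (auto simp: split_beta intro: continuous_on_subset)
      then obtain B where "\<forall>y\<in>(\<lambda>z. vc (snd z) (fst z)) ` (K n \<times> {-\<eta>..\<eta>}). norm y \<le> B"
        using compact_imp_bounded bounded_iff by metis
      then show thesis by (intro that[of B]) simp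
    qed
    have "continuous_on {-\<eta>..\<eta>} (\<lambda>c. integral (K n) (vc c))"
      unfolding continuous_on_sequentially
    proof (intro allI ballI impI)
      fix c :: "nat \<Rightarrow> real" and c0 assume c: "c0 \<in> {-\<eta>..\<eta>}" "(\<forall>k. c k \<in> {-\<eta>..\<eta>}) \<and> c \<longlonglongrightarrow> c0"
      show "((\<lambda>c. integral (K n) (vc c)) \<circ> c) \<longlonglongrightarrow> integral (K n) (vc c0)"
        unfolding o_def
      proof (rule dominated_convergence(2)[where h = "\<lambda>_. B"])
        show "vc (c k) integrable_on K n" for k using c by (intro Kint cvc) auto
        show "(\<lambda>_. B) integrable_on K n" by (intro integrable_on_compact K continuous_intros)
        show "norm (vc (c k) x) \<le> B" if "x \<in> K n" for k x using B c(2) that by force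
        show "(\<lambda>k. vc (c k) x) \<longlonglongrightarrow> vc c0 x" if "x \<in> K n" for x
        proof -
          have "continuous_on {-\<eta>..\<eta>} (\<lambda>c. vc c x)"
            using that K(2)[of n] by (intro continuous_on_compose2[OF vc(1), of _ "\<lambda>c. (x, c)", simplified] continuous_intros) auto
          then show ?thesis using c unfolding continuous_on_sequentially o_def by blast
        qed
      qed
    qed
    then have "\<exists>c\<ge>-\<eta>. c \<le> \<eta> \<and> integral (K n) (vc c) = integral (K n) u"
      using elim \<rho>1(2)[of n] \<rho>2(2)[of n] \<eta> by (intro IVT') auto
    then obtain c where "-\<eta> \<le> c" "c \<le> \<eta>" "integral (K n) (vc c) = integral (K n) u" by blast
    then show ?case by (intro bexI[of _ c]) auto
  qed
qed

section \<open>Shifting the potential by a constant\<close>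

context entropy_density
begin

lemma psi_inverse_exists:
  obtains g where "continuous_on (psi_of H ` {0<..}) g" "\<And>r. 0 < r \<Longrightarrow> g (psi_of H r) = r"
proof -
  have c: "continuous_on {0<..} (psi_of H)"
    using psi_DERIV by (intro continuous_at_imp_continuous_on) (auto intro: DERIV_isCont)
  have "inj_on (psi_of H) {0<..}" 
    by (intro linorder_inj_onI) (metis greaterThan_iff less_irrefl psi_strict_mono, auto)
  then obtain g where "homeomorphism {0<..} (psi_of H ` {0<..}) (psi_of H) g"
    using injective_into_1d_eq_homeomorphism[OF c convex_imp_path_connected[OF convex_real_interval(3)]] by blast
  then show thesis by (intro that[of g]) (auto simp: homeomorphism_def)
qed

lemma psi_image_interval:
  assumes "0 < r1" "0 < r2" "psi_of H r1 \<le> s" "s \<le> psi_of H r2"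
  shows "s \<in> psi_of H ` {0<..}"
proof -
  have "psi_of H r1 \<le> psi_of H r2" using assms by simp
  then have le: "r1 \<le> r2" using psi_le_iff assms by blast
  have "continuous_on {r1..r2} (psi_of H)"
    using assms by (intro continuous_at_imp_continuous_on) (auto intro!: DERIV_isCont[OF psi_DERIV])
  then have "\<exists>r\<ge>r1. r \<le> r2 \<and> psi_of H r = s" using assms le by (intro IVT') auto
  then show ?thesis using assms by auto
qed

text \<open>
  A shift of \<open>\<psi>(v)\<close> by a small constant stays within the range of \<open>\<psi>\<close>, uniformly over an unbounded
  domain. Upwards: strong concavity makes \<open>\<psi>(v)\<close> small far away, so \<open>v\<close> is bounded. Downwards: either
  \<open>\<psi>\<close> is unbounded below, or \<open>\<psi>(v)\<close> is bounded below, and then strong concavity confines the interior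
  of \<open>S\<close> to a ball, on which \<open>v\<close> has a positive minimum.
\<close>
lemma potential_range:
  fixes S :: "'a::euclidean_space set"
  assumes S: "closed S" and x0: "x0 \<in> interior S"
    and v: "continuous_on S v" "\<And>x. x \<in> S \<Longrightarrow> 0 < v x" and C: "0 < C"
    and concave: "\<And>y. y \<in> interior S \<Longrightarrow>
      psi_of H (v y) \<le> psi_of H (v x0) + g \<bullet> (y - x0) - C / 2 * (norm (y - x0))\<^sup>2"
  obtains \<eta> where "0 < \<eta>"
    "\<And>x c. x \<in> interior S \<Longrightarrow> c \<in> {-\<eta>..\<eta>} \<Longrightarrow> psi_of H (v x) + c \<in> psi_of H ` {0<..}"
proof -
  \<comment> \<open>the radius is chosen so that the quadratic term dominates the linear one and the gap to \<open>\<beta>\<close>\<close>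
  have coercive: "psi_of H (v y) \<le> \<beta>" if y: "y \<in> interior S" and far: "R < norm (y - x0)"
    and R: "R = 1 + 2 / C * (norm g + \<bar>psi_of H (v x0) - \<beta>\<bar>)" for y R \<beta>
  proof -
    let ?r = "norm (y - x0)"
    have r1: "1 \<le> ?r" using far R C by (smt (verit) divide_nonneg_pos mult_nonneg_nonneg norm_ge_zero)
    have "norm g + \<bar>psi_of H (v x0) - \<beta>\<bar> \<le> C / 2 * ?r" using far C unfolding R by (simp add: field_simps)
    then have "(norm g + \<bar>psi_of H (v x0) - \<beta>\<bar>) * ?r \<le> C / 2 * ?r * ?r" by (rule mult_right_mono) simp
    moreover have "\<bar>psi_of H (v x0) - \<beta>\<bar> * 1 \<le> \<bar>psi_of H (v x0) - \<beta>\<bar> * ?r" using r1 by (intro mult_left_mono) auto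
    moreover have "g \<bullet> (y - x0) \<le> norm g * ?r" by (rule norm_cauchy_schwarz)
    ultimately show ?thesis using concave[OF y] by (simp add: power2_eq_square algebra_simps)
  qed
  have comp: "compact (S \<inter> cball x0 R)" for R using S by (intro closed_Int_compact) auto
  have x0S: "x0 \<in> S" using x0 interior_subset by blast
  obtain vm where vm: "0 < vm" "\<And>x. x \<in> interior S \<Longrightarrow> v x \<le> vm"
  proof -
    define R where "R = 1 + 2 / C * (norm g + \<bar>psi_of H (v x0) - psi_of H (v x0)\<bar>)"
    have R0: "0 \<le> R" using C by (simp add: R_def)
    have "\<exists>z\<in>S \<inter> cball x0 R. \<forall>y\<in>S \<inter> cball x0 R. v y \<le> v z"
      using x0S R0 by (intro continuous_attains_sup[OF comp] continuous_on_subset[OF v(1)]) auto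
    then obtain z where z: "z \<in> S" "\<And>y. y \<in> S \<Longrightarrow> dist x0 y \<le> R \<Longrightarrow> v y \<le> v z" by auto
    show thesis
    proof (rule that[of "v z"])
      show "0 < v z" by (rule v(2)[OF z(1)])
      fix x assume x: "x \<in> interior S"
      then have xS: "x \<in> S" using interior_subset by blast
      show "v x \<le> v z"
      proof (cases "dist x0 x \<le> R")
        case False
        then have "psi_of H (v x) \<le> psi_of H (v x0)"
          by (intro coercive[OF x _ R_def]) (simp add: dist_norm norm_minus_commute)
        then have "v x \<le> v x0" using psi_le_iff v(2) x0S xS by blast
        also have "\<dots> \<le> v z" using z(2)[OF x0S] R0 by simp
        finally show ?thesis .
      qed (use z(2)[OF xS] in blast)
    qed
  qed
  obtain \<eta>1 where \<eta>1: "0 < \<eta>1" "\<And>x. x \<in> interior S \<Longrightarrow> \<exists>y>0. psi_of H y \<le> psi_of H (v x) - \<eta>1"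
  proof (cases "\<exists>\<beta>. \<forall>y>0. \<beta> \<le> psi_of H y")
    case False
    then have "\<exists>y>0. psi_of H y \<le> psi_of H (v x) - 1" for x by (meson not_le less_imp_le)
    then show thesis by (intro that[of 1]) auto
  next
    case True
    then obtain \<beta> where \<beta>: "\<And>y. 0 < y \<Longrightarrow> \<beta> \<le> psi_of H y" by blast
    define R where "R = 1 + 2 / C * (norm g + \<bar>psi_of H (v x0) - (\<beta> - 1)\<bar>)"
    have R0: "0 \<le> R" using C by (simp add: R_def)
    have "\<exists>z\<in>S \<inter> cball x0 R. \<forall>y\<in>S \<inter> cball x0 R. v z \<le> v y"
      using x0S R0 by (intro continuous_attains_inf[OF comp] continuous_on_subset[OF v(1)]) auto
    then obtain z where z: "z \<in> S" "\<And>y. y \<in> S \<Longrightarrow> dist x0 y \<le> R \<Longrightarrow> v z \<le> v y" by auto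
    have vz: "0 < v z" by (rule v(2)[OF z(1)])
    show thesis
    proof (rule that[of "psi_of H (v z) - psi_of H (v z / 2)"])
      show "0 < psi_of H (v z) - psi_of H (v z / 2)" using vz psi_strict_mono[of "v z / 2" "v z"] by simp
      fix x assume x: "x \<in> interior S"
      then have xS: "x \<in> S" using interior_subset by blast
      have "dist x0 x \<le> R"
      proof (rule ccontr)
        assume "\<not> dist x0 x \<le> R"
        then have "psi_of H (v x) \<le> \<beta> - 1"
          by (intro coercive[OF x _ R_def]) (simp add: dist_norm norm_minus_commute)
        then show False using \<beta>[OF v(2)[OF xS]] by simp
      qed
      then have "psi_of H (v z) \<le> psi_of H (v x)" using z(2)[OF xS] psi_le_iff[OF vz v(2)[OF xS]] by simp
      then show "\<exists>y>0. psi_of H y \<le> psi_of H (v x) - (psi_of H (v z) - psi_of H (v z / 2))"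
        using vz by (intro exI[of _ "v z / 2"]) auto
    qed
  qed
  define \<eta>2 where "\<eta>2 = psi_of H (vm + 1) - psi_of H vm"
  have \<eta>2: "0 < \<eta>2" using psi_strict_mono[of vm "vm + 1"] vm(1) by (simp add: \<eta>2_def)
  show thesis
  proof (rule that[of "min \<eta>1 \<eta>2"])
    show "0 < min \<eta>1 \<eta>2" using \<eta>1(1) \<eta>2 by simp
    fix x c assume x: "x \<in> interior S" and c: "c \<in> {- min \<eta>1 \<eta>2..min \<eta>1 \<eta>2}"
    then have xS: "x \<in> S" using interior_subset by blast
    obtain y where y: "0 < y" "psi_of H y \<le> psi_of H (v x) - \<eta>1" using \<eta>1(2)[OF x] by blast
    have "psi_of H (v x) \<le> psi_of H vm" using psi_le_iff[OF v(2)[OF xS] vm(1)] vm(2)[OF x] by simp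
    then show "psi_of H (v x) + c \<in> psi_of H ` {0<..}"
      using c y vm(1) by (intro psi_image_interval[of y "vm + 1"]) (auto simp: \<eta>2_def)
  qed
qed

end

section \<open>The entropy inequality\<close>

text \<open>
  The bounds that multiply the volume of the boundary layer are uniform over the shifts \<open>c\<close>. Hence
  one thickness \<open>e\<close> makes the error small for every shift, before the balancing shift, which depends
  on \<open>e\<close>, has been chosen.
\<close>
lemma entropy_inequality_near_compact:
  fixes A :: "(real ^ 'n::finite) set" and H :: "real \<Rightarrow> real"
    and u v F :: "real ^ 'n \<Rightarrow> real" and W gu :: "real ^ 'n \<Rightarrow> real ^ 'n" and vc :: "real \<Rightarrow> real ^ 'n \<Rightarrow> real"
  assumes M: "mccann_entropy H U dU (CARD('n))"
    and A: "compact A" "convex A" "A \<noteq> {}" and \<rho>: "0 < \<rho>"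
    and Om: "open Om" "{x. norm (x - closest_point A x) \<le> \<rho>} \<subseteq> Om"
    and u: "\<And>x. x \<in> Om \<Longrightarrow> 0 < u x" "\<And>x. x \<in> Om \<Longrightarrow> (u has_derivative (\<lambda>h. gu x \<bullet> h)) (at x)"
      "continuous_on Om gu"
    and vc: "continuous_on (Om \<times> {-\<eta>..\<eta>}) (\<lambda>(x, c). vc c x)"
      "\<And>x c. x \<in> Om \<Longrightarrow> c \<in> {-\<eta>..\<eta>} \<Longrightarrow> 0 < vc c x"
      "\<And>x c. x \<in> Om \<Longrightarrow> c \<in> {-\<eta>..\<eta>} \<Longrightarrow> (H (vc c x) + U (vc c x)) / vc c x = F x + c"
    and W: "continuous_on Om W"
      "\<And>x y. x \<in> Om \<Longrightarrow> y \<in> Om \<Longrightarrow> F y \<le> F x - W x \<bullet> (y - x) - C / 2 * (norm (y - x))\<^sup>2"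
    and C: "0 < C" and \<delta>: "0 < \<delta>"
  shows "\<exists>e. 0 < e \<and> e \<le> \<rho> \<and> (\<forall>c\<in>{-\<eta>..\<eta>}.
      integral {x. norm (x - closest_point A x) \<le> e} u = integral {x. norm (x - closest_point A x) \<le> e} (vc c) \<longrightarrow>
      integral A (\<lambda>x. H (u x) + u x * (- (F x + c)) + U (vc c x)) \<le>
        1 / (2 * C) * integral {x. norm (x - closest_point A x) \<le> e}
            (\<lambda>x. u x * (norm ((dU (u x) / u x) *\<^sub>R gu x + W x))\<^sup>2) + \<delta>)"
proof -
  interpret mccann_entropy H U dU "CARD('n)" by (rule M)
  let ?L = "\<lambda>e. {x. norm (x - closest_point A x) \<le> e}"
  have clA: "closed A" and bdA: "bounded A" using A(1) by (auto simp: compact_eq_bounded_closed)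
  have cL: "compact (?L \<rho>)" by (rule compact_neighbourhood[OF clA A(2,3) bdA])
  have cu: "continuous_on (?L \<rho>) u"
    using u(2) Om(2) by (meson continuous_at_imp_continuous_on has_derivative_continuous subsetD)
  have bound: "\<exists>B. \<forall>x\<in>S. h x \<le> B" if "compact S" "continuous_on S h" for S :: "'z::topological_space set" and h :: "'z \<Rightarrow> real"
    using compact_imp_bounded[OF compact_continuous_image[OF that(2,1)]]
    by (auto simp: bounded_iff) (meson abs_le_D1)
  obtain B1 where B1: "\<And>x. x \<in> ?L \<rho> \<Longrightarrow> U (u x) \<le> B1"
  proof -
    have "continuous_on (?L \<rho>) (\<lambda>x. U (u x))"
      by (rule continuous_on_compose2[OF continuous_on_U cu]) (use u(1) Om(2) in auto)
    then show thesis using bound[OF cL] that by blast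
  qed
  obtain B2 where B2: "\<And>x. x \<in> ?L \<rho> \<Longrightarrow> u x \<le> B2" using bound[OF cL cu] by blast
  obtain B3 where B3: "\<And>x c. x \<in> ?L \<rho> \<Longrightarrow> c \<in> {-\<eta>..\<eta>} \<Longrightarrow> U (vc c x) / vc c x \<le> B3"
  proof -
    let ?Z = "?L \<rho> \<times> {-\<eta>..\<eta>}"
    have cvc: "continuous_on ?Z (\<lambda>z. vc (snd z) (fst z))"
      using vc(1) Om(2) by (auto simp: split_beta intro: continuous_on_subset)
    have pos: "0 < vc (snd z) (fst z)" if "z \<in> ?Z" for z
      using that Om(2) by (intro vc(2)) auto
    have "continuous_on ?Z (\<lambda>z. U (vc (snd z) (fst z)) / vc (snd z) (fst z))"
      using pos by (intro continuous_on_divide continuous_on_compose2[OF continuous_on_U cvc] cvc) force+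
    moreover have "compact ?Z" by (intro compact_Times cL compact_Icc)
    ultimately obtain B where "\<forall>z\<in>?Z. U (vc (snd z) (fst z)) / vc (snd z) (fst z) \<le> B" using bound by blast
    then show thesis by (intro that[of B]) auto
  qed
  define Z where "Z = 2 * B1 + B3 * B2"
  have "(\<lambda>k. Z * (integral (?L (1 / real (Suc k))) (\<lambda>_. 1) - integral A (\<lambda>_. 1::real))) \<longlonglongrightarrow> Z * 0"
    by (intro tendsto_intros neighbourhood_shrink A)
  then have "\<forall>\<^sub>F k in sequentially. Z * (integral (?L (1 / real (Suc k))) (\<lambda>_. 1) - integral A (\<lambda>_. 1::real)) < \<delta>"
    using \<delta> by (intro order_tendstoD(2)) auto
  moreover have "\<forall>\<^sub>F k in sequentially. 1 / real (Suc k) < \<rho>"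
    by (rule order_tendstoD(2)[OF LIMSEQ_Suc[OF lim_1_over_n] \<rho>])
  ultimately have "\<forall>\<^sub>F k in sequentially. Z * (integral (?L (1 / real (Suc k))) (\<lambda>_. 1) - integral A (\<lambda>_. 1::real)) < \<delta> \<and> 1 / real (Suc k) < \<rho>"
    by eventually_elim simp
  then obtain k where k: "Z * (integral (?L (1 / real (Suc k))) (\<lambda>_. 1) - integral A (\<lambda>_. 1::real)) < \<delta>" "1 / real (Suc k) < \<rho>"
    using eventually_happens'[OF sequentially_bot] by blast
  define e where "e = 1 / real (Suc k)"
  have e: "0 < e" "e < \<rho>" using k(2) by (simp_all add: e_def)
  have sub: "?L e \<subseteq> ?L \<rho>" using e(2) by auto
  have subO: "?L e \<subseteq> Om" using sub Om(2) by blast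
  show ?thesis
  proof (intro exI[of _ e] conjI ballI impI)
    show "0 < e" "e \<le> \<rho>" using e by auto
    fix c assume c: "c \<in> {-\<eta>..\<eta>}" and mass: "integral (?L e) u = integral (?L e) (vc c)"
    have cvc: "continuous_on (?L e) (vc c)"
      using c subO by (intro continuous_on_compose2[OF vc(1), of _ "\<lambda>x. (x, c)", simplified] continuous_intros) auto
    have "integral A (\<lambda>x. H (u x) + u x * (- (F x + c)) + U (vc c x)) \<le>
        1 / (2 * C) * integral (?L e) (\<lambda>x. u x * (norm ((dU (u x) / u x) *\<^sub>R gu x + W x))\<^sup>2)
        + (2 * B1 + B3 * B2) * (integral (?L e) (\<lambda>_. 1) - integral A (\<lambda>_. 1))"
    proof (rule bounded_entropy_inequality[OF refl A e(1) Om(1) subO u(1) u(2) u(3) cvc _ _ _ _ C mass])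
      fix x p assume x: "x \<in> ?L e"
      then have xO: "x \<in> Om" using subO by blast
      show "0 < vc c x" by (rule vc(2)[OF xO c])
      show "- (F x + c) = - ((H (vc c x) + U (vc c x)) / vc c x)" by (simp only: vc(3)[OF xO c])
      show "U (u x) \<le> B1" "U (vc c x) / vc c x \<le> B3" "u x \<le> B2" using B1 B2 B3 c x sub by blast+
      assume "p \<in> ?L e"
      then have pO: "p \<in> Om" using subO by blast
      show "- (F x + c) + W x \<bullet> (p - x) + C / 2 * (norm (p - x))\<^sup>2 \<le> - (F p + c)"
        using W(2)[OF xO pO] by simp
    next
      show "continuous_on (?L e) W" by (rule continuous_on_subset[OF W(1) subO])
    qed
    then show "integral A (\<lambda>x. H (u x) + u x * (- (F x + c)) + U (vc c x)) \<le>
        1 / (2 * C) * integral (?L e) (\<lambda>x. u x * (norm ((dU (u x) / u x) *\<^sub>R gu x + W x))\<^sup>2) + \<delta>"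
      using k(1) unfolding Z_def e_def by linarith
  qed
qed

theorem theorem1p3:
  fixes H :: "real \<Rightarrow> real" and S :: "(real ^ 'n::finite) set"
    and v u :: "real ^ 'n \<Rightarrow> real" and C :: real
  assumes H_convex: "strictly_convex_on {0..} H"
    and H_smooth: "smooth_real_on {0<..} H"
    and H_zero: "H 0 = 0"
    and S: "closed S" "convex S"
    and v_smooth: "smooth_up_to_boundary S v"
    and v_pos: "\<And>x. x \<in> S \<Longrightarrow> 0 < v x"
    and v_int: "set_integrable lborel (interior S) v"
    and U_cond: "\<And>r. 0 < r \<Longrightarrow> 0 \<le> U2_of H r + 1 / real CARD('n) * U_of H r"
    and C_pos: "0 < C"
    and hess: "\<And>x. x \<in> S \<Longrightarrow>
      loewner_le (C *\<^sub>R mat 1) (- hessian_on S (\<lambda>y. psi_of H (v y)) x)"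
    and u_smooth: "smooth_up_to_boundary S u"
    and u_pos: "\<And>x. x \<in> S \<Longrightarrow> 0 < u x"
    and u_int: "set_integrable lborel (interior S) u"
    and mass: "(LINT x:interior S|lborel. u x) = (LINT x:interior S|lborel. v x)"
  shows "(\<integral>\<^sup>+x\<in>interior S. ennreal (H (u x) - H (v x) - (u x - v x) * psi_of H (v x)) \<partial>lborel)
    \<le> ennreal (1 / (2 * C)) *
      (\<integral>\<^sup>+x\<in>interior S. ennreal (u x *
          (norm (gradient (\<lambda>y. psi_of H (u y) - psi_of H (v y)) x))\<^sup>2) \<partial>lborel)"
proof (cases "interior S = {}")
  case True
  then show ?thesis by simp
next
  case False
  let ?Om = "interior S"
  interpret E: entropy_density H by unfold_locales (rule H_convex H_smooth H_zero)+
  let ?dU = "\<lambda>r. r * deriv (psi_of H) r"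
  have MC: "mccann_entropy H (U_of H) ?dU (CARD('n))" using U_cond by (intro E.mccann_entropy_of) auto
  interpret M: mccann_entropy H "U_of H" ?dU "CARD('n)" by (rule MC)
  have OmS: "x \<in> S" if "x \<in> ?Om" for x using that interior_subset by blast
  have vO: "0 < v x" and uO: "0 < u x" if "x \<in> ?Om" for x using v_pos u_pos OmS that by auto
  have psi_eq: "(H r + U_of H r) / r = psi_of H r" if "0 < r" for r
    using that by (simp add: U_of_def psi_of_def)
  define F where "F = (\<lambda>y. psi_of H (v y))"
  have F: "\<And>x. x \<in> ?Om \<Longrightarrow> F differentiable (at x)"
    "\<And>x j. x \<in> ?Om \<Longrightarrow> partial_deriv j F differentiable (at x)"
    "\<And>i j. continuous_on ?Om (partial_deriv i (partial_deriv j F))"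
    using comp_twice_differentiable[OF v_smooth vO E.psi_DERIV E.dpsi_DERIV E.ddpsi_DERIV, folded F_def] by blast+
  have concave: "F y \<le> F x + gradient F x \<bullet> (y - x) - C / 2 * (norm (y - x))\<^sup>2" if "x \<in> ?Om" "y \<in> ?Om" for x y
    using hess OmS by (intro strongly_concave_of_hessian[OF S(2) F(1) F(2) F(3) _ that]) (auto simp: F_def)
  have cgF: "continuous_on ?Om (gradient F)"
    unfolding gradient_def[abs_def] by (intro continuous_on_vec_lambda continuous_on_of_differentiable F(2))
  have cF: "continuous_on ?Om F" by (intro continuous_on_of_differentiable F(1))
  have du: "(u has_derivative (\<lambda>h. gradient u x \<bullet> h)) (at x)" if "x \<in> ?Om" for x
    by (rule has_derivative_gradient[OF smooth_up_to_boundary_differentiable(1)[OF u_smooth that]])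
  have cgu: "continuous_on ?Om (gradient u)" by (rule smooth_up_to_boundary_continuous_gradient[OF u_smooth])
  have cvS: "continuous_on S v" and cuS: "continuous_on S u" using v_smooth u_smooth by (auto simp: smooth_up_to_boundary_def)
  have cv: "continuous_on ?Om v" and cu: "continuous_on ?Om u"
    using cvS cuS interior_subset continuous_on_subset by blast+
  have grad: "gradient (\<lambda>y. psi_of H (u y) - psi_of H (v y)) x = (?dU (u x) / u x) *\<^sub>R gradient u x + - gradient F x"
    if x: "x \<in> ?Om" for x
  proof (rule gradient_eqI)
    have "((\<lambda>y. psi_of H (u y)) has_derivative (\<lambda>h. (deriv (psi_of H) (u x) *\<^sub>R gradient u x) \<bullet> h)) (at x)"
      by (rule has_derivative_real_comp[OF smooth_up_to_boundary_differentiable(1)[OF u_smooth x] E.psi_DERIV[OF uO[OF x]]])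
    from has_derivative_diff[OF this has_derivative_gradient[OF F(1)[OF x]]]
    show "((\<lambda>y. psi_of H (u y) - psi_of H (v y)) has_derivative
        (\<lambda>h. ((?dU (u x) / u x) *\<^sub>R gradient u x + - gradient F x) \<bullet> h)) (at x)"
      unfolding F_def by (rule has_derivative_eq_rhs) (use uO[OF x] in \<open>simp add: fun_eq_iff inner_diff_left\<close>)
  qed
  obtain x0 where x0: "x0 \<in> ?Om" using False by blast
  obtain \<eta> where \<eta>: "0 < \<eta>"
    and range: "\<And>x c. x \<in> ?Om \<Longrightarrow> c \<in> {-\<eta>..\<eta>} \<Longrightarrow> psi_of H (v x) + c \<in> psi_of H ` {0<..}"
    using E.potential_range[OF S(1) x0 cvS v_pos C_pos concave[OF x0, unfolded F_def]] by blast
  obtain g where g: "continuous_on (psi_of H ` {0<..}) g" "\<And>r. 0 < r \<Longrightarrow> g (psi_of H r) = r"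
    using E.psi_inverse_exists by blast
  \<comment> \<open>the density whose potential is that of \<open>v\<close> shifted by \<open>c\<close>\<close>
  define vc where "vc c x = g (F x + c)" for c x
  have vc: "0 < vc c x" "psi_of H (vc c x) = F x + c" if xc: "x \<in> ?Om" "c \<in> {-\<eta>..\<eta>}" for x c
  proof -
    obtain r where "0 < r" "F x + c = psi_of H r" using range[OF xc] by (auto simp: F_def)
    then show "0 < vc c x" "psi_of H (vc c x) = F x + c" using g(2) by (auto simp: vc_def)
  qed
  have vc0: "vc 0 x = v x" if "x \<in> ?Om" for x using g(2)[OF vO[OF that]] by (simp add: vc_def F_def)
  have cvc: "continuous_on (?Om \<times> {-\<eta>..\<eta>}) (\<lambda>(x, c). vc c x)"
    unfolding vc_def split_beta using range
    by (intro continuous_on_compose2[OF g(1)] continuous_intros continuous_on_compose2[OF cF]) (auto simp: F_def)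
  have vc_mono: "vc c x < vc c' x" if "x \<in> ?Om" "c \<in> {-\<eta>..\<eta>}" "c' \<in> {-\<eta>..\<eta>}" "c < c'" for x c c'
    using vc[OF that(1,2)] vc[OF that(1,3)] that(4) E.psi_less_iff[of "vc c x" "vc c' x"] by simp
  obtain A \<rho> a b where A: "\<And>n. compact (A n)" "\<And>n. convex (A n)" "\<And>n. cbox a b \<subseteq> A n" "box a b \<noteq> {}" "\<And>n. 0 < \<rho> n"
    "\<And>n. {x. norm (x - closest_point (A n) x) \<le> \<rho> n} \<subseteq> ?Om"
    "\<And>x. x \<in> ?Om \<Longrightarrow> \<forall>\<^sub>F n in sequentially. x \<in> A n"
  proof -
    show thesis by (rule convex_exhaustion[OF S False]) (fact that)
  qed
  have Ane: "A n \<noteq> {}" for n using A(3)[of n] A(4) box_subset_cbox[of a b] by blast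
  let ?L = "\<lambda>n e. {x. norm (x - closest_point (A n) x) \<le> e}"
  let ?a = "\<lambda>x. (?dU (u x) / u x) *\<^sub>R gradient u x + - gradient F x"
  let ?e = "\<lambda>c x. H (u x) + u x * (- (F x + c)) + U_of H (vc c x)"
  define good where "good n e \<longleftrightarrow> 0 < e \<and> e \<le> \<rho> n \<and> (\<forall>c\<in>{-\<eta>..\<eta>}. integral (?L n e) u = integral (?L n e) (vc c) \<longrightarrow>
      integral (A n) (?e c) \<le> 1 / (2 * C) * integral (?L n e) (\<lambda>x. u x * (norm (?a x))\<^sup>2) + 1 / real (Suc n))" for n e
  have "\<exists>e. good n e" for n
    unfolding good_def
  proof (rule entropy_inequality_near_compact[OF MC A(1,2) Ane A(5) open_interior A(6) uO du cgu cvc])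
    show "(H (vc c x) + U_of H (vc c x)) / vc c x = F x + c" if "x \<in> ?Om" "c \<in> {-\<eta>..\<eta>}" for x c
      using psi_eq vc that by simp
    show "F y \<le> F x - - gradient F x \<bullet> (y - x) - C / 2 * (norm (y - x))\<^sup>2" if "x \<in> ?Om" "y \<in> ?Om" for x y
      using concave[OF that] by simp
    show "0 < vc c x" if "x \<in> ?Om" "c \<in> {-\<eta>..\<eta>}" for x c by (rule vc(1)[OF that])
    show "continuous_on ?Om (\<lambda>x. - gradient F x)" by (intro continuous_on_minus cgF)
    show "0 < 1 / real (Suc n)" by simp
  qed (use C_pos in simp_all)
  then obtain \<epsilon> where good: "\<And>n. good n (\<epsilon> n)" by metis
  have \<epsilon>: "\<And>n. 0 < \<epsilon> n" "\<And>n. \<epsilon> n \<le> \<rho> n"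
    and ineq: "\<And>n c. c \<in> {-\<eta>..\<eta>} \<Longrightarrow> integral (?L n (\<epsilon> n)) u = integral (?L n (\<epsilon> n)) (vc c) \<Longrightarrow>
      integral (A n) (?e c) \<le> 1 / (2 * C) * integral (?L n (\<epsilon> n)) (\<lambda>x. u x * (norm (?a x))\<^sup>2) + 1 / real (Suc n)"
    using good unfolding good_def by blast+
  define K where "K n = ?L n (\<epsilon> n)" for n
  have clA: "closed (A n)" and bdA: "bounded (A n)" for n using A(1)[of n] by (auto simp: compact_eq_bounded_closed)
  have cK: "compact (K n)" for n unfolding K_def by (rule compact_neighbourhood[OF clA A(2) Ane bdA])
  have AK: "A n \<subseteq> K n" for n using \<epsilon>(1)[of n] by (auto simp: K_def closest_point_self)
  have KO: "K n \<subseteq> ?Om" for n using A(6)[of n] \<epsilon>(2)[of n] by (auto simp: K_def)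
  have AO: "A n \<subseteq> ?Om" for n using AK KO by blast
  have bal: "\<forall>\<^sub>F n in sequentially. \<exists>c\<in>{-\<kappa>..\<kappa>}. integral (K n) (vc c) = integral (K n) u" if \<kappa>: "0 < \<kappa>" "\<kappa> \<le> \<eta>" for \<kappa>
  proof (rule mass_balance[where Om = ?Om and v = v and a = a and b = b])
    show "u integrable_on ?Om" "v integrable_on ?Om" using u_int v_int set_borel_integral_eq_integral(1) by blast+
    show "integral ?Om u = integral ?Om v"
      using mass set_borel_integral_eq_integral(2)[OF u_int] set_borel_integral_eq_integral(2)[OF v_int] by simp
    show "continuous_on (?Om \<times> {-\<kappa>..\<kappa>}) (\<lambda>(x, c). vc c x)"
      using \<kappa> by (intro continuous_on_subset[OF cvc]) auto
    show "vc (-\<kappa>) x < v x" "v x < vc \<kappa> x" if "x \<in> ?Om" for x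
      using vc_mono[OF that, of "-\<kappa>" 0] vc_mono[OF that, of 0 \<kappa>] vc0[OF that] \<kappa> by auto
    show "\<forall>\<^sub>F n in sequentially. x \<in> K n" if "x \<in> ?Om" for x
      using A(7)[OF that] by eventually_elim (use AK in blast)
    show "cbox a b \<subseteq> K n" for n using A(3) AK by blast
  qed (use uO vO cu cv cK KO A(4) \<kappa> in auto)
  \<comment> \<open>at stage \<open>m\<close> the shift is at most \<open>1 / (m + 1)\<close>, so that the shifted densities converge to \<open>v\<close>\<close>
  define balanced where "balanced m n c \<longleftrightarrow> m \<le> n \<and> c \<in> {-\<eta>..\<eta>} \<and> \<bar>c\<bar> \<le> 1 / real (Suc m) \<and> integral (K n) u = integral (K n) (vc c)" for m n c
  have "\<exists>n c. balanced m n c" for m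
  proof -
    let ?\<kappa> = "min \<eta> (1 / real (Suc m))"
    have "\<forall>\<^sub>F n in sequentially. m \<le> n" by (rule eventually_ge_at_top)
    moreover have "\<forall>\<^sub>F n in sequentially. \<exists>c\<in>{-?\<kappa>..?\<kappa>}. integral (K n) (vc c) = integral (K n) u"
      using \<eta> by (intro bal) auto
    ultimately have "\<forall>\<^sub>F n in sequentially. m \<le> n \<and> (\<exists>c\<in>{-?\<kappa>..?\<kappa>}. integral (K n) (vc c) = integral (K n) u)"
      by eventually_elim simp
    then obtain n c where "m \<le> n" "c \<in> {-?\<kappa>..?\<kappa>}" "integral (K n) (vc c) = integral (K n) u"
      using eventually_happens'[OF sequentially_bot] by blast
    then show ?thesis unfolding balanced_def by (intro exI[of _ n] exI[of _ c]) auto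
  qed
  then obtain N c where balanced: "\<And>m. balanced m (N m) (c m)" by metis
  have N: "\<And>m. m \<le> N m" and c: "\<And>m. c m \<in> {-\<eta>..\<eta>}" "\<And>m. \<bar>c m\<bar> \<le> 1 / real (Suc m)"
    and mK: "\<And>m. integral (K (N m)) u = integral (K (N m)) (vc (c m))"
    using balanced unfolding balanced_def by blast+
  have clim: "c \<longlonglongrightarrow> 0"
    by (rule Lim_null_comparison[OF always_eventually LIMSEQ_Suc[OF lim_1_over_n]])
       (unfold real_norm_def, intro allI c(2))
  define R where "R = ennreal (1 / (2 * C)) * (\<integral>\<^sup>+x\<in>?Om. ennreal (u x *
          (norm (gradient (\<lambda>y. psi_of H (u y) - psi_of H (v y)) x))\<^sup>2) \<partial>lborel)"
  let ?F = "\<lambda>m x. ennreal (?e (c m) x) * indicator (A (N m)) x"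
  have e_nonneg: "0 \<le> ?e d x" if "x \<in> ?Om" "d \<in> {-\<eta>..\<eta>}" for x d
    using M.H_tangent[OF uO[OF that(1)] vc(1)[OF that]] psi_eq[OF vc(1)[OF that]] vc(2)[OF that]
    by (simp only: mult_minus_right diff_conv_add_uminus)
  have ce: "continuous_on (A n) (?e d)" if "d \<in> {-\<eta>..\<eta>}" for n d
  proof -
    have "continuous_on (A n) (vc d)"
      using that AO[of n] by (intro continuous_on_compose2[OF cvc, of _ "\<lambda>x. (x, d)", simplified] continuous_intros) auto
    then have "continuous_on (A n) (\<lambda>x. U_of H (vc d x))"
      by (rule continuous_on_compose2[OF M.continuous_on_U]) (use vc(1) AO that in auto)
    moreover have "continuous_on (A n) (\<lambda>x. H (u x))"
      by (rule continuous_on_compose2[OF M.continuous_on_H continuous_on_subset[OF cu AO]]) (use uO AO in auto)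
    ultimately show ?thesis by (intro continuous_intros continuous_on_subset[OF cu AO] continuous_on_subset[OF cF AO])
  qed
  have step: "(\<integral>\<^sup>+x. ?F m x \<partial>lborel) \<le> R + ennreal (1 / real (Suc m))" for m
  proof -
    have ca: "continuous_on (K (N m)) (\<lambda>x. u x * (norm (?a x))\<^sup>2)"
    proof -
      have "continuous_on ?Om (\<lambda>x. ?dU (u x))"
        by (rule continuous_on_compose2[OF M.dU_cont cu]) (use uO in auto)
      then have "continuous_on ?Om (\<lambda>x. ?dU (u x) / u x)"
        by (rule continuous_on_divide[OF _ cu]) (use uO in \<open>fastforce\<close>)
      then have "continuous_on ?Om (\<lambda>x. u x * (norm (?a x))\<^sup>2)"
        by (intro continuous_on_mult[OF cu] continuous_on_power continuous_on_norm continuous_on_add continuous_on_minus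
          continuous_on_scaleR cgu cgF)
      then show ?thesis by (rule continuous_on_subset[OF _ KO])
    qed
    let ?I = "integral (K (N m)) (\<lambda>x. u x * (norm (?a x))\<^sup>2)"
    have a0: "0 \<le> u x * (norm (?a x))\<^sup>2" if "x \<in> ?Om" for x using uO[OF that] by simp
    have I0: "0 \<le> ?I" using a0 KO by (intro integral_nonneg integrable_on_compact cK ca) blast
    have "(\<integral>\<^sup>+x. ?F m x \<partial>lborel) = ennreal (integral (A (N m)) (?e (c m)))"
      using e_nonneg c(1) AO by (intro nn_integral_compact A(1) ce) blast+
    also have "\<dots> \<le> ennreal (1 / (2 * C) * ?I + 1 / real (Suc (N m)))"
      by (intro ennreal_leI ineq[OF c(1), of "N m" m, folded K_def] mK)
    also have "\<dots> \<le> ennreal (1 / (2 * C) * ?I + 1 / real (Suc m))"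
      using N[of m] by (intro ennreal_leI add_left_mono divide_left_mono) auto
    also have "\<dots> = ennreal (1 / (2 * C)) * ennreal ?I + ennreal (1 / real (Suc m))"
    proof -
      have C0: "0 \<le> 1 / (2 * C)" using C_pos by simp
      show ?thesis
        unfolding ennreal_mult[OF C0 I0, symmetric] by (rule ennreal_plus[OF mult_nonneg_nonneg[OF C0 I0]]) simp
    qed
    also have "ennreal ?I = (\<integral>\<^sup>+x\<in>K (N m). ennreal (u x * (norm (?a x))\<^sup>2) \<partial>lborel)"
      using a0 KO by (intro nn_integral_compact[symmetric] cK ca) blast
    also have "\<dots> \<le> (\<integral>\<^sup>+x\<in>?Om. ennreal (u x * (norm (gradient (\<lambda>y. psi_of H (u y) - psi_of H (v y)) x))\<^sup>2) \<partial>lborel)"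
      using KO[of "N m"] grad by (intro nn_integral_mono) (auto simp: indicator_def)
    finally show ?thesis unfolding R_def by (simp add: mult_left_mono add_right_mono)
  qed
  have meas: "?F m \<in> borel_measurable lborel" for m
  proof -
    have "(\<lambda>x. indicator (A (N m)) x *\<^sub>R ?e (c m) x) \<in> borel_measurable borel"
      using clA c(1) by (intro borel_measurable_continuous_on_indicator ce) auto
    then have "(\<lambda>x. ennreal (indicator (A (N m)) x *\<^sub>R ?e (c m) x)) \<in> borel_measurable lborel" by measurable
    also have "(\<lambda>x. ennreal (indicator (A (N m)) x *\<^sub>R ?e (c m) x)) = ?F m" by (auto simp: indicator_def)
    finally show ?thesis .
  qed
  have pointwise: "ennreal (H (u x) - H (v x) - (u x - v x) * psi_of H (v x)) * indicator ?Om x \<le> liminf (\<lambda>m. ?F m x)" for x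
  proof (cases "x \<in> ?Om")
    case True
    have "(\<lambda>m. vc (c m) x) \<longlonglongrightarrow> vc 0 x"
    proof -
      have "continuous_on {-\<eta>..\<eta>} (\<lambda>d. vc d x)"
        using True by (intro continuous_on_compose2[OF cvc, of _ "\<lambda>d. (x, d)", simplified] continuous_intros) auto
      then show ?thesis using clim c(1) \<eta> unfolding continuous_on_sequentially o_def by auto
    qed
    then have "(\<lambda>m. vc (c m) x) \<longlonglongrightarrow> v x" by (simp add: vc0 True)
    then have "(\<lambda>m. U_of H (vc (c m) x)) \<longlonglongrightarrow> U_of H (v x)"
      using DERIV_isCont[OF M.U_deriv[OF vO[OF True]]] by (rule isCont_tendsto_compose[rotated])
    then have "(\<lambda>m. ?e (c m) x) \<longlonglongrightarrow> H (u x) + u x * (- (F x + 0)) + U_of H (v x)"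
      by (intro tendsto_intros clim)
    then have "(\<lambda>m. ennreal (?e (c m) x)) \<longlonglongrightarrow> ennreal (H (u x) + u x * (- (F x + 0)) + U_of H (v x))"
      by (rule tendsto_ennrealI)
    moreover have "\<forall>\<^sub>F m in sequentially. x \<in> A (N m)"
    proof -
      have "filterlim N at_top sequentially"
        using N by (intro filterlim_at_top_mono[OF filterlim_ident]) auto
      then show ?thesis using A(7)[OF True] by (rule eventually_compose_filterlim[rotated])
    qed
    then have "\<forall>\<^sub>F m in sequentially. ennreal (?e (c m) x) = ?F m x" by eventually_elim simp
    ultimately have "(\<lambda>m. ?F m x) \<longlonglongrightarrow> ennreal (H (u x) + u x * (- (F x + 0)) + U_of H (v x))"
      by (rule Lim_transform_eventually)
    then have "liminf (\<lambda>m. ?F m x) = ennreal (H (u x) + u x * (- (F x + 0)) + U_of H (v x))"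
      by (intro lim_imp_Liminf) auto
    also have "H (u x) + u x * (- (F x + 0)) + U_of H (v x) = H (u x) - H (v x) - (u x - v x) * psi_of H (v x)"
      by (simp add: F_def U_of_def psi_of_def algebra_simps)
    finally show ?thesis using True by simp
  qed simp
  have "(\<integral>\<^sup>+x\<in>?Om. ennreal (H (u x) - H (v x) - (u x - v x) * psi_of H (v x)) \<partial>lborel)
      \<le> (\<integral>\<^sup>+x. liminf (\<lambda>m. ?F m x) \<partial>lborel)"
    by (intro nn_integral_mono pointwise)
  also have "\<dots> \<le> liminf (\<lambda>m. \<integral>\<^sup>+x. ?F m x \<partial>lborel)"
    by (rule nn_integral_liminf[OF meas])
  also have "\<dots> \<le> liminf (\<lambda>m. R + ennreal (1 / real (Suc m)))"
    using step by (intro Liminf_mono) auto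
  also have "\<dots> = R"
  proof -
    have "(\<lambda>m. R + ennreal (1 / real (Suc m))) \<longlonglongrightarrow> R + ennreal 0"
      by (intro tendsto_add tendsto_const tendsto_ennrealI LIMSEQ_Suc[OF lim_1_over_n])
    then show ?thesis by (intro lim_imp_Liminf) auto
  qed
  finally show ?thesis unfolding R_def .
qed

end
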